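(* Let $\phi(z)=\sum_{n=1}^\infty a_nz^n$ be an entire function (vanishing at $0$), and let $\phi^\star(z):=\sum_{n=1}^\infty \frac{a_nz^n}{n\zeta(n+1)}$ be the associated entire function. Suppose the restriction of $\phi$ to $(0,\infty)$ is mellin-proper. Then the Riemann hypothesis holds if and only if for every $\epsilon>0$, $\phi^\star(x)=O_\epsilon(x^{-1/2+\epsilon})$ as $x\to+\infty$.
   Context: For $a\in\mathbb{R}$, $N_a(f):=\int_0^\infty t^{-a-1}|f(t)|\,dt$. The (left-)Mellin transform of $f:(0,\infty)\to\mathbb{C}$ is $f^\wedge(s):=\int_0^\infty t^{-s-1}f(t)\,dt$ where the integral converges absolutely. $\phi$ is called proper if $N_\sigma(\phi)<\infty$ for all $\sigma\in(-\tfrac12,1]$, and mellin-proper if it is proper and $\phi^\wedge(s)\neq0$ for all $s$ with $-\tfrac12<\Re s<0$. *)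

theory Defs
  imports "HOL-Complex_Analysis.Complex_Analysis" "HOL-Library.Landau_Symbols"
begin

text \<open>
  The Riemann zeta function on the punctured plane, as the analytic continuation of its Dirichlet
  series. The continuation is taken through the nested punctured half-planes
  \<open>{z. c < Re z} - {1}\<close>, on each of which it is unique by the identity theorem. The value at the
  pole \<open>s = 1\<close> is unspecified.
\<close>
definition riemann_zeta :: "complex \<Rightarrow> complex" where
  "riemann_zeta s = (THE w. \<exists>c f. c < Re s \<and> f holomorphic_on ({z. c < Re z} - {1}) \<and>
     (\<forall>z. 1 < Re z \<longrightarrow> (\<lambda>n. 1 / of_nat (Suc n) powr z) sums f z) \<and> w = f s)"

lemma riemann_zeta_eqI:
  assumes c: "c < Re s" and s: "s \<noteq> 1"
    and f: "f holomorphic_on ({z. c < Re z} - {1})"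
    and sums: "\<And>z. 1 < Re z \<Longrightarrow> (\<lambda>n. 1 / of_nat (Suc n) powr z) sums f z"
  shows "riemann_zeta s = f s"
proof -
  have "g s = f s" if d: "d < Re s" and g: "g holomorphic_on ({z. d < Re z} - {1})"
    and gs: "\<forall>z. 1 < Re z \<longrightarrow> (\<lambda>n. 1 / of_nat (Suc n) powr z) sums g z" for d g
  proof -
    define e where "e = max c d"
    define S where "S = {z. e < Re z} - {1}"
    define U where "U = {z. max e 1 < Re z}"
    have op: "open {z. e < Re z}" for e by (rule open_halfspace_Re_gt)
    have "connected S" unfolding S_def
      by (intro connected_open_delete op convex_connected convex_halfspace_Re_gt) simp
    moreover have "open S" unfolding S_def by (intro open_delete op)
    moreover have "open U" unfolding U_def by (rule op)
    moreover have "U \<subseteq> S" by (auto simp: S_def U_def)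
    moreover have "complex_of_real (max e 1 + 1) \<in> U" by (auto simp: U_def max_def)
    moreover have "f holomorphic_on S" "g holomorphic_on S"
      by (auto intro!: holomorphic_on_subset[OF f] holomorphic_on_subset[OF g]
               simp: S_def e_def)
    moreover have "s \<in> S" using c d s by (simp add: S_def e_def)
    moreover have "g z = f z" if "z \<in> U" for z
    proof -
      have "1 < Re z" using that by (simp add: U_def)
      then show ?thesis using sums[of z] gs sums_unique2 by blast
    qed
    ultimately show ?thesis
      using analytic_continuation_open[of U S g f s] by blast
  qed
  then show ?thesis
    unfolding riemann_zeta_def using assms by (intro the_equality) blast+
qed

definition riemann_hypothesis :: bool where
  "riemann_hypothesis \<longleftrightarrow>
     (\<forall>s. 0 < Re s \<and> Re s < 1 \<and> riemann_zeta s = 0 \<longrightarrow> Re s = 1 / 2)"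

text \<open>
  Functions on \<open>(0, \<infinity>)\<close> are represented by total functions on the reals; only their values at
  positive arguments are used.
\<close>
definition mellin_norm :: "real \<Rightarrow> (real \<Rightarrow> complex) \<Rightarrow> ennreal" where
  "mellin_norm a f = (\<integral>\<^sup>+t\<in>{0<..}. ennreal (t powr (- a - 1) * norm (f t)) \<partial>lborel)"

text \<open>As a Bochner integral, this is \<open>0\<close> where the defining integral is not absolutely convergent.\<close>
definition mellin :: "(real \<Rightarrow> complex) \<Rightarrow> complex \<Rightarrow> complex" where
  "mellin f s = (LINT t:{0<..}|lborel. complex_of_real t powr (- s - 1) * f t)"

definition proper_fun :: "(real \<Rightarrow> complex) \<Rightarrow> bool" where
  "proper_fun f \<longleftrightarrow> (\<forall>\<sigma>. - 1 / 2 < \<sigma> \<and> \<sigma> \<le> 1 \<longrightarrow> mellin_norm \<sigma> f < \<infinity>)"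

definition mellin_proper :: "(real \<Rightarrow> complex) \<Rightarrow> bool" where
  "mellin_proper f \<longleftrightarrow>
     proper_fun f \<and> (\<forall>s. - 1 / 2 < Re s \<and> Re s < 0 \<longrightarrow> mellin f s \<noteq> 0)"

text \<open>The index is shifted: the term at \<open>n\<close> is the one of degree \<open>n + 1\<close>; \<open>a 0\<close> is not used.\<close>
definition star_series :: "(nat \<Rightarrow> complex) \<Rightarrow> complex \<Rightarrow> complex" where
  "star_series a z = (\<Sum>n. a (Suc n) * z ^ Suc n /
     (of_nat (Suc n) * riemann_zeta (of_nat (Suc n) + 1)))"

end

theory Submission
  imports Defs "HOL-Computational_Algebra.Squarefree"
begin

text \<open>
  Write \<open>m(u)\<close> for the sum of \<open>\<mu>(k)/k\<close> over \<open>k \<le> u\<close>. Expanding \<open>1/\<zeta>(n + 1)\<close> as a Dirichlet series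
  gives \<open>\<phi>\<^sup>\<star>(x) = \<integral> m(x/t) \<phi>(t) dt/t\<close>. Under the Riemann hypothesis \<open>m(u) = O(u powr (- 1 / 2 + \<epsilon>))\<close>, and
  the decay of \<open>\<phi>\<^sup>\<star>\<close> follows from the finiteness of \<open>N\<^sub>\<sigma>(\<phi>)\<close> for \<open>\<sigma> > - 1 / 2\<close>. The bound on \<open>m\<close> comes from
  shifting the contour in an absolutely convergent Perron integral, with \<open>1/\<zeta>(s) = O(\<bar>s\<bar> powr \<epsilon>)\<close> to
  the right of the critical line.

  Conversely, \<open>s \<zeta>(s + 1) (\<phi>\<^sup>\<star>)\<^sup>\<and>(s) = \<phi>\<^sup>\<and>(s)\<close> for \<open>0 < Re s < 1\<close>. If \<open>\<phi>\<^sup>\<star>\<close> decays, both sides are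
  holomorphic for \<open>- 1 / 2 < Re s < 1\<close>, so a zero of \<open>\<zeta>\<close> with real part in \<open>(1/2, 1)\<close> would be a zero of
  \<open>\<phi>\<^sup>\<and>\<close>; zeros with real part in \<open>(0, 1/2)\<close> are reflected to the right half of the strip.
\<close>

section \<open>Mellin transforms\<close>

text \<open>The pole of \<open>\<zeta>(s + 1)\<close> at \<open>s = 0\<close> lies inside the strip
  on which both directions work. Both are therefore phrased with \<open>zeta_reg\<close>, which is
  \<open>s * \<zeta>(s + 1)\<close> with the pole cancelled: the identity of transforms continues
  through 0, and the contour passes 0 without a residue. The contour also crosses the line on which
  the argument of zeta has real part 1, about which the Riemann hypothesis is silent; this is the
  reason for the 3-4-1 inequality. To read the identity of transforms off the integral of
  \<open>m(x/t)\<close> would take a bound on \<open>m\<close>, which is at hand only under the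
  hypothesis. Instead \<open>primitive\<close>, the integral of \<open>\<phi>(t)/t\<close>, is
  written as a superposition of dilates of \<open>\<phi>\<close> and also of
  \<open>star_series\<close>, and its transform is computed twice. For the reflection of zeros it
  suffices to relate zeta at \<open>s\<close> and at \<open>1 - s\<close> up to finite factors. The
  relation comes from two formulas for one elementary function, one resting on the geometric series
  and the other on the partial fractions of the cotangent.\<close>

definition mellin_integrable :: "(real \<Rightarrow> complex) \<Rightarrow> complex \<Rightarrow> bool" where
  "mellin_integrable f s \<longleftrightarrow> set_integrable lborel {0<..} (\<lambda>t. complex_of_real t powr (- s - 1) * f t)"

lemma powr_of_real_pos: "t > 0 \<Longrightarrow> complex_of_real t powr z = exp (z * of_real (ln t))"
  by (simp add: powr_def Ln_of_real)

lemma norm_powr_of_real_pos: "t > 0 \<Longrightarrow> norm (complex_of_real t powr z) = t powr (Re z)"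
  by (simp add: powr_of_real_pos powr_def)

lemma borel_measurable_indicator_powr [measurable]:
  "(\<lambda>t. indicator {0<..} t *\<^sub>R (complex_of_real t powr z)) \<in> borel_measurable borel"
proof -
  have "(\<lambda>t. indicator {0<..} t *\<^sub>R (complex_of_real t powr z)) =
      (\<lambda>t. indicator {0<..} t *\<^sub>R exp (z * of_real (ln t)))"
    by (intro ext) (simp add: indicator_def of_bool_def powr_of_real_pos)
  then show ?thesis by simp
qed

lemma borel_measurable_indicator_powr_mult:
  assumes "f \<in> borel_measurable borel"
  shows "(\<lambda>t. indicator {0<..} t *\<^sub>R (complex_of_real t powr z * f t)) \<in> borel_measurable borel"
proof -
  have "(\<lambda>t. (indicator {0<..} t *\<^sub>R (complex_of_real t powr z)) * f t) \<in> borel_measurable borel"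
    using assms by measurable
  then show ?thesis by simp
qed

text \<open>For \<open>t \<ge> 1\<close> the power of \<open>t\<close> is dominated by the one at
  the left end of the strip, for \<open>t < 1\<close> by the one at the right end; the sum of both
  is a common majorant.\<close>

lemma mellin_integrable_interpolate:
  assumes 1: "mellin_integrable f s1" and 2: "mellin_integrable f s2"
    and le: "Re s1 \<le> Re s" "Re s \<le> Re s2"
  shows "mellin_integrable f s"
  unfolding mellin_integrable_def set_integrable_def
proof (rule Bochner_Integration.integrable_bound)
  let ?g = "\<lambda>s t. indicator {0<..} t *\<^sub>R (complex_of_real t powr (- s - 1) * f t)"
  show "integrable lborel (\<lambda>t. norm (?g s1 t) + norm (?g s2 t))"
    using 1 2 unfolding mellin_integrable_def set_integrable_def
    by (intro Bochner_Integration.integrable_add integrable_norm)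
  \<comment> \<open>\<open>f\<close> is not assumed measurable; the integrand at \<open>s\<close>
    inherits measurability from the one at \<open>s1\<close> through this factor.\<close>
  have eq: "?g s = (\<lambda>t. exp ((s1 - s) * of_real (ln t)) * ?g s1 t)"
  proof
    fix t :: real
    show "?g s t = exp ((s1 - s) * of_real (ln t)) * ?g s1 t"
    proof (cases "t > 0")
      case True
      have "exp ((- s - 1) * of_real (ln t)) =
          exp ((s1 - s) * of_real (ln t)) * exp ((- s1 - 1) * of_real (ln t))"
        by (subst exp_add [symmetric], rule arg_cong[where f = exp]) (simp add: ring_distribs)
      then have "exp ((- s - 1) * of_real (ln t)) * f t =
          exp ((s1 - s) * of_real (ln t)) * (exp ((- s1 - 1) * of_real (ln t)) * f t)"
        by (metis mult.assoc)
      then show ?thesis using True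
        by (simp only: powr_of_real_pos indicator_simps(1) greaterThan_iff scaleR_one)
    qed simp
  qed
  have "?g s1 \<in> borel_measurable lborel"
    using 1 by (auto simp: mellin_integrable_def set_integrable_def)
  then show "?g s \<in> borel_measurable lborel"
    unfolding eq by measurable
  show "AE t in lborel. norm (?g s t) \<le> norm (norm (?g s1 t) + norm (?g s2 t))"
  proof (rule AE_I2)
    fix t :: real
    show "norm (?g s t) \<le> norm (norm (?g s1 t) + norm (?g s2 t))"
    proof (cases "t > 0")
      case True
      have "t powr (- Re s - 1) \<le> t powr (- Re s1 - 1) + t powr (- Re s2 - 1)"
      proof (cases "t \<ge> 1")
        case True
        then have "t powr (- Re s - 1) \<le> t powr (- Re s1 - 1)"
          using le by (intro powr_mono) auto
        then show ?thesis by (smt (verit) powr_ge_zero)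
      next
        case False
        then have "t powr (- Re s - 1) \<le> t powr (- Re s2 - 1)"
          using le \<open>t > 0\<close> by (intro powr_mono') auto
        then show ?thesis by (smt (verit) powr_ge_zero)
      qed
      then have "t powr (- Re s - 1) * norm (f t) \<le> (t powr (- Re s1 - 1) + t powr (- Re s2 - 1)) * norm (f t)"
        by (rule mult_right_mono) simp
      then show ?thesis
        using True by (simp add: norm_mult norm_powr_of_real_pos algebra_simps)
    qed simp
  qed
qed

lemma norm_exp_minus_1_le: "norm (exp z - 1) \<le> norm z * exp (norm z)" for z :: complex
proof -
  have "norm (exp z - exp 0) \<le> exp (norm z) * norm (z - 0)"
  proof (rule field_differentiable_bound[of "cball 0 (norm z)" exp exp])
    fix w :: complex assume "w \<in> cball 0 (norm z)"
    then show "norm (exp w) \<le> exp (norm z)"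
      using norm_exp[of w] exp_le_cancel_iff[of "norm w" "norm z"] by (simp del: exp_le_cancel_iff)
  qed (auto intro!: derivative_eq_intros)
  then show ?thesis by (simp add: mult.commute)
qed

text \<open>Differentiation under the integral sign. The factor \<open>ln t\<close> from the
  derivative is absorbed in a small power of \<open>t\<close>, so the integrands slightly to the
  left and to the right of \<open>s\<close> dominate all difference quotients.\<close>

lemma mellin_holomorphic:
  assumes 1: "mellin_integrable f s1" and 2: "mellin_integrable f s2"
  shows "mellin f holomorphic_on {s. Re s1 < Re s \<and> Re s < Re s2}"
proof (rule holomorphic_onI)
  fix s assume s: "s \<in> {s. Re s1 < Re s \<and> Re s < Re s2}"
  \<comment> \<open>Increments are kept below \<open>\<delta>\<close>, while the majorant uses the
    points at distance \<open>2 * \<delta>\<close> from \<open>s\<close>, which still lie in the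
    closed strip.\<close>
  define \<delta> where "\<delta> = min (Re s - Re s1) (Re s2 - Re s) / 2"
  have \<delta>: "\<delta> > 0" "Re s1 \<le> Re s - 2 * \<delta>" "Re s + 2 * \<delta> \<le> Re s2"
    using s by (auto simp: \<delta>_def min_def field_simps)
  let ?g = "\<lambda>s t. indicator {0<..} t *\<^sub>R (complex_of_real t powr (- s - 1) * f t)"
  have int: "integrable lborel (?g z)" if "Re s1 \<le> Re z" "Re z \<le> Re s2" for z
    using mellin_integrable_interpolate[OF 1 2 that]
    by (simp add: mellin_integrable_def set_integrable_def)
  have mel: "mellin f z = integral\<^sup>L lborel (?g z)" for z
    by (simp add: mellin_def set_lebesgue_integral_def)
  define D where "D = (LINT t|lborel. of_real (- ln t) * ?g s t)"
  have "((\<lambda>h. (mellin f (s + h) - mellin f s) / h) \<longlongrightarrow> D) (at 0 within ball 0 \<delta>)"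
    unfolding tendsto_at_iff_sequentially
  proof safe
    fix X :: "nat \<Rightarrow> complex"
    assume X: "\<forall>i. X i \<in> ball 0 \<delta> - {0}" and lim: "X \<longlonglongrightarrow> 0"
    have Xre: "Re s1 \<le> Re (s + X i)" "Re (s + X i) \<le> Re s2" for i
      using X[rule_format, of i] abs_Re_le_cmod[of "X i"] \<delta> by auto
    let ?q = "\<lambda>i t. (?g (s + X i) t - ?g s t) / X i"
    have "(\<lambda>i. integral\<^sup>L lborel (?q i)) \<longlonglongrightarrow> integral\<^sup>L lborel (\<lambda>t. of_real (- ln t) * ?g s t)"
    proof (rule integral_dominated_convergence)
      have meas: "?g z \<in> borel_measurable lborel" if "Re s1 \<le> Re z" "Re z \<le> Re s2" for z
        using int[OF that] by simp
      show "?q i \<in> borel_measurable lborel" for i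
        using Xre[of i] s
        by (intro borel_measurable_divide borel_measurable_diff borel_measurable_const meas) auto
      show "(\<lambda>t. of_real (- ln t) * ?g s t) \<in> borel_measurable lborel"
        using s by (intro borel_measurable_times meas) auto
      show "integrable lborel (\<lambda>t. (1 / \<delta>) * (norm (?g (s - of_real (2 * \<delta>)) t) + norm (?g (s + of_real (2 * \<delta>)) t)))"
        using \<delta> by (intro integrable_mult_right Bochner_Integration.integrable_add integrable_norm int) auto
      show "AE t in lborel. (\<lambda>i. ?q i t) \<longlonglongrightarrow> of_real (- ln t) * ?g s t"
      proof (rule AE_I2)
        fix t :: real
        show "(\<lambda>i. ?q i t) \<longlonglongrightarrow> of_real (- ln t) * ?g s t"
        proof (cases "t > 0")
          case True
          have "((\<lambda>z. exp ((- z - 1) * of_real (ln t)) * f t) has_field_derivative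
              of_real (- ln t) * (exp ((- s - 1) * of_real (ln t)) * f t)) (at s)"
            by (auto intro!: derivative_eq_intros)
          then have "((\<lambda>h. (exp ((- (s + h) - 1) * of_real (ln t)) * f t -
              exp ((- s - 1) * of_real (ln t)) * f t) / h) \<longlongrightarrow>
              of_real (- ln t) * (exp ((- s - 1) * of_real (ln t)) * f t)) (at 0)"
            by (simp add: DERIV_def)
          moreover have "filterlim X (at 0) sequentially"
            using lim X by (auto simp: filterlim_at)
          ultimately have "(\<lambda>i. (exp ((- (s + X i) - 1) * of_real (ln t)) * f t -
              exp ((- s - 1) * of_real (ln t)) * f t) / X i) \<longlonglongrightarrow>
              of_real (- ln t) * (exp ((- s - 1) * of_real (ln t)) * f t)"
            by (rule filterlim_compose)
          then show ?thesis using True by (simp add: powr_of_real_pos)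
        qed simp
      qed
      show "AE t in lborel. norm (?q i t) \<le>
          (1 / \<delta>) * (norm (?g (s - of_real (2 * \<delta>)) t) + norm (?g (s + of_real (2 * \<delta>)) t))" for i
      proof (rule AE_I2)
        fix t :: real
        show "norm (?q i t) \<le>
          (1 / \<delta>) * (norm (?g (s - of_real (2 * \<delta>)) t) + norm (?g (s + of_real (2 * \<delta>)) t))"
        proof (cases "t > 0")
          case True
          define L where "L = ln t"
          define h where "h = X i"
          have h: "h \<noteq> 0" "norm h < \<delta>" using X[rule_format, of i] by (auto simp: h_def)
          have "?q i t = (exp ((- s - 1) * of_real L) * f t) * ((exp (- h * of_real L) - 1) / h)"
          proof -
            have "exp ((- (s + h) - 1) * of_real L) = exp ((- s - 1) * of_real L) * exp (- h * of_real L)"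
              by (simp add: exp_add [symmetric] algebra_simps)
            then show ?thesis using True
              by (simp only: powr_of_real_pos L_def [symmetric] h_def [symmetric] indicator_simps(1) greaterThan_iff scaleR_one)
                (simp add: field_simps)
          qed
          then have "norm (?q i t) = exp ((- Re s - 1) * L) * norm (f t) * (norm (exp (- h * of_real L) - 1) / norm h)"
            by (simp add: norm_mult norm_divide)
          also have "\<dots> \<le> exp ((- Re s - 1) * L) * norm (f t) * ((1 / \<delta>) * exp (2 * \<delta> * \<bar>L\<bar>))"
          proof (rule mult_left_mono)
            have "norm (exp (- h * of_real L) - 1) \<le> norm h * \<bar>L\<bar> * exp (norm h * \<bar>L\<bar>)"
              using norm_exp_minus_1_le[of "- h * of_real L"] by (simp add: norm_mult)
            then have "norm (exp (- h * of_real L) - 1) / norm h \<le> \<bar>L\<bar> * exp (norm h * \<bar>L\<bar>)"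
              using h by (simp add: field_simps)
            also have "\<dots> \<le> \<bar>L\<bar> * exp (\<delta> * \<bar>L\<bar>)"
              using h by (intro mult_left_mono) (auto intro: mult_right_mono)
            also have "\<bar>L\<bar> \<le> (1 / \<delta>) * exp (\<delta> * \<bar>L\<bar>)"
            proof -
              have "\<delta> * \<bar>L\<bar> \<le> exp (\<delta> * \<bar>L\<bar>)" using exp_ge_add_one_self[of "\<delta> * \<bar>L\<bar>"] by linarith
              then show ?thesis using \<delta> by (simp add: field_simps)
            qed
            then have "\<bar>L\<bar> * exp (\<delta> * \<bar>L\<bar>) \<le> (1 / \<delta>) * exp (\<delta> * \<bar>L\<bar>) * exp (\<delta> * \<bar>L\<bar>)"
              by (rule mult_right_mono) simp
            also have "\<dots> = (1 / \<delta>) * exp (2 * \<delta> * \<bar>L\<bar>)"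
              by (simp add: exp_add [symmetric])
            finally show "norm (exp (- h * of_real L) - 1) / norm h \<le> (1 / \<delta>) * exp (2 * \<delta> * \<bar>L\<bar>)" .
          qed simp
          also have "\<dots> = (1 / \<delta>) * (exp ((- Re s - 1) * L) * exp (2 * \<delta> * \<bar>L\<bar>)) * norm (f t)"
            by simp
          also have "\<dots> \<le> (1 / \<delta>) * (exp ((- (Re s - 2 * \<delta>) - 1) * L) + exp ((- (Re s + 2 * \<delta>) - 1) * L)) * norm (f t)"
          proof (intro mult_right_mono mult_left_mono)
            \<comment> \<open>For \<open>L \<ge> 0\<close> the first summand equals the left-hand
              side, for \<open>L < 0\<close> the second one does.\<close>
            show "exp ((- Re s - 1) * L) * exp (2 * \<delta> * \<bar>L\<bar>) \<le>
              exp ((- (Re s - 2 * \<delta>) - 1) * L) + exp ((- (Re s + 2 * \<delta>) - 1) * L)"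
              by (cases "L \<ge> 0") (simp_all add: exp_add [symmetric] algebra_simps)
          qed (use \<delta> in auto)
          also have "\<dots> = (1 / \<delta>) * (norm (?g (s - of_real (2 * \<delta>)) t) + norm (?g (s + of_real (2 * \<delta>)) t))"
            using True by (simp add: powr_of_real_pos norm_mult L_def algebra_simps)
          finally show ?thesis .
        qed simp
      qed
    qed
    moreover have "integral\<^sup>L lborel (?q i) = (mellin f (s + X i) - mellin f s) / X i" for i
    proof -
      have "integrable lborel (?g (s + X i))" "integrable lborel (?g s)"
        using Xre[of i] s by (intro int; simp)+
      then have "(LINT t|lborel. ?g (s + X i) t - ?g s t) = mellin f (s + X i) - mellin f s"
        unfolding mel by (rule Bochner_Integration.integral_diff)
      then show ?thesis by simp
    qed
    ultimately show "((\<lambda>h. (mellin f (s + h) - mellin f s) / h) \<circ> X) \<longlonglongrightarrow> D"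
      by (simp only: o_def D_def)
  qed
  moreover have "at 0 within ball 0 \<delta> = at (0 :: complex)"
    using \<delta> by (intro at_within_open) auto
  ultimately have "((\<lambda>h. (mellin f (s + h) - mellin f s) / h) \<longlongrightarrow> D) (at 0)"
    by (simp only:)
  then have "(mellin f has_field_derivative D) (at s)"
    by (simp add: DERIV_def)
  then show "mellin f field_differentiable at s within {s. Re s1 < Re s \<and> Re s < Re s2}"
    using field_differentiable_at_within field_differentiable_def by blast
qed

lemma mellin_holomorphic_open:
  assumes A: "open A" and f: "\<And>s. Re s \<in> A \<Longrightarrow> mellin_integrable f s"
  shows "mellin f holomorphic_on {s. Re s \<in> A}"
proof (rule holomorphic_onI)
  fix s assume "s \<in> {s. Re s \<in> A}"
  then obtain e where e: "e > 0" "ball (Re s) e \<subseteq> A" using A open_contains_ball by blast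
  define u where "u = complex_of_real (Re s - e / 2)"
  define v where "v = complex_of_real (Re s + e / 2)"
  have "Re u \<in> A" "Re v \<in> A" using e by (auto simp: u_def v_def dist_real_def subset_iff)
  then have "mellin f holomorphic_on {s. Re u < Re s \<and> Re s < Re v}"
    by (intro mellin_holomorphic f)
  moreover have "open {s. Re u < Re s \<and> Re s < Re v}"
    by (intro open_Collect_conj open_halfspace_Re_gt open_halfspace_Re_lt)
  moreover have "s \<in> {s. Re u < Re s \<and> Re s < Re v}" using e by (auto simp: u_def v_def)
  ultimately show "mellin f field_differentiable at s within {s. Re s \<in> A}"
    using holomorphic_on_imp_differentiable_at field_differentiable_at_within by blast
qed

lemma mellin_integrable_of_norm:
  assumes f: "f \<in> borel_measurable borel" and "mellin_norm \<sigma> f < \<infinity>" "Re s = \<sigma>"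
  shows "mellin_integrable f s"
  unfolding mellin_integrable_def set_integrable_def
proof (rule integrableI_bounded)
  show "(\<lambda>t. indicator {0<..} t *\<^sub>R (complex_of_real t powr (- s - 1) * f t)) \<in> borel_measurable lborel"
    using borel_measurable_indicator_powr_mult[OF f] by simp
  have "(\<integral>\<^sup>+t. ennreal (norm (indicator {0<..} t *\<^sub>R (complex_of_real t powr (- s - 1) * f t))) \<partial>lborel) = mellin_norm \<sigma> f"
    unfolding mellin_norm_def
    by (rule nn_integral_cong) (auto simp: indicator_def norm_mult norm_powr_of_real_pos assms(3))
  then show "(\<integral>\<^sup>+t. ennreal (norm (indicator {0<..} t *\<^sub>R (complex_of_real t powr (- s - 1) * f t))) \<partial>lborel) < \<infinity>"
    using assms(2) by simp
qed

section \<open>Dilations and their superpositions\<close>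

lemma mellin_scale:
  assumes g: "mellin_integrable g s" and c: "c > 0"
  shows "mellin_integrable (\<lambda>t. g (c * t)) s"
    and "mellin (\<lambda>t. g (c * t)) s = of_real c powr s * mellin g s"
    and "(LINT t|lborel. norm (indicator {0<..} t *\<^sub>R (complex_of_real t powr (- s - 1) * g (c * t)))) =
         c powr Re s * (LINT t|lborel. norm (indicator {0<..} t *\<^sub>R (complex_of_real t powr (- s - 1) * g t)))"
proof -
  let ?h = "\<lambda>t. indicator {0<..} t *\<^sub>R (complex_of_real t powr (- s - 1) * g t)"
  let ?k = "\<lambda>t. indicator {0<..} t *\<^sub>R (complex_of_real t powr (- s - 1) * g (c * t))"
  have eq: "?k = (\<lambda>t. of_real c powr (s + 1) * ?h (0 + c * t))"
  proof
    fix t :: real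
    show "?k t = of_real c powr (s + 1) * ?h (0 + c * t)"
    proof (cases "t > 0")
      case True
      have "complex_of_real (c * t) powr (- s - 1) = of_real c powr (- s - 1) * of_real t powr (- s - 1)"
        using True c powr_of_real_pos[of "c * t" "- s - 1"] powr_of_real_pos[of c "- s - 1"]
          powr_of_real_pos[of t "- s - 1"]
        by (simp add: ln_mult exp_add [symmetric] algebra_simps del: of_real_mult)
      moreover have "complex_of_real c powr (s + 1) * of_real c powr (- s - 1) = 1"
        using c by (simp add: powr_add [symmetric])
      ultimately show ?thesis using True c by (simp add: mult.assoc [symmetric])
    next
      case False
      then have "\<not> 0 < c * t" using c by (simp add: zero_less_mult_iff)
      then show ?thesis using False by simp
    qed
  qed
  have eqt: "?k t = of_real c powr (s + 1) * ?h (0 + c * t)" for t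
    by (rule fun_cong[OF eq])
  have h: "integrable lborel ?h"
    using g by (simp add: mellin_integrable_def set_integrable_def)
  have "integrable lborel (\<lambda>t. of_real c powr (s + 1) * ?h (0 + c * t))"
    using c by (intro integrable_mult_right lborel_integrable_real_affine[OF h]) auto
  then show "mellin_integrable (\<lambda>t. g (c * t)) s"
    unfolding mellin_integrable_def set_integrable_def eq .
  have "integral\<^sup>L lborel ?h = c *\<^sub>R integral\<^sup>L lborel (\<lambda>t. ?h (0 + c * t))"
    using lborel_integral_real_affine[of c ?h 0] c by simp
  then have "integral\<^sup>L lborel (\<lambda>t. ?h (0 + c * t)) = integral\<^sup>L lborel ?h / of_real c"
    using c by (simp add: scaleR_conv_of_real)
  then have "integral\<^sup>L lborel ?k = of_real c powr (s + 1) * (integral\<^sup>L lborel ?h / of_real c)"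
    unfolding eq by (simp only: integral_mult_right_zero)
  also have "\<dots> = of_real c powr s * integral\<^sup>L lborel ?h"
    using c by (simp add: powr_add)
  finally show "mellin (\<lambda>t. g (c * t)) s = of_real c powr s * mellin g s"
    by (simp add: mellin_def set_lebesgue_integral_def)
  \<comment> \<open>The same substitution for absolute values: this is the quantity that Fubini's
    theorem asks for in \<open>mellin_superposition\<close>.\<close>
  have "(LINT t|lborel. norm (?h t)) = c * (LINT t|lborel. norm (?h (0 + c * t)))"
    using lborel_integral_real_affine[of c "\<lambda>t. norm (?h t)" 0] c by simp
  then have "(LINT t|lborel. norm (?h (0 + c * t))) = (LINT t|lborel. norm (?h t)) / c"
    using c by simp
  then have "(LINT t|lborel. norm (?k t)) = c powr (Re s + 1) * ((LINT t|lborel. norm (?h t)) / c)"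
    by (simp only: eqt norm_mult[of "of_real c powr (s + 1)"] norm_powr_of_real_pos[OF c]
      integral_mult_right_zero plus_complex.simps one_complex.simps)
  then show "(LINT t|lborel. norm (?k t)) = c powr Re s * (LINT t|lborel. norm (?h t))"
    using c by (simp add: powr_add)
qed

text \<open>Fubini for a weighted family of dilates of \<open>g\<close>, each of which contributes a
  factor \<open>of_real (c y) powr s\<close>. The measure \<open>M\<close> is arbitrary so that a
  series (counting measure) and an integral (\<open>lborel\<close>) are covered alike. Where
  \<open>c y\<close> is not positive the dilate leaves the half-line, so the weight has to vanish
  there.\<close>

lemma mellin_superposition:
  fixes M :: "'b measure" and w :: "'b \<Rightarrow> complex" and c :: "'b \<Rightarrow> real"
  assumes M: "sigma_finite_measure M"
    and [measurable]: "w \<in> borel_measurable M" "c \<in> borel_measurable M" "g \<in> borel_measurable borel"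
    and c: "\<And>y. c y \<le> 0 \<Longrightarrow> w y = 0"
    and w: "integrable M (\<lambda>y. w y * of_real (c y) powr s)"
    and g: "mellin_integrable g s"
    and f: "\<And>x. x > 0 \<Longrightarrow> f x = (LINT y|M. w y * g (c y * x))"
  shows "mellin f s = (LINT y|M. w y * of_real (c y) powr s) * mellin g s"
proof -
  interpret pair_sigma_finite M lborel
    using M by (simp add: pair_sigma_finite_def lborel.sigma_finite_measure_axioms)
  let ?G = "\<lambda>y x. indicator {0<..} x *\<^sub>R (complex_of_real x powr (- s - 1) * g (c y * x))"
  define H where "H = (\<lambda>(y, x). w y * ?G y x)"
  have Gint: "integrable lborel (?G y)" if "c y > 0" for y
    using mellin_scale(1)[OF g that] by (simp add: mellin_integrable_def set_integrable_def)
  have Hint: "integrable lborel (\<lambda>x. H (y, x))" for y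
  proof (cases "c y > 0")
    case True
    have "(\<lambda>x. H (y, x)) = (\<lambda>x. w y * ?G y x)" by (simp add: H_def)
    then show ?thesis using Gint[OF True] by (simp only: integrable_mult_right)
  next
    case False
    then show ?thesis using c[of y] by (simp add: H_def)
  qed
  have [measurable]: "H \<in> borel_measurable (M \<Otimes>\<^sub>M lborel)"
  proof -
    have "(\<lambda>(y, x). w y * ((indicator {0<..} x *\<^sub>R (complex_of_real x powr (- s - 1))) * g (c y * x)))
      \<in> borel_measurable (M \<Otimes>\<^sub>M lborel)"
      by measurable
    then show ?thesis unfolding H_def by (simp add: case_prod_unfold)
  qed
  let ?N = "LINT t|lborel. norm (indicator {0<..} t *\<^sub>R (complex_of_real t powr (- s - 1) * g t))"
  \<comment> \<open>By scaling, the inner integral of absolute values depends on \<open>y\<close>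
    only through the norm of \<open>w y * of_real (c y) powr s\<close>, whose integrability is the
    assumption \<open>w\<close>.\<close>
  have "(LINT x|lborel. norm (H (y, x))) = norm (w y * of_real (c y) powr s) * ?N" for y
  proof (cases "c y > 0")
    case True
    have "(LINT x|lborel. norm (H (y, x))) = norm (w y) * (LINT x|lborel. norm (?G y x))"
      unfolding H_def case_prod_conv norm_mult by (simp only: integral_mult_right_zero)
    also have "\<dots> = norm (w y * of_real (c y) powr s) * ?N"
      by (subst mellin_scale(3)[OF g True]) (simp add: norm_mult norm_powr_of_real_pos True)
    finally show ?thesis .
  next
    case False
    then show ?thesis using c[of y] by (simp add: H_def)
  qed
  then have "integrable M (\<lambda>y. LINT x|lborel. norm (H (y, x)))"
    using integrable_norm[OF w] by simp
  then have "integrable (M \<Otimes>\<^sub>M lborel) H"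
    using Hint by (intro Fubini_integrable) auto
  then have H': "integrable (M \<Otimes>\<^sub>M lborel) (\<lambda>(y, x). H (y, x))"
    by simp
  have "mellin f s = (LINT x|lborel. LINT y|M. H (y, x))"
    unfolding mellin_def set_lebesgue_integral_def
  proof (rule Bochner_Integration.integral_cong)
    fix x :: real
    show "indicator {0<..} x *\<^sub>R (complex_of_real x powr (- s - 1) * f x) = (LINT y|M. H (y, x))"
    proof (cases "x > 0")
      case True
      have "(LINT y|M. H (y, x)) = (LINT y|M. complex_of_real x powr (- s - 1) * (w y * g (c y * x)))"
        using True by (simp add: H_def mult_ac)
      then show ?thesis using True f[OF True] by simp
    qed (simp add: H_def)
  qed simp
  also have "\<dots> = (LINT y|M. LINT x|lborel. H (y, x))"
    by (rule Fubini_integral[OF H'])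
  also have "\<dots> = (LINT y|M. (w y * of_real (c y) powr s) * mellin g s)"
  proof (rule Bochner_Integration.integral_cong)
    fix y
    show "(LINT x|lborel. H (y, x)) = (w y * of_real (c y) powr s) * mellin g s"
    proof (cases "c y > 0")
      case True
      have "(LINT x|lborel. H (y, x)) = w y * mellin (\<lambda>t. g (c y * t)) s"
        unfolding H_def mellin_def set_lebesgue_integral_def case_prod_conv
        by (simp only: integral_mult_right_zero)
      then show ?thesis using mellin_scale(2)[OF g True] by simp
    next
      case False
      then show ?thesis using c[of y] by (simp add: H_def)
    qed
  qed simp
  finally show ?thesis by simp
qed

section \<open>Power functions and step functions\<close>

lemma has_vector_derivative_powr_of_real:
  assumes "t > 0" "s \<noteq> 0"
  shows "((\<lambda>t. - (complex_of_real t powr (- s)) / s) has_vector_derivative complex_of_real t powr (- s - 1)) (at t)"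
proof -
  have "((\<lambda>z. - (z powr (- s)) / s) has_field_derivative (complex_of_real t powr (- s - 1))) (at (complex_of_real t))"
    using assms by (auto intro!: derivative_eq_intros simp: complex_nonpos_Reals_iff)
  from has_vector_derivative_real_field[OF this] show ?thesis
    by (simp add: o_def)
qed

lemma isCont_powr_of_real: "t > 0 \<Longrightarrow> isCont (\<lambda>t. complex_of_real t powr z) t"
  by (intro continuous_intros) (auto simp: complex_nonpos_Reals_iff)

lemma set_integrable_powr_of_real:
  assumes "set_integrable lborel A (\<lambda>t. t powr (Re z))" "A \<subseteq> {0<..}" "A \<in> sets borel"
  shows "set_integrable lborel A (\<lambda>t. complex_of_real t powr z)"
  unfolding set_integrable_def
proof (rule Bochner_Integration.integrable_bound)
  show "integrable lborel (\<lambda>t. indicator A t *\<^sub>R (t powr (Re z)))"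
    using assms by (simp add: set_integrable_def)
  have "(\<lambda>t. indicator A t *\<^sub>R (complex_of_real t powr z)) =
      (\<lambda>t. indicator A t *\<^sub>R (indicator {0<..} t *\<^sub>R (complex_of_real t powr z)))"
    using assms(2) by (intro ext) (auto simp: indicator_def)
  then show "(\<lambda>t. indicator A t *\<^sub>R (complex_of_real t powr z)) \<in> borel_measurable lborel"
    using assms(3) by simp
  show "AE t in lborel. norm (indicator A t *\<^sub>R (complex_of_real t powr z)) \<le> norm (indicator A t *\<^sub>R (t powr (Re z)))"
    using assms(2) by (intro AE_I2) (auto simp: indicator_def norm_powr_of_real_pos)
qed

lemma set_integrable_powr_tail:
  fixes b a :: real
  assumes "b > 0" "a > 0"
  shows "set_integrable lborel {a<..} (\<lambda>t. t powr (- b - 1))"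
proof -
  have "set_integrable lborel (einterval (ereal a) \<infinity>) (\<lambda>t. t powr (- b - 1))"
  proof (rule interval_integral_FTC_nonneg(1)[where F = "\<lambda>t. - (t powr (- b)) / b" and A = "- (a powr (- b)) / b" and B = 0])
    fix x assume "ereal a < ereal x"
    then show "DERIV (\<lambda>t. - (t powr (- b)) / b) x :> x powr (- b - 1)"
      and "isCont (\<lambda>t. t powr (- b - 1)) x"
      using assms by (auto intro!: derivative_eq_intros continuous_intros)
  next
    show "(((\<lambda>t. - (t powr (- b)) / b) \<circ> real_of_ereal) \<longlongrightarrow> - (a powr (- b)) / b) (at_right (ereal a))"
      using assms by (auto intro!: tendsto_eq_intros simp: ereal_tendsto_simps)
    have "((\<lambda>t. - (t powr (- b)) / b) \<longlongrightarrow> - 0 / b) at_top"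
      using assms by (intro tendsto_intros tendsto_neg_powr filterlim_ident) auto
    then show "(((\<lambda>t. - (t powr (- b)) / b) \<circ> real_of_ereal) \<longlongrightarrow> 0) (at_left \<infinity>)"
      by (simp add: ereal_tendsto_simps)
  qed auto
  then show ?thesis by (simp add: einterval_def greaterThan_def)
qed

lemma set_integrable_powr_head:
  fixes b a :: real
  assumes "b > -1" "a > 0"
  shows "set_integrable lborel {0<..<a} (\<lambda>t. t powr b)"
proof -
  have "set_integrable lborel (einterval 0 (ereal a)) (\<lambda>t. t powr b)"
  proof (rule interval_integral_FTC_nonneg(1)[where F = "\<lambda>t. t powr (b + 1) / (b + 1)" and A = 0 and B = "a powr (b + 1) / (b + 1)"])
    fix x assume "0 < ereal x"
    then show "DERIV (\<lambda>t. t powr (b + 1) / (b + 1)) x :> x powr b"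
      and "isCont (\<lambda>t. t powr b) x"
      using assms by (auto intro!: derivative_eq_intros continuous_intros)
  next
    show "(((\<lambda>t. t powr (b + 1) / (b + 1)) \<circ> real_of_ereal) \<longlongrightarrow> 0) (at_right 0)"
    proof -
      have "((\<lambda>t::real. t powr (b + 1) / (b + 1)) \<longlongrightarrow> 0 / (b + 1)) (at_right 0)"
        using assms by (intro tendsto_divide tendsto_zero_powrI[where b = "b + 1"] tendsto_const tendsto_ident_at)
          (auto simp: eventually_at_filter)
      then show ?thesis by (simp add: zero_ereal_def ereal_tendsto_simps)
    qed
    show "(((\<lambda>t. t powr (b + 1) / (b + 1)) \<circ> real_of_ereal) \<longlongrightarrow> a powr (b + 1) / (b + 1)) (at_left (ereal a))"
      using assms by (auto intro!: tendsto_eq_intros simp: ereal_tendsto_simps)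
  qed (use assms in auto)
  moreover have "einterval 0 (ereal a) = {0<..<a}" by (auto simp: einterval_def)
  ultimately show ?thesis by simp
qed

lemma powr_tail_integral:
  assumes s: "Re s > 0" and a: "a > 0"
  shows "set_integrable lborel {a<..} (\<lambda>t. complex_of_real t powr (- s - 1))"
    and "(LINT t:{a<..}|lborel. complex_of_real t powr (- s - 1)) = of_real a powr (- s) / s"
proof -
  show int: "set_integrable lborel {a<..} (\<lambda>t. complex_of_real t powr (- s - 1))"
    using set_integrable_powr_tail[OF s a] a by (intro set_integrable_powr_of_real) auto
  have "(LBINT t=ereal a..\<infinity>. complex_of_real t powr (- s - 1)) = 0 - (- (of_real a powr (- s)) / s)"
  proof (rule interval_integral_FTC_integrable[where F = "\<lambda>t. - (complex_of_real t powr (- s)) / s"])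
    show "set_integrable lborel (einterval (ereal a) \<infinity>) (\<lambda>t. complex_of_real t powr (- s - 1))"
      using int by (simp add: einterval_def greaterThan_def)
    fix x assume "ereal a < ereal x"
    then show "((\<lambda>t. - (complex_of_real t powr (- s)) / s) has_vector_derivative complex_of_real x powr (- s - 1)) (at x)"
      and "isCont (\<lambda>t. complex_of_real t powr (- s - 1)) x"
      using a s has_vector_derivative_powr_of_real[of x s] isCont_powr_of_real[of x]
      by (force simp: complex_eq_iff)+
  next
    have "isCont (\<lambda>t. - (complex_of_real t powr (- s)) / s) a"
      using a s by (intro continuous_intros isCont_powr_of_real) auto
    then have "((\<lambda>t. - (complex_of_real t powr (- s)) / s) \<longlongrightarrow> - (of_real a powr (- s)) / s) (at_right a)"
      by (simp add: isCont_def filterlim_at_split)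
    then show "(((\<lambda>t. - (complex_of_real t powr (- s)) / s) \<circ> real_of_ereal) \<longlongrightarrow> - (of_real a powr (- s)) / s) (at_right (ereal a))"
      by (simp add: ereal_tendsto_simps)
    have "((\<lambda>t. norm (complex_of_real t powr (- s) / s)) \<longlongrightarrow> 0) at_top"
    proof (rule Lim_transform_eventually)
      have "((\<lambda>t. t powr (- Re s) / norm s) \<longlongrightarrow> 0 / norm s) at_top"
        using s by (intro tendsto_divide tendsto_neg_powr filterlim_ident tendsto_const) auto
      then show "((\<lambda>t. t powr (- Re s) / norm s) \<longlongrightarrow> 0) at_top" by simp
      show "\<forall>\<^sub>F t in at_top. t powr (- Re s) / norm s = norm (complex_of_real t powr (- s) / s)"
        using eventually_gt_at_top[of 0] by eventually_elim (simp add: norm_divide norm_powr_of_real_pos)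
    qed
    then have "((\<lambda>t. - (complex_of_real t powr (- s)) / s) \<longlongrightarrow> 0) at_top"
      by (intro tendsto_norm_zero_cancel[where f = "\<lambda>t. - (complex_of_real t powr (- s)) / s"]) (simp only: norm_minus_cancel minus_divide_left [symmetric])
    then show "(((\<lambda>t. - (complex_of_real t powr (- s)) / s) \<circ> real_of_ereal) \<longlongrightarrow> 0) (at_left \<infinity>)"
      by (simp add: ereal_tendsto_simps)
  qed auto
  then show "(LINT t:{a<..}|lborel. complex_of_real t powr (- s - 1)) = of_real a powr (- s) / s"
    by (simp add: interval_integral_to_infinity_eq)
qed

lemma powr_head_integral:
  assumes s: "Re s < 0" and a: "a > 0"
  shows "set_integrable lborel {0<..<a} (\<lambda>t. complex_of_real t powr (- s - 1))"
    and "(LINT t:{0<..<a}|lborel. complex_of_real t powr (- s - 1)) = - (of_real a powr (- s) / s)"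
proof -
  show int: "set_integrable lborel {0<..<a} (\<lambda>t. complex_of_real t powr (- s - 1))"
    using set_integrable_powr_head[of "- Re s - 1" a] s a by (intro set_integrable_powr_of_real) auto
  have eq: "einterval 0 (ereal a) = {0<..<a}" by (auto simp: einterval_def)
  have "(LBINT t=0..ereal a. complex_of_real t powr (- s - 1)) = - (of_real a powr (- s)) / s - 0"
  proof (rule interval_integral_FTC_integrable[where F = "\<lambda>t. - (complex_of_real t powr (- s)) / s"])
    show "set_integrable lborel (einterval 0 (ereal a)) (\<lambda>t. complex_of_real t powr (- s - 1))"
      using int by (simp add: eq)
    fix x assume "0 < ereal x"
    then show "((\<lambda>t. - (complex_of_real t powr (- s)) / s) has_vector_derivative complex_of_real x powr (- s - 1)) (at x)"
      and "isCont (\<lambda>t. complex_of_real t powr (- s - 1)) x"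
      using a s has_vector_derivative_powr_of_real[of x s] isCont_powr_of_real[of x]
      by (force simp: complex_eq_iff)+
  next
    have "isCont (\<lambda>t. - (complex_of_real t powr (- s)) / s) a"
      using a s by (intro continuous_intros isCont_powr_of_real) auto
    then have "((\<lambda>t. - (complex_of_real t powr (- s)) / s) \<longlongrightarrow> - (of_real a powr (- s)) / s) (at_left a)"
      by (simp add: isCont_def filterlim_at_split)
    then show "(((\<lambda>t. - (complex_of_real t powr (- s)) / s) \<circ> real_of_ereal) \<longlongrightarrow> - (of_real a powr (- s)) / s) (at_left (ereal a))"
      by (simp add: ereal_tendsto_simps)
    have "((\<lambda>t. norm (complex_of_real t powr (- s) / s)) \<longlongrightarrow> 0) (at_right 0)"
    proof (rule Lim_transform_eventually)
      have "((\<lambda>t. t powr (- Re s) / norm s) \<longlongrightarrow> 0 / norm s) (at_right 0)"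
        using s by (intro tendsto_divide tendsto_zero_powrI[where b = "- Re s"] tendsto_const tendsto_ident_at)
          (auto simp: eventually_at_filter)
      then show "((\<lambda>t. t powr (- Re s) / norm s) \<longlongrightarrow> 0) (at_right 0)" by simp
      show "\<forall>\<^sub>F t in at_right 0. t powr (- Re s) / norm s = norm (complex_of_real t powr (- s) / s)"
        by (simp add: eventually_at_filter norm_divide norm_powr_of_real_pos)
    qed
    then have "((\<lambda>t. - (complex_of_real t powr (- s)) / s) \<longlongrightarrow> 0) (at_right 0)"
      by (intro tendsto_norm_zero_cancel[where f = "\<lambda>t. - (complex_of_real t powr (- s)) / s"]) (simp only: norm_minus_cancel minus_divide_left [symmetric])
    then show "(((\<lambda>t. - (complex_of_real t powr (- s)) / s) \<circ> real_of_ereal) \<longlongrightarrow> 0) (at_right 0)"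
      by (simp add: zero_ereal_def ereal_tendsto_simps)
  qed (use a in auto)
  then show "(LINT t:{0<..<a}|lborel. complex_of_real t powr (- s - 1)) = - (of_real a powr (- s) / s)"
    using a by (simp add: interval_lebesgue_integral_def eq)
qed

text \<open>The growth exponent \<open>\<alpha>\<close> at infinity limits the strip of absolute
  convergence on the left, the exponent \<open>\<beta>\<close> at 0 limits it on the right.\<close>

lemma mellin_integrable_boundI:
  assumes f: "f \<in> borel_measurable borel"
    and 1: "\<And>t. t \<ge> 1 \<Longrightarrow> norm (f t) \<le> C * t powr \<alpha>" "Re s > \<alpha>"
    and 2: "\<And>t. 0 < t \<Longrightarrow> t < 1 \<Longrightarrow> norm (f t) \<le> C * t powr \<beta>" "Re s < \<beta>"
  shows "mellin_integrable f s"
  unfolding mellin_integrable_def set_integrable_def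
proof (rule Bochner_Integration.integrable_bound)
  show "integrable lborel (\<lambda>t. C * (indicator {1<..} t *\<^sub>R (t powr (- (Re s - \<alpha>) - 1))) +
      C * (indicator {0<..<1} t *\<^sub>R (t powr (\<beta> - Re s - 1))))"
    using set_integrable_powr_tail[of "Re s - \<alpha>" 1] set_integrable_powr_head[of "\<beta> - Re s - 1" 1] assms(3,5)
    unfolding set_integrable_def
    by (intro Bochner_Integration.integrable_add integrable_mult_right) auto
  show "(\<lambda>t. indicator {0<..} t *\<^sub>R (complex_of_real t powr (- s - 1) * f t)) \<in> borel_measurable lborel"
    using borel_measurable_indicator_powr_mult[OF f] by simp
  have "AE t in lborel. t \<noteq> (1 :: real)" by (rule AE_lborel_singleton)
  then show "AE t in lborel. norm (indicator {0<..} t *\<^sub>R (complex_of_real t powr (- s - 1) * f t)) \<le>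
     norm (C * (indicator {1<..} t *\<^sub>R (t powr (- (Re s - \<alpha>) - 1))) +
      C * (indicator {0<..<1} t *\<^sub>R (t powr (\<beta> - Re s - 1))))"
  proof eventually_elim
    fix t :: real assume t: "t \<noteq> 1"
    have *: "norm (complex_of_real t powr (- s - 1) * f t) \<le> C * t powr (\<gamma> - Re s - 1)"
      if "t > 0" "norm (f t) \<le> C * t powr \<gamma>" for \<gamma>
    proof -
      have "norm (complex_of_real t powr (- s - 1) * f t) \<le> t powr (- Re s - 1) * (C * t powr \<gamma>)"
        using that by (auto simp: norm_mult norm_powr_of_real_pos intro!: mult_left_mono)
      also have "\<dots> = C * (t powr (- Re s - 1) * t powr \<gamma>)" by simp
      also have "\<dots> = C * t powr (\<gamma> - Re s - 1)"
        by (simp add: powr_add [symmetric] algebra_simps)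
      finally show ?thesis .
    qed
    consider "t \<le> 0" | "0 < t" "t < 1" | "t > 1" using t by linarith
    then show "norm (indicator {0<..} t *\<^sub>R (complex_of_real t powr (- s - 1) * f t)) \<le>
     norm (C * (indicator {1<..} t *\<^sub>R (t powr (- (Re s - \<alpha>) - 1))) +
      C * (indicator {0<..<1} t *\<^sub>R (t powr (\<beta> - Re s - 1))))"
    proof cases
      case 2
      then show ?thesis using *[OF _ assms(4)[of t]] by simp
    next
      case 3
      then have "norm (complex_of_real t powr (- s - 1) * f t) \<le> C * t powr (\<alpha> - Re s - 1)"
        using *[OF _ assms(2)[of t]] by simp
      also have "\<alpha> - Re s - 1 = - (Re s - \<alpha>) - 1" by simp
      finally show ?thesis using 3 by simp
    qed simp
  qed
qed

text \<open>Abel summation in integral form: the jump \<open>c k\<close>, located at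
  \<open>k + 1\<close>, contributes the tail integral of \<open>t powr (- s - 1)\<close> from that
  point on.\<close>

lemma step_function_mellin:
  fixes c :: "nat \<Rightarrow> complex"
  assumes s: "Re s > 0" and sum: "summable (\<lambda>k. norm (c k) * real (Suc k) powr (- Re s))"
  shows "mellin_integrable (\<lambda>t. \<Sum>k<nat \<lfloor>t\<rfloor>. c k) s"
    and "mellin (\<lambda>t. \<Sum>k<nat \<lfloor>t\<rfloor>. c k) s = (\<Sum>k. c k * of_nat (Suc k) powr (- s)) / s"
proof -
  let ?f = "\<lambda>k t. c k * (indicator {real (Suc k)<..} t *\<^sub>R (complex_of_real t powr (- s - 1)))"
  let ?S = "\<lambda>t :: real. \<Sum>k<nat \<lfloor>t\<rfloor>. c k"
  have int: "integrable lborel (?f k)" for k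
    using powr_tail_integral(1)[OF s, of "real (Suc k)"]
    by (intro integrable_mult_right) (simp add: set_integrable_def)
  have val: "integral\<^sup>L lborel (?f k) = c k * of_nat (Suc k) powr (- s) / s" for k
    using powr_tail_integral(2)[OF s, of "real (Suc k)"]
    by (simp only: set_lebesgue_integral_def integral_mult_right_zero of_nat_0_less_iff zero_less_Suc) simp
  have normval: "(LINT t|lborel. norm (?f k t)) = norm (c k) * real (Suc k) powr (- Re s) / Re s" for k
  proof -
    \<comment> \<open>Up to the constant \<open>norm (c k)\<close>, the absolute value of the
      integrand is the integrand for the real point \<open>Re s\<close>, so the complex tail
      integral can be used again.\<close>
    have "complex_of_real (LINT t|lborel. norm (?f k t)) =
      (LINT t|lborel. norm (c k) * (indicator {real (Suc k)<..} t *\<^sub>R (complex_of_real t powr (- of_real (Re s) - 1))))"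
      unfolding integral_complex_of_real [symmetric]
    proof (rule Bochner_Integration.integral_cong)
      fix t
      show "complex_of_real (norm (?f k t)) = norm (c k) * (indicator {real (Suc k)<..} t *\<^sub>R (complex_of_real t powr (- of_real (Re s) - 1)))"
      proof (cases "t > real (Suc k)")
        case True
        then have "t > 0" by linarith
        then show ?thesis using True powr_of_real[of t "- Re s - 1"]
          by (simp add: norm_mult norm_powr_of_real_pos del: of_nat_Suc)
      qed simp
    qed simp
    also have "\<dots> = norm (c k) * (of_nat (Suc k) powr (- of_real (Re s)) / of_real (Re s))"
      using powr_tail_integral(2)[of "of_real (Re s)" "real (Suc k)"] s
      by (simp only: set_lebesgue_integral_def integral_mult_right_zero of_nat_0_less_iff zero_less_Suc)
        (use powr_of_real[of "real (Suc k)" "- Re s"] in \<open>simp del: of_nat_Suc\<close>)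
    also have "\<dots> = of_real (norm (c k) * real (Suc k) powr (- Re s) / Re s)"
      using powr_of_real[of "real (Suc k)" "- Re s"] by (simp del: of_nat_Suc)
    finally show ?thesis by (simp only: of_real_eq_iff)
  qed
  \<comment> \<open>At an integer \<open>t\<close> the floor already counts the jump at
    \<open>t\<close> and the open half-line does not. The integers form a null set.\<close>
  have sums: "(\<lambda>k. ?f k t) sums (indicator {0<..} t *\<^sub>R (complex_of_real t powr (- s - 1) * ?S t))"
    if nz: "t \<notin> \<int>" for t
  proof -
    have "(\<lambda>k. ?f k t) sums (\<Sum>k<nat \<lfloor>t\<rfloor>. ?f k t)"
    proof (rule sums_finite)
      fix k assume "k \<notin> {..<nat \<lfloor>t\<rfloor>}"
      then have "nat \<lfloor>t\<rfloor> \<le> k" by simp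
      then have "t < real (Suc k)" by linarith
      then show "?f k t = 0" by simp
    qed simp
    also have "(\<Sum>k<nat \<lfloor>t\<rfloor>. ?f k t) = (\<Sum>k<nat \<lfloor>t\<rfloor>. c k * (complex_of_real t powr (- s - 1)))"
    proof (rule sum.cong)
      fix k assume "k \<in> {..<nat \<lfloor>t\<rfloor>}"
      then have "real (Suc k) \<le> t" by simp linarith
      moreover have "t \<noteq> real (Suc k)" using nz by (metis Ints_of_nat)
      ultimately show "?f k t = c k * (complex_of_real t powr (- s - 1))" by simp
    qed simp
    also have "\<dots> = indicator {0<..} t *\<^sub>R (complex_of_real t powr (- s - 1) * ?S t)"
      by (cases "t > 0") (simp_all add: sum_distrib_right [symmetric] mult.commute)
    finally show ?thesis .
  qed
  have AEZ: "AE t in lborel. t \<notin> (\<int> :: real set)"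
    by (intro AE_not_in countable_imp_null_set_lborel) (simp add: Ints_def)
  have summ: "summable (\<lambda>k. LINT t|lborel. norm (?f k t))"
    unfolding normval by (rule summable_divide[OF sum])
  have summAE: "AE t in lborel. summable (\<lambda>k. norm (?f k t))"
    using AEZ
  proof eventually_elim
    case (elim t)
    show ?case
    proof (rule summable_finite[of "{..<nat \<lfloor>t\<rfloor>}"])
      fix k assume "k \<notin> {..<nat \<lfloor>t\<rfloor>}"
      then have "nat \<lfloor>t\<rfloor> \<le> k" by simp
      then have "t < real (Suc k)" by linarith
      then show "norm (?f k t) = 0" by simp
    qed simp
  qed
  have AEeq: "AE t in lborel. (\<Sum>k. ?f k t) = indicator {0<..} t *\<^sub>R (complex_of_real t powr (- s - 1) * ?S t)"
    using AEZ by eventually_elim (rule sums_unique[OF sums, symmetric])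
  have meas: "(\<lambda>t. indicator {0<..} t *\<^sub>R (complex_of_real t powr (- s - 1) * ?S t)) \<in> borel_measurable lborel"
  proof -
    have "?S \<in> borel_measurable borel"
      by (rule measurable_compose[OF measurable_real_floor]) simp
    from borel_measurable_indicator_powr_mult[OF this] show ?thesis by simp
  qed
  have I: "integrable lborel (\<lambda>t. \<Sum>k. ?f k t)"
    by (rule integrable_suminf[where f = ?f, OF int summAE summ])
  have J: "integral\<^sup>L lborel (\<lambda>t. \<Sum>k. ?f k t) = (\<Sum>k. integral\<^sup>L lborel (?f k))"
    by (rule integral_suminf[where f = ?f, OF int summAE summ])
  show "mellin_integrable ?S s"
    unfolding mellin_integrable_def set_integrable_def
    by (rule integrable_cong_AE_imp[OF I meas AEeq])
  have "mellin ?S s = integral\<^sup>L lborel (\<lambda>t. \<Sum>k. ?f k t)"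
    unfolding mellin_def set_lebesgue_integral_def
    by (rule integral_cong_AE[OF meas borel_measurable_integrable[OF I]]) (use AEeq in \<open>auto elim: eventually_mono\<close>)
  also have "\<dots> = (\<Sum>k. c k * of_nat (Suc k) powr (- s) / s)"
    unfolding J val ..
  also have "\<dots> = (\<Sum>k. c k * of_nat (Suc k) powr (- s)) / s"
  proof (rule suminf_divide)
    show "summable (\<lambda>k. c k * of_nat (Suc k) powr (- s))"
    proof (rule summable_norm_cancel)
      have "norm (c k * of_nat (Suc k) powr (- s)) = norm (c k) * real (Suc k) powr (- Re s)" for k
        using norm_powr_of_real_pos[of "real (Suc k)" "- s"] by (simp add: norm_mult del: of_nat_Suc)
      then show "summable (\<lambda>k. norm (c k * of_nat (Suc k) powr (- s)))" using sum by simp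
    qed
  qed
  finally show "mellin ?S s = (\<Sum>k. c k * of_nat (Suc k) powr (- s)) / s" .
qed


section \<open>The zeta function to the right of the imaginary axis\<close>

lemma one_over_of_nat_Suc_powr: "1 / of_nat (Suc n) powr z = of_nat (Suc n) powr (- z)" for z :: complex
  by (simp add: powr_minus field_simps del: of_nat_Suc)

lemma norm_of_nat_Suc_powr: "norm (complex_of_nat (Suc n) powr z) = real (Suc n) powr Re z"
  using norm_powr_of_real_pos[of "real (Suc n)" z] by (simp del: of_nat_Suc)

lemma summable_Suc_powr: "\<sigma> > 1 \<Longrightarrow> summable (\<lambda>k. real (Suc k) powr (- \<sigma>))"
  using summable_real_powr_iff[of "- \<sigma>"] summable_Suc_iff[of "\<lambda>k. real k powr (- \<sigma>)"] by (simp del: of_nat_Suc)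

lemma summable_of_nat_Suc_powr: "Re s > 1 \<Longrightarrow> summable (\<lambda>k. complex_of_nat (Suc k) powr (- s))"
  by (rule summable_norm_cancel) (simp add: norm_of_nat_Suc_powr summable_Suc_powr del: of_nat_Suc)

text \<open>Cut off below 1, so that the transform converges on all of \<open>Re s > 0\<close>. The
  uncut fractional part equals \<open>t\<close> near 0, which would force
  \<open>Re s < 1\<close>.\<close>

definition frac1 :: "real \<Rightarrow> complex" where
  "frac1 t = (if t \<ge> 1 then of_real (frac t) else 0)"

lemma borel_measurable_frac1 [measurable]: "frac1 \<in> borel_measurable borel"
  unfolding frac1_def frac_def by measurable

lemma norm_frac1_le: "norm (frac1 t) \<le> 1"
  using frac_lt_1[of t] frac_ge_0[of t] by (simp add: frac1_def)

lemma mellin_integrable_frac1: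
  assumes "Re s > 0"
  shows "mellin_integrable frac1 s"
proof (rule mellin_integrable_boundI[where C = 1 and \<alpha> = 0 and \<beta> = "Re s + 1"])
  show "norm (frac1 t) \<le> 1 * t powr 0" if "t \<ge> 1" for t
    using that norm_frac1_le[of t] by simp
qed (use assms in \<open>auto simp: frac1_def\<close>)

text \<open>For \<open>t > 1\<close> the fractional part is \<open>t\<close> minus the number of
  positive integers up to \<open>t\<close>. The first gives \<open>1 / (s - 1)\<close>, the second
  is a step function with all jumps equal to 1.\<close>

lemma mellin_frac1:
  assumes s: "Re s > 1"
  shows "mellin frac1 s = 1 / (s - 1) - (\<Sum>k. of_nat (Suc k) powr (- s)) / s"
proof -
  have sum: "summable (\<lambda>k. norm (1 :: complex) * real (Suc k) powr (- Re s))"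
    using summable_Suc_powr[OF s] by simp
  let ?S = "\<lambda>t :: real. \<Sum>k<nat \<lfloor>t\<rfloor>. 1 :: complex"
  have S: "mellin_integrable ?S s" "mellin ?S s = (\<Sum>k. of_nat (Suc k) powr (- s)) / s"
    using step_function_mellin[OF _ sum] s by (simp_all del: of_nat_Suc sum_constant)
  have I: "set_integrable lborel {1<..} (\<lambda>t. complex_of_real t powr (- (s - 1) - 1))"
    "(LINT t:{1<..}|lborel. complex_of_real t powr (- (s - 1) - 1)) = 1 / (s - 1)"
    using powr_tail_integral[of "s - 1" 1] s by simp_all
  have "mellin frac1 s = (LINT t|lborel. indicator {1<..} t *\<^sub>R (complex_of_real t powr (- (s - 1) - 1)) -
      indicator {0<..} t *\<^sub>R (complex_of_real t powr (- s - 1) * ?S t))"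
    unfolding mellin_def set_lebesgue_integral_def
  proof (rule integral_cong_AE)
    show "(\<lambda>t. indicator {0<..} t *\<^sub>R (complex_of_real t powr (- s - 1) * frac1 t)) \<in> borel_measurable lborel"
      using borel_measurable_indicator_powr_mult[OF borel_measurable_frac1] by simp
    show "(\<lambda>t. indicator {1<..} t *\<^sub>R (complex_of_real t powr (- (s - 1) - 1)) -
      indicator {0<..} t *\<^sub>R (complex_of_real t powr (- s - 1) * ?S t)) \<in> borel_measurable lborel"
      using I(1) S(1) unfolding set_integrable_def mellin_integrable_def
      by (intro borel_measurable_diff borel_measurable_integrable)
    have "AE t in lborel. t \<noteq> (1 :: real)" by (rule AE_lborel_singleton)
    then show "AE t in lborel. indicator {0<..} t *\<^sub>R (complex_of_real t powr (- s - 1) * frac1 t) =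
      indicator {1<..} t *\<^sub>R (complex_of_real t powr (- (s - 1) - 1)) -
      indicator {0<..} t *\<^sub>R (complex_of_real t powr (- s - 1) * ?S t)"
    proof eventually_elim
      fix t :: real assume t: "t \<noteq> 1"
      show "indicator {0<..} t *\<^sub>R (complex_of_real t powr (- s - 1) * frac1 t) =
        indicator {1<..} t *\<^sub>R (complex_of_real t powr (- (s - 1) - 1)) -
        indicator {0<..} t *\<^sub>R (complex_of_real t powr (- s - 1) * ?S t)"
      proof (cases "t > 1")
        case True
        then have S: "?S t = of_real (of_int \<lfloor>t\<rfloor>)"
          by (simp add: of_nat_nat)
        have "complex_of_real t powr (- (s - 1) - 1) = of_real t powr (- s - 1) * of_real t"
          using powr_add[of "complex_of_real t" "- s - 1" 1] True by (simp add: algebra_simps)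
        then show ?thesis using True unfolding S by (simp add: frac1_def frac_def algebra_simps)
      next
        case False
        then have "nat \<lfloor>t\<rfloor> = 0" using t by auto
        then show ?thesis using False t by (simp add: frac1_def)
      qed
    qed
  qed
  also have "\<dots> = 1 / (s - 1) - (\<Sum>k. of_nat (Suc k) powr (- s)) / s"
    using I S unfolding set_integrable_def mellin_integrable_def set_lebesgue_integral_def mellin_def
    by (subst Bochner_Integration.integral_diff) simp_all
  finally show ?thesis .
qed

lemma mellin_frac1_holomorphic: "mellin frac1 holomorphic_on {s. 0 < Re s}"
  using mellin_holomorphic_open[of "{0<..}" frac1] mellin_integrable_frac1 by simp

lemma riemann_zeta_frac1:
  assumes "Re s > 0" "s \<noteq> 1"
  shows "riemann_zeta s = s / (s - 1) - s * mellin frac1 s"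
proof (rule riemann_zeta_eqI[of 0])
  show "(\<lambda>s. s / (s - 1) - s * mellin frac1 s) holomorphic_on {z. 0 < Re z} - {1}"
    by (intro holomorphic_intros holomorphic_on_subset[OF mellin_frac1_holomorphic]) auto
  fix z assume z: "1 < Re z"
  then have "z \<noteq> 0" "z \<noteq> 1" by auto
  then have "z / (z - 1) - z * mellin frac1 z = (\<Sum>k. of_nat (Suc k) powr (- z))"
    unfolding mellin_frac1[OF z] by (simp only: right_diff_distrib) simp
  then show "(\<lambda>n. 1 / of_nat (Suc n) powr z) sums (z / (z - 1) - z * mellin frac1 z)"
    using summable_sums[OF summable_of_nat_Suc_powr[OF z]] by (simp only: one_over_of_nat_Suc_powr)
qed (use assms in auto)

lemma riemann_zeta_sums:
  assumes s: "Re s > 1"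
  shows "(\<lambda>k. of_nat (Suc k) powr (- s)) sums riemann_zeta s"
proof -
  have "Re s > 0" "s \<noteq> 1" "s \<noteq> 0" "s - 1 \<noteq> 0" using s by auto
  then have "riemann_zeta s = (\<Sum>k. of_nat (Suc k) powr (- s))"
    unfolding riemann_zeta_frac1[OF \<open>Re s > 0\<close> \<open>s \<noteq> 1\<close>] mellin_frac1[OF s]
    by (simp only: right_diff_distrib) simp
  then show ?thesis using summable_sums[OF summable_of_nat_Suc_powr[OF s]] by simp
qed

text \<open>This is \<open>s * \<zeta>(1 + s)\<close>, with the pole of zeta cancelled by the factor
  \<open>s\<close> and the removable singularity at 0 filled in. It relates the transforms of
  \<open>\<phi>\<close> and \<open>star_series\<close>, and its reciprocal is what the Perron
  integral contains.\<close>

definition zeta_reg :: "complex \<Rightarrow> complex" where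
  "zeta_reg s = (1 + s) - s * (1 + s) * mellin frac1 (1 + s)"

lemma zeta_reg_holomorphic: "zeta_reg holomorphic_on {s. -1 < Re s}"
proof -
  have "(mellin frac1 \<circ> (\<lambda>s. 1 + s)) holomorphic_on {s. -1 < Re s}"
    by (rule holomorphic_on_compose_gen[OF _ mellin_frac1_holomorphic]) (auto intro!: holomorphic_intros)
  then show ?thesis unfolding zeta_reg_def[abs_def] o_def by (intro holomorphic_intros)
qed

lemma zeta_reg_eq: "Re s > -1 \<Longrightarrow> s \<noteq> 0 \<Longrightarrow> zeta_reg s = s * riemann_zeta (1 + s)"
  by (subst riemann_zeta_frac1) (auto simp: zeta_reg_def field_simps)

lemma zeta_reg_0 [simp]: "zeta_reg 0 = 1"
  by (simp add: zeta_reg_def)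

text \<open>The piece between 0 and 1 adds \<open>1 / (1 - s)\<close> to the transform of
  \<open>frac1\<close>, which cancels the term \<open>s / (s - 1)\<close> of the continuation
  formula.\<close>

lemma mellin_frac:
  assumes s: "0 < Re s" "Re s < 1"
  shows "mellin_integrable (\<lambda>t. of_real (frac t)) s"
    and "riemann_zeta s = - s * mellin (\<lambda>t. of_real (frac t)) s"
proof -
  have [measurable]: "(\<lambda>t. complex_of_real (frac t)) \<in> borel_measurable borel"
    unfolding frac_def by measurable
  show F: "mellin_integrable (\<lambda>t. of_real (frac t)) s"
  proof (rule mellin_integrable_boundI[where C = 1 and \<alpha> = 0 and \<beta> = 1])
    show "norm (complex_of_real (frac t)) \<le> 1 * t powr 0" if "t \<ge> 1" for t
      using that frac_lt_1[of t] frac_ge_0[of t] by simp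
    show "norm (complex_of_real (frac t)) \<le> 1 * t powr 1" if "0 < t" "t < 1" for t
      using that frac_eq[of t] by simp
  qed (use s in auto)
  have I: "set_integrable lborel {0<..<1} (\<lambda>t. complex_of_real t powr (- (s - 1) - 1))"
    "(LINT t:{0<..<1}|lborel. complex_of_real t powr (- (s - 1) - 1)) = - (1 / (s - 1))"
    using powr_head_integral[of "s - 1" 1] s by simp_all
  have F1: "mellin_integrable frac1 s" using s by (intro mellin_integrable_frac1)
  have "mellin (\<lambda>t. of_real (frac t)) s =
      (LINT t|lborel. indicator {0<..<1} t *\<^sub>R (complex_of_real t powr (- (s - 1) - 1)) +
      indicator {0<..} t *\<^sub>R (complex_of_real t powr (- s - 1) * frac1 t))"
    unfolding mellin_def set_lebesgue_integral_def
  proof (rule Bochner_Integration.integral_cong)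
    fix t :: real
    consider "t \<le> 0" | "0 < t" "t < 1" | "t \<ge> 1" by linarith
    then show "indicator {0<..} t *\<^sub>R (complex_of_real t powr (- s - 1) * complex_of_real (frac t)) =
      indicator {0<..<1} t *\<^sub>R (complex_of_real t powr (- (s - 1) - 1)) +
      indicator {0<..} t *\<^sub>R (complex_of_real t powr (- s - 1) * frac1 t)"
    proof cases
      case 2
      then have "complex_of_real t powr (- (s - 1) - 1) = of_real t powr (- s - 1) * of_real t"
        using powr_add[of "complex_of_real t" "- s - 1" 1] by (simp add: algebra_simps)
      then show ?thesis using 2 frac_eq[of t] by (simp add: frac1_def)
    qed (simp_all add: frac1_def)
  qed simp
  also have "\<dots> = - (1 / (s - 1)) + mellin frac1 s"
    using I F1 unfolding set_integrable_def mellin_integrable_def set_lebesgue_integral_def mellin_def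
    by (subst Bochner_Integration.integral_add) simp_all
  finally have M: "mellin (\<lambda>t. of_real (frac t)) s = - (1 / (s - 1)) + mellin frac1 s" .
  have "s \<noteq> 1" using s by auto
  then show "riemann_zeta s = - s * mellin (\<lambda>t. of_real (frac t)) s"
    unfolding M riemann_zeta_frac1[OF s(1) \<open>s \<noteq> 1\<close>] by (simp add: algebra_simps)
qed

section \<open>The Euler product and zero-free half-plane\<close>

lemma zeta_has_sum:
  assumes s: "Re s > 1"
  shows "((\<lambda>n. of_nat n powr (- s)) has_sum riemann_zeta s) {0<..}"
    and "(\<lambda>n. norm (complex_of_nat n powr (- s))) summable_on {0<..}"
proof -
  have im: "{0 :: nat<..} = Suc ` UNIV" by (auto simp: image_iff gr0_conv_Suc)
  have summ: "summable (\<lambda>k. norm (complex_of_nat (Suc k) powr (- s)))"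
    unfolding norm_of_nat_Suc_powr using summable_Suc_powr[OF s] by simp
  show "((\<lambda>n. of_nat n powr (- s)) has_sum riemann_zeta s) {0<..}"
    unfolding im using norm_summable_imp_has_sum[OF summ riemann_zeta_sums[OF s]]
    by (subst has_sum_reindex) (simp_all add: o_def)
  show "(\<lambda>n. norm (complex_of_nat n powr (- s))) summable_on {0<..}"
    unfolding im using summ
    by (subst summable_on_reindex) (simp_all add: o_def summable_on_UNIV_nonneg_real_iff)
qed

lemma of_nat_mult_powr:
  "complex_of_nat (m * n) powr z = of_nat m powr z * of_nat n powr z"
proof (cases "m = 0 \<or> n = 0")
  case False
  then have "m > 0" "n > 0" by auto
  then show ?thesis
    using powr_of_real_pos[of "real m" z] powr_of_real_pos[of "real n" z] powr_of_real_pos[of "real (m * n)" z]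
    by (simp add: ln_mult exp_add [symmetric] ring_distribs)
qed auto

definition sieved :: "nat set \<Rightarrow> nat set" where
  "sieved P = {n. n > 0 \<and> (\<forall>p\<in>P. \<not> p dvd n)}"

lemma sieved_insert:
  assumes "prime p" "\<And>q. q \<in> P \<Longrightarrow> prime q" "p \<notin> P"
  shows "sieved (insert p P) = sieved P - (\<lambda>n. p * n) ` sieved P"
    and "(\<lambda>n. p * n) ` sieved P \<subseteq> sieved P"
proof -
  have q: "\<not> q dvd p" if "q \<in> P" for q
    using assms that primes_dvd_imp_eq by blast
  show "(\<lambda>n. p * n) ` sieved P \<subseteq> sieved P"
    using q assms by (auto simp: sieved_def prime_dvd_mult_iff prime_gt_0_nat)
  show "sieved (insert p P) = sieved P - (\<lambda>n. p * n) ` sieved P"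
  proof (intro equalityI subsetI)
    fix n assume "n \<in> sieved (insert p P)"
    then show "n \<in> sieved P - (\<lambda>n. p * n) ` sieved P" by (auto simp: sieved_def)
  next
    fix n assume n: "n \<in> sieved P - (\<lambda>n. p * n) ` sieved P"
    have "\<not> p dvd n"
    proof
      assume "p dvd n"
      then obtain m where m: "n = p * m" by (elim dvdE)
      then have "m \<in> sieved P" using n by (auto simp: sieved_def)
      then show False using n m by auto
    qed
    then show "n \<in> sieved (insert p P)" using n by (auto simp: sieved_def)
  qed
qed

text \<open>The sieve of Eratosthenes: among the integers still left, multiplication by
  \<open>1 - of_nat p powr (- s)\<close> removes the multiples of \<open>p\<close>.\<close>

lemma euler_sieve:
  assumes s: "Re s > 1" and "finite P" "\<And>p. p \<in> P \<Longrightarrow> prime p"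
  shows "((\<lambda>n. of_nat n powr (- s)) has_sum (riemann_zeta s * (\<Prod>p\<in>P. 1 - of_nat p powr (- s)))) (sieved P)"
  using assms(2,3)
proof (induction P rule: finite_induct)
  case empty
  have "sieved {} = {0<..}" by (auto simp: sieved_def)
  then show ?case using zeta_has_sum(1)[OF s] by simp
next
  case (insert p P)
  let ?X = "riemann_zeta s * (\<Prod>p\<in>P. 1 - of_nat p powr (- s))"
  have IH: "((\<lambda>n. of_nat n powr (- s)) has_sum ?X) (sieved P)"
    using insert by auto
  have p: "p > 0" using insert.prems prime_gt_0_nat by blast
  have "((\<lambda>n. of_nat n powr (- s)) has_sum (of_nat p powr (- s) * ?X)) ((\<lambda>n. p * n) ` sieved P)"
    using has_sum_cmult_right[OF IH, of "of_nat p powr (- s)"] p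
    by (subst has_sum_reindex) (auto simp: inj_on_def o_def of_nat_mult_powr simp del: of_nat_mult)
  then have "((\<lambda>n. of_nat n powr (- s)) has_sum (?X - of_nat p powr (- s) * ?X)) (sieved P - (\<lambda>n. p * n) ` sieved P)"
    using insert.prems insert.hyps by (intro has_sum_Diff IH sieved_insert(2)) auto
  moreover have "sieved (insert p P) = sieved P - (\<lambda>n. p * n) ` sieved P"
    using insert.prems insert.hyps by (intro sieved_insert(1)) auto
  ultimately show ?case using insert.hyps by (simp add: algebra_simps)
qed

text \<open>In the limit the sieve leaves only the integer 1. Stated with zeta as a factor and with
  limit 1, the product formula yields nonvanishing at once, since a zero would make the sequence
  constantly 0.\<close>

lemma euler_product_LIMSEQ:
  assumes s: "Re s > 1"
  shows "(\<lambda>N. riemann_zeta s * (\<Prod>p | prime p \<and> p \<le> N. 1 - of_nat p powr (- s))) \<longlonglongrightarrow> 1"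
proof -
  let ?P = "\<lambda>N :: nat. {p. prime p \<and> p \<le> N}"
  define a where "a = (\<lambda>k N. if Suc k \<in> sieved (?P N) then complex_of_nat (Suc k) powr (- s) else 0)"
  have fin: "finite (?P N)" for N by (rule finite_subset[of _ "{..N}"]) auto
  have X: "suminf (\<lambda>k. a k N) = riemann_zeta s * (\<Prod>p\<in>?P N. 1 - of_nat p powr (- s))" for N
  proof -
    have "((\<lambda>n. of_nat n powr (- s)) has_sum (riemann_zeta s * (\<Prod>p\<in>?P N. 1 - of_nat p powr (- s)))) (sieved (?P N))"
      by (rule euler_sieve[OF s fin]) auto
    also have "sieved (?P N) = Suc ` {k. Suc k \<in> sieved (?P N)}"
    proof -
      have "n \<in> Suc ` {k. Suc k \<in> sieved (?P N)}" if "n \<in> sieved (?P N)" for n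
        using that by (cases n) (auto simp: sieved_def)
      then show ?thesis by auto
    qed
    finally have "((\<lambda>k. complex_of_nat (Suc k) powr (- s)) has_sum (riemann_zeta s * (\<Prod>p\<in>?P N. 1 - of_nat p powr (- s)))) {k. Suc k \<in> sieved (?P N)}"
      by (subst (asm) has_sum_reindex) (auto simp: o_def)
    also have "?this \<longleftrightarrow> ((\<lambda>k. a k N) has_sum (riemann_zeta s * (\<Prod>p\<in>?P N. 1 - of_nat p powr (- s)))) UNIV"
      by (rule has_sum_cong_neutral) (auto simp: a_def)
    finally show ?thesis by (metis has_sum_imp_sums sums_unique)
  qed
  have "((\<lambda>N. suminf (\<lambda>k. a k N)) \<longlonglongrightarrow> suminf (\<lambda>k. if k = 0 then 1 else 0))"
  proof (rule tannerys_theorem[where M = "\<lambda>k. real (Suc k) powr (- Re s)", THEN conjunct2, THEN conjunct2])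
    \<comment> \<open>As soon as \<open>N \<ge> k + 1\<close>, the integer \<open>k + 1\<close> is
      sieved out by one of its prime factors, unless \<open>k = 0\<close>.\<close>
    show "(\<lambda>N. a k N) \<longlonglongrightarrow> (if k = 0 then 1 else 0)" for k
    proof (rule tendsto_eventually)
      show "\<forall>\<^sub>F N in sequentially. a k N = (if k = 0 then 1 else 0)"
        using eventually_ge_at_top[of "Suc k"]
      proof eventually_elim
        case (elim N)
        show ?case
        proof (cases "k = 0")
          case True
          then show ?thesis by (auto simp: a_def sieved_def)
        next
          case False
          then obtain p where "prime p" "p dvd Suc k" using prime_factor_nat[of "Suc k"] by auto
          then have "Suc k \<notin> sieved (?P N)" using elim dvd_imp_le[of p "Suc k"] by (auto simp: sieved_def)
          then show ?thesis using False by (simp add: a_def)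
        qed
      qed
    qed
    have "norm (a k N) \<le> real (Suc k) powr (- Re s)" for k N
      using norm_of_nat_Suc_powr[of k "- s"] by (simp add: a_def del: of_nat_Suc)
    then show "\<forall>\<^sub>F (k, N) in sequentially \<times>\<^sub>F sequentially. norm (a k N) \<le> real (Suc k) powr (- Re s)"
      by (simp add: always_eventually)
  qed (use summable_Suc_powr[OF s] in auto)
  moreover have "suminf (\<lambda>k. if k = 0 then 1 else 0 :: complex) = 1"
    using sums_If_finite_set[of "{0}" "\<lambda>_. 1 :: complex"] by (simp add: sums_iff)
  ultimately show ?thesis unfolding X by simp
qed

lemma riemann_zeta_nonzero_gt_1:
  assumes "Re s > 1" shows "riemann_zeta s \<noteq> 0"
proof
  assume "riemann_zeta s = 0"
  then have "(\<lambda>_ :: nat. 0 :: complex) \<longlonglongrightarrow> 1"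
    using euler_product_LIMSEQ[OF assms] by simp
  then show False by (simp add: LIMSEQ_const_iff)
qed

text \<open>The logarithm of the product is a sum of terms \<open>-(3 + 4 cos \<theta> + cos 2\<theta>) r\<^sup>k/k\<close>.\<close>

lemma three_four_one:
  fixes r :: real and w :: complex
  assumes r: "0 < r" "r < 1" and w: "norm w = 1"
  shows "norm (1 - of_real r :: complex) ^ 3 * norm (1 - of_real r * w) ^ 4 * norm (1 - of_real r * w\<^sup>2) \<le> 1"
proof -
  define L where "L = (\<lambda>z :: complex. Re (ln (1 - z)))"
  have L: "norm (1 - z) = exp (L z)" "(\<lambda>n. - Re (z ^ n) / real n) sums L z" if "norm z < 1" for z
  proof -
    have "1 - z \<noteq> 0" using that by auto
    then show "norm (1 - z) = exp (L z)" by (simp add: L_def)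
    \<comment> \<open>The term at \<open>n = 0\<close> is a quotient by 0 and hence 0, so the
      logarithmic series effectively starts at 1.\<close>
    have "(\<lambda>n. Re (- ((- (- z)) ^ n) / of_nat n)) sums Re (ln (1 + (- z)))"
      by (intro sums_Re Ln_series') (use that in simp)
    moreover have "Re (- ((- (- z)) ^ n) / of_nat n) = - Re (z ^ n) / real n" for n
      by (simp add: Re_divide_of_nat)
    ultimately show "(\<lambda>n. - Re (z ^ n) / real n) sums L z"
      by (simp add: L_def)
  qed
  let ?r = "complex_of_real r"
  have n: "norm ?r < 1" "norm (?r * w) < 1" "norm (?r * w\<^sup>2) < 1"
    using r w by (simp_all add: norm_mult norm_power)
  have sums: "(\<lambda>n. 3 * (- Re (?r ^ n) / real n) + 4 * (- Re ((?r * w) ^ n) / real n) + (- Re ((?r * w\<^sup>2) ^ n) / real n))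
      sums (3 * L ?r + 4 * L (?r * w) + L (?r * w\<^sup>2))"
    by (intro sums_add sums_mult L n)
  have le: "3 * (- Re (?r ^ n) / real n) + 4 * (- Re ((?r * w) ^ n) / real n) + (- Re ((?r * w\<^sup>2) ^ n) / real n) \<le> 0" for n
  proof -
    have R: "Re (complex_of_real x * v) = x * Re v" for x v by simp
    define u where "u = w ^ n"
    have u: "(Re u)\<^sup>2 + (Im u)\<^sup>2 = 1"
      using w cmod_power2[of u] by (simp add: u_def norm_power)
    have "(?r * w) ^ n = of_real (r ^ n) * u" "(?r * w\<^sup>2) ^ n = of_real (r ^ n) * u\<^sup>2" "?r ^ n = of_real (r ^ n)"
      by (simp_all add: u_def power_mult_distrib mult.commute flip: power_mult)
    then have e: "Re ((?r * w) ^ n) = r ^ n * Re u" "Re ((?r * w\<^sup>2) ^ n) = r ^ n * Re (u\<^sup>2)" "Re (?r ^ n) = r ^ n"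
      by (metis R, metis R, metis Re_complex_of_real)
    have "3 * (- Re (?r ^ n) / real n) + 4 * (- Re ((?r * w) ^ n) / real n) + (- Re ((?r * w\<^sup>2) ^ n) / real n)
      = - (r ^ n * (3 + 4 * Re u + Re (u\<^sup>2)) / real n)"
      unfolding e by (simp add: divide_inverse algebra_simps del: times_complex.sel)
    also have "Re (u\<^sup>2) = 2 * (Re u)\<^sup>2 - 1"
      using u by (simp add: power2_eq_square)
    also have "3 + 4 * Re u + (2 * (Re u)\<^sup>2 - 1) = 2 * (1 + Re u)\<^sup>2"
      by (simp add: power2_eq_square algebra_simps)
    finally show ?thesis using r by simp
  qed
  have "3 * L ?r + 4 * L (?r * w) + L (?r * w\<^sup>2) \<le> 0"
    by (rule sums_le[OF le sums sums_zero])
  then have "exp (3 * L ?r + 4 * L (?r * w) + L (?r * w\<^sup>2)) \<le> 1" by simp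
  also have "exp (3 * L ?r + 4 * L (?r * w) + L (?r * w\<^sup>2)) =
      exp (L ?r) ^ 3 * exp (L (?r * w)) ^ 4 * exp (L (?r * w\<^sup>2))"
    by (simp add: exp_add flip: exp_of_nat_mult)
  finally show ?thesis using L(1)[OF n(1)] L(1)[OF n(2)] L(1)[OF n(3)] by simp
qed

text \<open>The factors of the three Euler products satisfy the opposite inequality prime by prime,
  by \<open>three_four_one\<close> with \<open>r = p powr (- \<sigma>)\<close>. Each zeta value
  times its product tends to 1, which turns the inequality around.\<close>

lemma zeta_three_four_one:
  assumes \<sigma>: "\<sigma> > 1"
  shows "1 \<le> norm (riemann_zeta (of_real \<sigma>)) ^ 3 * norm (riemann_zeta (Complex \<sigma> t)) ^ 4 * norm (riemann_zeta (Complex \<sigma> (2 * t)))"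
proof -
  let ?P = "\<lambda>N :: nat. {p. prime p \<and> p \<le> N}"
  let ?Q = "\<lambda>s N. \<Prod>p\<in>?P N. 1 - of_nat p powr (- s)"
  let ?Z = "norm (riemann_zeta (of_real \<sigma>)) ^ 3 * norm (riemann_zeta (Complex \<sigma> t)) ^ 4 * norm (riemann_zeta (Complex \<sigma> (2 * t)))"
  have "(\<lambda>N. norm (riemann_zeta (of_real \<sigma>) * ?Q (of_real \<sigma>) N) ^ 3 *
      norm (riemann_zeta (Complex \<sigma> t) * ?Q (Complex \<sigma> t) N) ^ 4 *
      norm (riemann_zeta (Complex \<sigma> (2 * t)) * ?Q (Complex \<sigma> (2 * t)) N))
    \<longlonglongrightarrow> norm (1 :: complex) ^ 3 * norm (1 :: complex) ^ 4 * norm (1 :: complex)"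
    using \<sigma> by (intro tendsto_mult tendsto_power tendsto_norm euler_product_LIMSEQ) auto
  then have "(\<lambda>N. norm (riemann_zeta (of_real \<sigma>) * ?Q (of_real \<sigma>) N) ^ 3 *
      norm (riemann_zeta (Complex \<sigma> t) * ?Q (Complex \<sigma> t) N) ^ 4 *
      norm (riemann_zeta (Complex \<sigma> (2 * t)) * ?Q (Complex \<sigma> (2 * t)) N)) \<longlonglongrightarrow> 1"
    by simp
  then show ?thesis
  proof (rule LIMSEQ_le_const2, intro exI allI impI)
    fix N :: nat
    let ?q = "\<lambda>p. norm (1 - complex_of_nat p powr (- of_real \<sigma>)) ^ 3 *
      norm (1 - complex_of_nat p powr (- Complex \<sigma> t)) ^ 4 * norm (1 - complex_of_nat p powr (- Complex \<sigma> (2 * t)))"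
    have "(\<Prod>p\<in>?P N. ?q p) \<le> 1"
    proof (intro prod_le_1 conjI)
      fix p assume "p \<in> ?P N"
      then have p: "p > 1" using prime_gt_1_nat by auto
      define r where "r = real p powr (- \<sigma>)"
      define w where "w = exp (- \<i> * of_real (t * ln (real p)))"
      have pw: "complex_of_nat p powr z = exp (z * of_real (ln (real p)))" for z
        using powr_of_real_pos[of "real p" z] p by simp
      have r: "complex_of_real r = complex_of_nat p powr (- of_real \<sigma>)"
        using powr_of_real[of "real p" "- \<sigma>"] p by (simp add: r_def)
      have 1: "complex_of_nat p powr (- Complex \<sigma> t) = of_real r * w"
        unfolding r pw w_def by (simp add: exp_add [symmetric] Complex_eq algebra_simps)
      have 2: "complex_of_nat p powr (- Complex \<sigma> (2 * t)) = of_real r * w\<^sup>2"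
        unfolding r pw w_def by (simp add: exp_add [symmetric] Complex_eq algebra_simps flip: exp_double)
      have "r < real p powr 0" unfolding r_def using p \<sigma> by (intro powr_less_mono) auto
      then have "0 < r" "r < 1" using p by (auto simp: r_def)
      then show "?q p \<le> 1"
        unfolding 1 2 r [symmetric] by (rule three_four_one) (simp add: w_def)
    qed simp
    then have "?Z * (\<Prod>p\<in>?P N. ?q p) \<le> ?Z * 1" by (rule mult_left_mono) simp
    then show "norm (riemann_zeta (of_real \<sigma>) * ?Q (of_real \<sigma>) N) ^ 3 *
      norm (riemann_zeta (Complex \<sigma> t) * ?Q (Complex \<sigma> t) N) ^ 4 *
      norm (riemann_zeta (Complex \<sigma> (2 * t)) * ?Q (Complex \<sigma> (2 * t)) N) \<le> ?Z"
      by (simp add: norm_mult prod_norm [symmetric] prod.distrib prod_power_distrib power_mult_distrib mult_ac)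
  qed
qed

text \<open>Let \<open>\<sigma> = 1 + h\<close> with \<open>h\<close> decreasing to 0. The cube at
  the real point grows like the third power of \<open>1 / h\<close>, while a zero at
  \<open>1 + \<i>t\<close> would make the fourth power of the middle factor at most a constant times
  \<open>h ^ 4\<close>. The 3-4-1 product would tend to 0 although it is at least 1.\<close>

lemma riemann_zeta_nonzero_eq_1:
  assumes t: "t \<noteq> 0" shows "riemann_zeta (Complex 1 t) \<noteq> 0"
proof
  assume z: "riemann_zeta (Complex 1 t) = 0"
  have hol: "zeta_reg holomorphic_on {s. -1 < Re s}" by (rule zeta_reg_holomorphic)
  have op: "open {s. -1 < Re s}" by (rule open_halfspace_Re_gt)
  have cont: "isCont zeta_reg s" if "-1 < Re s" for s
    using holomorphic_on_imp_continuous_on[OF hol] op that by (simp add: continuous_on_eq_continuous_at)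
  have lim: "((\<lambda>h. zeta_reg (Complex h u)) \<longlongrightarrow> zeta_reg (Complex 0 u)) (at_right 0)" for u
  proof (rule isCont_tendsto_compose[OF cont])
    have "((\<lambda>h. Complex h u) \<longlongrightarrow> Complex 0 u) (at 0)"
      by (intro tendsto_Complex tendsto_ident_at tendsto_const)
    then show "((\<lambda>h. Complex h u) \<longlongrightarrow> Complex 0 u) (at_right 0)"
      by (rule filterlim_mono) (simp_all add: at_le)
  qed simp
  have reg0: "zeta_reg (Complex 0 t) = 0"
  proof -
    have "1 + Complex 0 t = Complex 1 t" "Complex 0 t \<noteq> 0" using t by (simp_all add: complex_eq_iff)
    then show ?thesis using zeta_reg_eq[of "Complex 0 t"] z by simp
  qed
  obtain D where "(zeta_reg has_field_derivative D) (at (Complex 0 t))"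
    using holomorphic_on_imp_differentiable_at[OF hol op, of "Complex 0 t"]
    by (auto simp: field_differentiable_def)
  then have "((\<lambda>h. (zeta_reg (Complex 0 t + h) - zeta_reg (Complex 0 t)) / h) \<longlongrightarrow> D) (at 0)"
    by (simp add: DERIV_def)
  moreover have "filterlim (\<lambda>h. complex_of_real h) (at 0) (at_right 0)"
  proof -
    have "((\<lambda>h. complex_of_real h) \<longlongrightarrow> of_real 0) (at_right 0)"
      by (intro tendsto_of_real tendsto_ident_at)
    then show ?thesis by (simp add: filterlim_at eventually_at_filter)
  qed
  ultimately have "((\<lambda>h. (zeta_reg (Complex 0 t + of_real h) - zeta_reg (Complex 0 t)) / of_real h) \<longlongrightarrow> D) (at_right 0)"
    by (rule filterlim_compose)
  moreover have "(zeta_reg (Complex 0 t + of_real h) - zeta_reg (Complex 0 t)) / of_real h = zeta_reg (Complex h t) / of_real h" for h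
  proof -
    have "Complex 0 t + of_real h = Complex h t" by (simp add: complex_eq_iff)
    then show ?thesis by (simp add: reg0)
  qed
  ultimately have limD: "((\<lambda>h. zeta_reg (Complex h t) / of_real h) \<longlongrightarrow> D) (at_right 0)" by simp
  \<comment> \<open>The 3-4-1 product expressed by \<open>zeta_reg\<close>: three factors
    \<open>1 / h\<close> from the pole against four factors \<open>h\<close> from the zero leave a
    single \<open>h\<close>. The remaining denominators stay away from 0 because
    \<open>t \<noteq> 0\<close>.\<close>
  have "((\<lambda>h. norm (zeta_reg (Complex h 0)) ^ 3 * norm (zeta_reg (Complex h t) / of_real h) ^ 4 *
      norm (zeta_reg (Complex h (2 * t))) * h / (norm (Complex h t) ^ 4 * norm (Complex h (2 * t))))
      \<longlongrightarrow> norm (zeta_reg (Complex 0 0)) ^ 3 * norm D ^ 4 * norm (zeta_reg (Complex 0 (2 * t))) * 0 /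
        (norm (Complex 0 t) ^ 4 * norm (Complex 0 (2 * t)))) (at_right 0)"
    using t by (intro tendsto_divide tendsto_mult tendsto_power tendsto_norm lim limD tendsto_Complex
        tendsto_const tendsto_ident_at) (auto simp: complex_eq_iff)
  then have "((\<lambda>h. norm (zeta_reg (Complex h 0)) ^ 3 * norm (zeta_reg (Complex h t) / of_real h) ^ 4 *
      norm (zeta_reg (Complex h (2 * t))) * h / (norm (Complex h t) ^ 4 * norm (Complex h (2 * t)))) \<longlongrightarrow> 0) (at_right 0)"
    by simp
  moreover have "\<forall>\<^sub>F h in at_right 0. 1 \<le> norm (zeta_reg (Complex h 0)) ^ 3 * norm (zeta_reg (Complex h t) / of_real h) ^ 4 *
      norm (zeta_reg (Complex h (2 * t))) * h / (norm (Complex h t) ^ 4 * norm (Complex h (2 * t)))"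
    unfolding eventually_at_filter
  proof (intro always_eventually allI impI)
    fix h :: real assume "h \<noteq> 0" "h \<in> {0<..}"
    then have h: "h > 0" by simp
    have reg: "zeta_reg (Complex h u) = Complex h u * riemann_zeta (Complex (1 + h) u)" for u
    proof -
      have "1 + Complex h u = Complex (1 + h) u" by (simp add: complex_eq_iff)
      moreover have "Complex h u \<noteq> 0" using h by (simp add: complex_eq_iff)
      ultimately show ?thesis using zeta_reg_eq[of "Complex h u"] h by simp
    qed
    have h0: "complex_of_real (1 + h) = Complex (1 + h) 0" by (rule complex_of_real_def)
    have nz: "Complex h u \<noteq> 0" for u using h by (auto simp: complex_eq_iff)
    have nh: "norm (Complex h 0) = h" using h by (simp add: cmod_def)
    have "1 \<le> norm (riemann_zeta (Complex (1 + h) 0)) ^ 3 * norm (riemann_zeta (Complex (1 + h) t)) ^ 4 * norm (riemann_zeta (Complex (1 + h) (2 * t)))"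
      using zeta_three_four_one[of "1 + h" t] h by (simp only: h0)
    also have "\<dots> = norm (zeta_reg (Complex h 0)) ^ 3 * norm (zeta_reg (Complex h t) / of_real h) ^ 4 *
      norm (zeta_reg (Complex h (2 * t))) * h / (norm (Complex h t) ^ 4 * norm (Complex h (2 * t)))"
    proof -
      have A: "a ^ 3 * b ^ 4 * c = (h * a) ^ 3 * (x * b / h) ^ 4 * (y * c) * h / (x ^ 4 * y)"
        if "x \<noteq> 0" "y \<noteq> 0" for a b c x y :: real
      proof -
        have h4: "h ^ 4 = h ^ 3 * h" by (simp add: power_numeral_reduce)
        show ?thesis using that h by (simp add: power_mult_distrib power_divide h4)
      qed
      show ?thesis unfolding reg norm_mult norm_divide nh norm_of_real abs_of_pos[OF h]
        by (rule A) (use nz in auto)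
    qed
    finally show "1 \<le> norm (zeta_reg (Complex h 0)) ^ 3 * norm (zeta_reg (Complex h t) / of_real h) ^ 4 *
      norm (zeta_reg (Complex h (2 * t))) * h / (norm (Complex h t) ^ 4 * norm (Complex h (2 * t)))" .
  qed
  ultimately have "(1 :: real) \<le> 0"
    by (rule tendsto_lowerbound) simp
  then show False by simp
qed

text \<open>Complements the Riemann hypothesis, which speaks of the open strip only: together they
  keep the whole half-plane right of the critical line free of zeros.\<close>

lemma riemann_zeta_nonzero:
  assumes "Re s \<ge> 1" "s \<noteq> 1" shows "riemann_zeta s \<noteq> 0"
proof (cases "Re s = 1")
  case True
  then have "s = Complex 1 (Im s)" "Im s \<noteq> 0" using assms by (auto simp: complex_eq_iff)
  then show ?thesis using riemann_zeta_nonzero_eq_1 by metis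
next
  case False
  then show ?thesis using riemann_zeta_nonzero_gt_1[of s] assms by simp
qed

section \<open>The Moebius function\<close>

definition moebius :: "nat \<Rightarrow> real" where
  "moebius n = (if squarefree n then (-1) ^ card (prime_factors n) else 0)"

lemma abs_moebius_le: "\<bar>moebius n\<bar> \<le> 1"
  by (simp add: moebius_def power_abs)

lemma moebius_1 [simp]: "moebius (Suc 0) = 1"
  by (simp add: moebius_def)

text \<open>Fix a prime \<open>p\<close> dividing \<open>n\<close>. Only squarefree divisors count,
  and \<open>d \<mapsto> p * d\<close> pairs those not divisible by \<open>p\<close> with those
  divisible by \<open>p\<close>, with opposite signs.\<close>

lemma sum_moebius_divisors:
  assumes n: "n > 1"
  shows "(\<Sum>d | d dvd n. moebius d) = 0"
proof -
  obtain p where p: "prime p" "p dvd n" using prime_factor_nat[of n] n by auto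
  have p0: "p > 0" using p prime_gt_0_nat by blast
  have fin: "finite {d. d dvd n}" using n by (intro finite_divisors_nat) auto
  let ?S = "{d. d dvd n \<and> squarefree d \<and> \<not> p dvd d}"
  let ?T = "(\<lambda>d. p * d) ` ?S"
  have pd: "squarefree (p * d)" "moebius (p * d) = - moebius d" if "squarefree d" "\<not> p dvd d" for d
  proof -
    have cop: "coprime p d" using p that by (simp add: prime_imp_coprime)
    show sf: "squarefree (p * d)"
      by (rule squarefree_mult_coprime[OF cop squarefree_prime[OF p(1)] that(1)])
    have "d \<noteq> 0" using that by (auto intro: Nat.gr0I)
    then have "prime_factors (p * d) = insert p (prime_factors d)"
      using p p0 by (simp add: prime_factors_product prime_prime_factors)
    moreover have "p \<notin> prime_factors d" using that by auto
    ultimately have "card (prime_factors (p * d)) = Suc (card (prime_factors d))" by simp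
    then show "moebius (p * d) = - moebius d" using sf that by (simp add: moebius_def)
  qed
  have "(\<Sum>d | d dvd n. moebius d) = (\<Sum>d\<in>?S \<union> ?T. moebius d)"
  proof (rule sum.mono_neutral_right[OF fin])
    show "?S \<union> ?T \<subseteq> {d. d dvd n}"
    proof
      fix d assume "d \<in> ?S \<union> ?T"
      then show "d \<in> {d. d dvd n}"
      proof
        assume "d \<in> ?T"
        then obtain e where e: "d = p * e" "e dvd n" "\<not> p dvd e" by auto
        then have "coprime p e" using p by (simp add: prime_imp_coprime)
        then show ?thesis using e p by (simp add: divides_mult)
      qed auto
    qed
    show "\<forall>d\<in>{d. d dvd n} - (?S \<union> ?T). moebius d = 0"
    proof
      fix d assume d: "d \<in> {d. d dvd n} - (?S \<union> ?T)"
      have "\<not> squarefree d"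
      proof
        assume sf: "squarefree d"
        then have "p dvd d" using d by auto
        then obtain e where e: "d = p * e" by (elim dvdE)
        have "\<not> p dvd e"
        proof
          assume "p dvd e"
          then have "p\<^sup>2 dvd d" using e by (auto simp: power2_eq_square)
          then have "p dvd 1" using sf squarefreeD by blast
          then show False using p by auto
        qed
        moreover have "squarefree e" using sf e squarefree_mono[of e d] by auto
        moreover have "e dvd n" using d e by (auto dest: dvd_mult_right)
        ultimately show False using d e by auto
      qed
      then show "moebius d = 0" by (simp add: moebius_def)
    qed
  qed
  also have "\<dots> = (\<Sum>d\<in>?S. moebius d) + (\<Sum>d\<in>?T. moebius d)"
  proof (rule sum.union_disjoint)
    show fS: "finite ?S" by (rule finite_subset[OF _ fin]) auto
    then show "finite ?T" by simp
  qed auto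
  also have "(\<Sum>d\<in>?T. moebius d) = (\<Sum>d\<in>?S. moebius (p * d))"
    by (rule sum.reindex_cong[where l = "\<lambda>d. p * d"]) (use p0 in \<open>auto simp: inj_on_def\<close>)
  also have "\<dots> = - (\<Sum>d\<in>?S. moebius d)"
    using pd by (simp add: sum_negf [symmetric])
  finally show ?thesis by simp
qed

lemma moebius_abs_summable:
  assumes s: "Re s > 1"
  shows "(\<lambda>n. norm (of_real (moebius n) * complex_of_nat n powr (- s))) summable_on {0<..}"
proof (rule Infinite_Sum.abs_summable_on_comparison_test[OF zeta_has_sum(2)[OF s]])
  fix n
  show "norm (of_real (moebius n) * complex_of_nat n powr (- s)) \<le> norm (complex_of_nat n powr (- s))"
    using abs_moebius_le[of n] by (simp add: norm_mult mult_left_le_one_le)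
qed

text \<open>Multiply by zeta and collect the terms with \<open>d * e = n\<close> in the absolutely
  convergent double series. The divisor sums of \<open>moebius\<close> leave only
  \<open>n = 1\<close>, so the product is 1.\<close>

lemma moebius_has_sum:
  assumes s: "Re s > 1"
  shows "((\<lambda>n. of_real (moebius n) * of_nat n powr (- s)) has_sum (1 / riemann_zeta s)) {0<..}"
proof -
  define M where "M = infsum (\<lambda>n. of_real (moebius n) * of_nat n powr (- s)) {0<..}"
  have M: "((\<lambda>n. of_real (moebius n) * of_nat n powr (- s)) has_sum M) {0<..}"
    unfolding M_def
    by (rule has_sum_infsum[OF Infinite_Sum.abs_summable_summable[OF moebius_abs_summable[OF s]]])
  define F where "F = (\<lambda>(d, e). (of_real (moebius d) * complex_of_nat d powr (- s)) * complex_of_nat e powr (- s))"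
  have Fsum: "(\<lambda>x. norm (F x)) summable_on ({0<..} \<times> {0<..})"
    unfolding Infinite_Sum.abs_summable_on_Sigma_iff
  proof (intro conjI ballI)
    show "(\<lambda>y. norm (F (x, y))) summable_on {0<..}" for x
      unfolding F_def case_prod_conv norm_mult using zeta_has_sum(2)[OF s] by (rule summable_on_cmult_right)
    have "(\<lambda>x. norm (of_real (moebius x) * complex_of_nat x powr (- s)) * (\<Sum>\<^sub>\<infinity>y\<in>{0<..}. norm (complex_of_nat y powr (- s)))) summable_on {0<..}"
      using moebius_abs_summable[OF s] by (rule summable_on_cmult_left)
    moreover have "norm (\<Sum>\<^sub>\<infinity>y\<in>{0<..}. norm (F (x, y))) = norm (of_real (moebius x) * complex_of_nat x powr (- s)) * (\<Sum>\<^sub>\<infinity>y\<in>{0<..}. norm (complex_of_nat y powr (- s)))" for x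
      unfolding F_def case_prod_conv
      by (simp add: norm_mult[of "of_real (moebius x) * complex_of_nat x powr (- s)"] infsum_cmult_right' infsum_nonneg abs_mult del: norm_mult)
    ultimately show "(\<lambda>x. norm (\<Sum>\<^sub>\<infinity>y\<in>{0<..}. norm (F (x, y)))) summable_on {0<..}"
      by simp
  qed
  have 1: "(F has_sum (M * riemann_zeta s)) ({0<..} \<times> {0<..})"
  proof (rule has_sum_SigmaI)
    fix d show "((\<lambda>e. F (d, e)) has_sum ((of_real (moebius d) * complex_of_nat d powr (- s)) * riemann_zeta s)) {0<..}"
      unfolding F_def case_prod_conv by (intro has_sum_cmult_right zeta_has_sum s)
    show "((\<lambda>d. (of_real (moebius d) * complex_of_nat d powr (- s)) * riemann_zeta s) has_sum (M * riemann_zeta s)) {0<..}"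
      by (intro has_sum_cmult_left M)
    show "F summable_on ({0<..} \<times> {0<..})" by (rule Infinite_Sum.abs_summable_summable[OF Fsum])
  qed
  define G where "G = (\<lambda>(n, d). of_real (moebius d) * complex_of_nat n powr (- s))"
  have "(F has_sum (M * riemann_zeta s)) ({0<..} \<times> {0<..}) = (G has_sum (M * riemann_zeta s)) (SIGMA n:{0<..}. {d. d dvd n})"
    by (rule has_sum_reindex_bij_witness[where j = "\<lambda>(d, e). (d * e, d)" and i = "\<lambda>(n, d). (d, n div d)"])
      (auto simp: F_def G_def of_nat_mult_powr dvd_div_eq_0_iff simp del: of_nat_mult intro!: Nat.gr0I)
  then have 2: "(G has_sum (M * riemann_zeta s)) (SIGMA n:{0<..}. {d. d dvd n})" using 1 by simp
  have "((\<lambda>n. of_real (\<Sum>d | d dvd n. moebius d) * complex_of_nat n powr (- s)) has_sum (M * riemann_zeta s)) {0<..}"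
  proof (rule has_sum_SigmaD[OF 2])
    fix n :: nat assume "n \<in> {0<..}"
    then have "finite {d. d dvd n}" by (intro finite_divisors_nat) auto
    then show "((\<lambda>d. G (n, d)) has_sum of_real (\<Sum>d | d dvd n. moebius d) * complex_of_nat n powr (- s)) {d. d dvd n}"
      by (intro has_sum_finiteI) (auto simp: G_def sum_distrib_right)
  qed
  moreover have "((\<lambda>n. of_real (\<Sum>d | d dvd n. moebius d) * complex_of_nat n powr (- s)) has_sum 1) {0<..}"
  proof -
    have "((\<lambda>n. of_real (\<Sum>d | d dvd n. moebius d) * complex_of_nat n powr (- s)) has_sum 1) {1}"
      by (rule has_sum_finiteI) auto
    also have "?this \<longleftrightarrow> ?thesis"
    proof (rule has_sum_cong_neutral)
      fix n :: nat assume "n \<in> {0<..} - {1}"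
      then have "n > 1" by auto
      then show "of_real (\<Sum>d | d dvd n. moebius d) * complex_of_nat n powr (- s) = 0"
        by (simp only: sum_moebius_divisors) simp
    qed auto
    finally show ?thesis .
  qed
  ultimately have "M * riemann_zeta s = 1" by (rule has_sum_unique)
  then have "M = 1 / riemann_zeta s" using riemann_zeta_nonzero_gt_1[OF s] by (simp add: field_simps)
  then show ?thesis using M by simp
qed

lemma moebius_sums:
  assumes s: "Re s > 1"
  shows "(\<lambda>k. of_real (moebius (Suc k)) * of_nat (Suc k) powr (- s)) sums (1 / riemann_zeta s)"
proof (rule has_sum_imp_sums)
  have im: "{0 :: nat<..} = Suc ` UNIV" by (auto simp: image_iff gr0_conv_Suc)
  show "((\<lambda>k. of_real (moebius (Suc k)) * of_nat (Suc k) powr (- s)) has_sum (1 / riemann_zeta s)) UNIV"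
    using moebius_has_sum[OF s] unfolding im by (subst (asm) has_sum_reindex) (simp_all add: o_def)
qed

section \<open>Reflection of zeros\<close>

text \<open>Integration by parts on every interval \<open>[n, n + 1]\<close>; in effect the integral
  of \<open>h\<close> is compared with the sum of its values at the positive integers. Since
  \<open>k\<close> is nonnegative, the integrals of the pieces are also their norms, so their
  convergent sum justifies integrating term by term.\<close>

lemma frac_kernel_integral:
  fixes h H k :: "real \<Rightarrow> real"
  assumes H: "\<And>u. u \<ge> 0 \<Longrightarrow> DERIV H u :> h u"
    and h: "\<And>u. u \<ge> 0 \<Longrightarrow> DERIV h u :> - k u"
    and k: "\<And>u. u \<ge> 0 \<Longrightarrow> k u \<ge> 0" and [measurable]: "k \<in> borel_measurable borel"
    and lim: "(\<lambda>n. H (real n)) \<longlonglongrightarrow> Hinf" and S: "(\<lambda>n. h (real (Suc n))) sums S"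
  shows "(LINT u:{0<..}|lborel. frac u * k u) = Hinf - H 0 - S"
proof -
  let ?f = "\<lambda>n u. (u - real n) * k u * indicator {real n..real (Suc n)} u"
  \<comment> \<open>Its derivative is \<open>(u - real n) * k u\<close>, because the two occurrences
    of \<open>h u\<close> cancel.\<close>
  let ?Q = "\<lambda>n u. H u - (u - real n) * h u"
  have bi: "has_bochner_integral lborel (?f n) (H (real (Suc n)) - H (real n) - h (real (Suc n)))" for n
  proof -
    have "has_bochner_integral lborel (?f n) (?Q n (real (Suc n)) - ?Q n (real n))"
    proof (rule has_bochner_integral_FTC_Icc_nonneg)
      fix u assume "u \<in> {real n..real (Suc n)}"
      then have u: "real n \<le> u" "u \<le> real (Suc n)" by auto
      then have "u \<ge> 0" by linarith
      then show "DERIV (?Q n) u :> (u - real n) * k u"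
        by (auto intro!: derivative_eq_intros H h simp: algebra_simps)
      show "0 \<le> (u - real n) * k u" using u k[OF \<open>u \<ge> 0\<close>] by simp
    qed auto
    then show ?thesis by (simp add: algebra_simps)
  qed
  have nn: "?f n u \<ge> 0" for n u
    using k[of u] by (cases "real n \<le> u \<and> u \<le> real (Suc n)") (auto simp: indicator_def)
  have sums: "(\<lambda>n. H (real (Suc n)) - H (real n) - h (real (Suc n))) sums (Hinf - H 0 - S)"
    using sums_diff[OF telescope_sums[OF lim] S] by simp
  have int: "integrable lborel (?f n)" for n using bi[of n] by (simp add: has_bochner_integral_iff)
  have val: "integral\<^sup>L lborel (?f n) = H (real (Suc n)) - H (real n) - h (real (Suc n))" for n
    using bi[of n] by (simp add: has_bochner_integral_iff del: of_nat_Suc)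
  have norm: "(\<lambda>u. norm (?f n u)) = ?f n" for n
    using nn[of _ n] by (intro ext) (simp only: real_norm_def abs_of_nonneg)
  have AEZ: "AE t in lborel. t \<notin> (\<int> :: real set)"
    by (intro AE_not_in countable_imp_null_set_lborel) (simp add: Ints_def)
  have pt: "(\<lambda>n. ?f n u) sums (indicator {0<..} u *\<^sub>R (frac u * k u))" if u: "u \<notin> \<int>" for u
  proof (cases "u > 0")
    case True
    have "(\<lambda>n. ?f n u) sums (\<Sum>n\<in>{nat \<lfloor>u\<rfloor>}. ?f n u)"
    proof (rule sums_finite)
      fix n assume "n \<notin> {nat \<lfloor>u\<rfloor>}"
      then have n: "int n \<noteq> \<lfloor>u\<rfloor>" using True by auto
      have ne: "u \<noteq> real (Suc n)" using u by (metis Ints_of_nat)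
      have "\<not> (real n \<le> u \<and> u \<le> real (Suc n))"
      proof
        assume "real n \<le> u \<and> u \<le> real (Suc n)"
        then have "\<lfloor>u\<rfloor> = int n" using ne by (intro floor_unique) auto
        then show False using n by simp
      qed
      then show "?f n u = 0" by (simp add: indicator_def)
    qed simp
    moreover have "real (nat \<lfloor>u\<rfloor>) = of_int \<lfloor>u\<rfloor>" using True by simp
    moreover have "u \<le> 1 + of_int \<lfloor>u\<rfloor>" "of_int \<lfloor>u\<rfloor> \<le> u" by linarith+
    ultimately show ?thesis using True by (simp add: frac_def add.commute)
  next
    case False
    then have "u < 0" using u by (cases "u = 0") auto
    then have "(\<lambda>n. ?f n u) = (\<lambda>n. 0)" by (intro ext) (simp add: indicator_def)
    then show ?thesis using False by simp
  qed
  have AEs: "AE u in lborel. summable (\<lambda>n. norm (?f n u))"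
    using AEZ
  proof eventually_elim
    case (elim u)
    then show ?case using sums_summable[OF pt] norm by (simp only: fun_cong[OF norm])
  qed
  have summ: "summable (\<lambda>n. LINT u|lborel. norm (?f n u))"
    unfolding norm val using sums by (rule sums_summable)
  have "(LINT u:{0<..}|lborel. frac u * k u) = (LINT u|lborel. (\<Sum>n. ?f n u))"
    unfolding set_lebesgue_integral_def
  proof (rule integral_cong_AE)
    show "(\<lambda>u. indicator {0<..} u *\<^sub>R (frac u * k u)) \<in> borel_measurable lborel"
      unfolding frac_def by measurable
    show "(\<lambda>u. \<Sum>n. ?f n u) \<in> borel_measurable lborel"
      by (rule borel_measurable_integrable[OF integrable_suminf[where f = ?f, OF int AEs summ]])
    show "AE u in lborel. indicator {0<..} u *\<^sub>R (frac u * k u) = (\<Sum>n. ?f n u)"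
      using AEZ by eventually_elim (rule sums_unique[OF pt])
  qed
  also have "\<dots> = (\<Sum>n. integral\<^sup>L lborel (?f n))"
    by (rule integral_suminf[where f = ?f, OF int AEs summ])
  also have "\<dots> = Hinf - H 0 - S"
    unfolding val using sums by (rule sums_unique [symmetric])
  finally show ?thesis .
qed

section \<open>Partial fractions of the cotangent\<close>

lemma Digamma_reflection:
  fixes z :: complex
  assumes "z \<notin> \<int>"
  shows "Digamma z - Digamma (1 - z) = - of_real pi * cos (of_real pi * z) / sin (of_real pi * z)"
proof -
  have z: "z \<notin> \<int>\<^sub>\<le>\<^sub>0" "1 - z \<notin> \<int>\<^sub>\<le>\<^sub>0"
    using assms nonpos_Ints_Int by (blast, metis Ints_1 Ints_diff diff_diff_eq2 add_diff_cancel_left' nonpos_Ints_Int)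
  have s: "sin (of_real pi * z) \<noteq> 0"
    using assms by (auto simp: sin_eq_0 mult.commute)
  have 1: "((\<lambda>z. Gamma z * Gamma (1 - z)) has_field_derivative
      (Gamma z * Gamma (1 - z) * (Digamma z - Digamma (1 - z)))) (at z)"
    using z by (auto intro!: derivative_eq_intros simp: algebra_simps)
  have 2: "((\<lambda>z. of_real pi / sin (of_real pi * z)) has_field_derivative
      (- (of_real pi * (of_real pi * cos (of_real pi * z))) / (sin (of_real pi * z))\<^sup>2)) (at z)"
    using s by (auto intro!: derivative_eq_intros simp: power2_eq_square)
  have "(\<lambda>z. Gamma z * Gamma (1 - z)) = (\<lambda>z. complex_of_real pi / sin (of_real pi * z))"
    by (intro ext Gamma_reflection_complex)
  with 1 2 have "Gamma z * Gamma (1 - z) * (Digamma z - Digamma (1 - z)) =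
      - (of_real pi * (of_real pi * cos (of_real pi * z))) / (sin (of_real pi * z))\<^sup>2"
    using DERIV_unique by metis
  then have "(of_real pi / sin (of_real pi * z)) * (Digamma z - Digamma (1 - z)) =
      (of_real pi / sin (of_real pi * z)) * (- of_real pi * cos (of_real pi * z) / sin (of_real pi * z))"
    unfolding Gamma_reflection_complex by (simp add: power2_eq_square)
  then show ?thesis using s by (simp only: mult_left_cancel divide_eq_0_iff of_real_eq_0_iff pi_neq_zero simp_thms)
qed

text \<open>\<open>Digamma z - Digamma (1 - z)\<close> is evaluated twice: by the reflection
  formula, and by the limit formula for each term, in which the logarithms cancel.\<close>

lemma cot_partial_fractions:
  fixes z :: complex
  assumes z: "z \<notin> \<int>"
  shows "(\<lambda>n. 2 * z / (of_nat (Suc n) ^ 2 - z\<^sup>2)) sums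
    (1 / z - of_real pi * cos (of_real pi * z) / sin (of_real pi * z))"
proof -
  have nz: "of_nat n + z \<noteq> 0" "of_nat n - z \<noteq> 0" for n
  proof -
    show "of_nat n + z \<noteq> 0"
      using z by (metis Ints_minus Ints_of_nat add_eq_0_iff)
    show "of_nat n - z \<noteq> 0"
      using z by (metis Ints_of_nat eq_iff_diff_eq_0)
  qed
  have z0: "z \<noteq> 0" using z by auto
  have "(\<lambda>m. (of_real (ln (real m)) - (\<Sum>n<m. inverse (z + of_nat n))) -
      (of_real (ln (real m)) - (\<Sum>n<m. inverse (1 - z + of_nat n)))) \<longlonglongrightarrow> Digamma z - Digamma (1 - z)"
    using z by (intro tendsto_diff Digamma_LIMSEQ) (use nz z0 in \<open>auto simp: algebra_simps\<close>)
  \<comment> \<open>The pairing is shifted by one: \<open>inverse (n + 1 - z)\<close> is matched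
    with \<open>inverse (n + 1 + z)\<close> and not with \<open>inverse (n + z)\<close>. This leaves
    the boundary terms \<open>inverse z\<close> and \<open>inverse (z + m)\<close>.\<close>
  moreover have "(of_real (ln (real m)) - (\<Sum>n<m. inverse (z + of_nat n))) -
      (of_real (ln (real m)) - (\<Sum>n<m. inverse (1 - z + of_nat n))) =
      (\<Sum>n<m. 2 * z / (of_nat (Suc n) ^ 2 - z\<^sup>2)) - inverse z + inverse (z + of_nat m)" for m
  proof (induction m)
    case (Suc m)
    have t: "2 * z / (of_nat (Suc m) ^ 2 - z\<^sup>2) = inverse (1 - z + of_nat m) - inverse (z + of_nat (Suc m))"
    proof -
      have "of_nat (Suc m) ^ 2 - z\<^sup>2 = (of_nat (Suc m) - z) * (of_nat (Suc m) + z)"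
        by (simp add: power2_eq_square algebra_simps)
      moreover have "1 - z + of_nat m = of_nat (Suc m) - z" "z + of_nat (Suc m) = of_nat (Suc m) + z" by simp_all
      ultimately show ?thesis using nz[of "Suc m"]
        by (simp only: inverse_diff_inverse) (simp add: field_simps)
    qed
    have "(of_real (ln (real (Suc m))) - (\<Sum>n<Suc m. inverse (z + of_nat n))) -
      (of_real (ln (real (Suc m))) - (\<Sum>n<Suc m. inverse (1 - z + of_nat n))) =
      ((of_real (ln (real m)) - (\<Sum>n<m. inverse (z + of_nat n))) -
      (of_real (ln (real m)) - (\<Sum>n<m. inverse (1 - z + of_nat n)))) - inverse (z + of_nat m) + inverse (1 - z + of_nat m)"
      by simp
    also have "\<dots> = (\<Sum>n<Suc m. 2 * z / (of_nat (Suc n) ^ 2 - z\<^sup>2)) - inverse z + inverse (z + of_nat (Suc m))"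
      unfolding Suc sum.lessThan_Suc t by simp
    finally show ?case .
  qed simp
  ultimately have "(\<lambda>m. (\<Sum>n<m. 2 * z / (of_nat (Suc n) ^ 2 - z\<^sup>2)) - inverse z + inverse (z + of_nat m))
    \<longlonglongrightarrow> Digamma z - Digamma (1 - z)" by simp
  moreover have "(\<lambda>m. inverse (z + of_nat m)) \<longlonglongrightarrow> 0"
    by (intro filterlim_compose[OF tendsto_inverse_0] tendsto_add_filterlim_at_infinity[OF tendsto_const] tendsto_of_nat)
  ultimately have "(\<lambda>m. (\<Sum>n<m. 2 * z / (of_nat (Suc n) ^ 2 - z\<^sup>2)) - inverse z + inverse (z + of_nat m)
      - inverse (z + of_nat m) + inverse z) \<longlonglongrightarrow> Digamma z - Digamma (1 - z) - 0 + inverse z"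
    by (intro tendsto_intros)
  then show ?thesis unfolding Digamma_reflection[OF z] sums_def
    by (simp add: inverse_eq_divide)
qed

lemma coth_partial_fractions:
  fixes x :: real
  assumes x: "x > 0"
  shows "(\<lambda>n. 2 * x / (x\<^sup>2 + 4 * pi\<^sup>2 * real (Suc n) ^ 2)) sums (1 / (exp x - 1) - 1 / x + 1 / 2)"
proof -
  \<comment> \<open>For this \<open>z\<close> the denominators
    \<open>of_nat (Suc n) ^ 2 - z\<^sup>2\<close> become those of the claim divided by
    \<open>4 * pi\<^sup>2\<close>, and the cotangent of \<open>pi * z\<close> becomes
    \<open>- \<i>\<close> times the hyperbolic cotangent of \<open>x / 2\<close>.\<close>
  define z where "z = \<i> * of_real (x / (2 * pi))"
  have z: "z \<notin> \<int>"
  proof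
    assume "z \<in> \<int>"
    then have "Im z = 0" by (auto elim: Ints_cases)
    then show False using x by (simp add: z_def)
  qed
  have e1: "exp x \<noteq> 1" using x by simp
  define q where "q = exp (x / 2)"
  have q: "q > 1" "exp x = q\<^sup>2" using x by (simp_all add: q_def flip: exp_double)
  have iz: "of_real pi * z = \<i> * of_real (x / 2)" by (simp add: z_def)
  have ex: "exp (\<i> * (\<i> * of_real (x / 2))) = of_real (inverse q)" "exp (- (\<i> * (\<i> * of_real (x / 2)))) = of_real q"
  proof -
    have i: "\<i> * (\<i> * of_real (x / 2)) = - complex_of_real (x / 2)" by (simp flip: mult.assoc)
    show "exp (\<i> * (\<i> * of_real (x / 2))) = of_real (inverse q)"
      unfolding i exp_minus exp_of_real q_def of_real_inverse ..
    show "exp (- (\<i> * (\<i> * of_real (x / 2)))) = of_real q"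
      unfolding i minus_minus exp_of_real q_def ..
  qed
  have cs: "cos (of_real pi * z) / sin (of_real pi * z) = - \<i> * of_real ((q + inverse q) / (q - inverse q))"
  proof -
    have "cos (of_real pi * z) = of_real ((q + inverse q) / 2)"
      unfolding cos_exp_eq iz ex by simp
    moreover have "sin (of_real pi * z) = of_real (inverse q - q) / (2 * \<i>)"
      unfolding sin_exp_eq iz ex by simp
    moreover have "inverse q < 1" using q by (simp add: inverse_less_1_iff)
    then have "inverse q - q \<noteq> 0" using q by linarith
    moreover have "complex_of_real a / (of_real b / (2 * \<i>)) = - \<i> * of_real (2 * a / (- b))" if "b \<noteq> 0" for a b
      using that by (simp add: field_simps)
    ultimately have "cos (of_real pi * z) / sin (of_real pi * z) =
        - \<i> * of_real (2 * ((q + inverse q) / 2) / (- (inverse q - q)))"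
      by (simp only:)
    also have "2 * ((q + inverse q) / 2) / (- (inverse q - q)) = (q + inverse q) / (q - inverse q)"
      by (simp only: minus_diff_eq nonzero_mult_div_cancel_left times_divide_eq_right zero_neq_numeral not_False_eq_True)
    finally show ?thesis .
  qed
  have "(\<lambda>n. 2 * z / (of_nat (Suc n) ^ 2 - z\<^sup>2) * (1 / (2 * pi * \<i>))) sums
    ((1 / z - of_real pi * cos (of_real pi * z) / sin (of_real pi * z)) * (1 / (2 * pi * \<i>)))"
    by (intro sums_mult2 cot_partial_fractions z)
  moreover have "2 * z / (of_nat (Suc n) ^ 2 - z\<^sup>2) * (1 / (2 * pi * \<i>)) = of_real (2 * x / (x\<^sup>2 + 4 * pi\<^sup>2 * real (Suc n) ^ 2))" for n
  proof -
    have z2: "z\<^sup>2 = - of_real ((x / (2 * pi))\<^sup>2)" unfolding z_def power_mult_distrib by simp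
    have "2 * z / (of_nat (Suc n) ^ 2 - z\<^sup>2) * (1 / (2 * pi * \<i>)) =
        of_real (2 * (x / (2 * pi)) / (real (Suc n) ^ 2 + (x / (2 * pi))\<^sup>2) * (1 / (2 * pi)))"
      unfolding z2 by (simp add: z_def del: of_nat_Suc)
    also have "2 * (x / (2 * pi)) / (real (Suc n) ^ 2 + (x / (2 * pi))\<^sup>2) * (1 / (2 * pi)) =
        2 * x / (x\<^sup>2 + 4 * pi\<^sup>2 * real (Suc n) ^ 2)"
    proof -
      have "real (Suc n) ^ 2 + (x / (2 * pi))\<^sup>2 = (x\<^sup>2 + 4 * pi\<^sup>2 * real (Suc n) ^ 2) / (4 * pi\<^sup>2)"
        by (simp add: field_simps power2_eq_square)
      moreover have "2 * (x / (2 * pi)) / (D / (4 * pi\<^sup>2)) * (1 / (2 * pi)) = 2 * x / D" for D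
        by (simp add: power2_eq_square)
      ultimately show ?thesis by (simp only:)
    qed
    finally show ?thesis .
  qed
  moreover have "(1 / z - of_real pi * cos (of_real pi * z) / sin (of_real pi * z)) * (1 / (2 * pi * \<i>)) =
      of_real (1 / (exp x - 1) - 1 / x + 1 / 2)"
  proof -
    have "(1 / z - of_real pi * cos (of_real pi * z) / sin (of_real pi * z)) * (1 / (2 * pi * \<i>)) =
      (1 / z) * (1 / (2 * pi * \<i>)) - of_real pi * (cos (of_real pi * z) / sin (of_real pi * z)) * (1 / (2 * pi * \<i>))"
      by (simp add: algebra_simps)
    also have "(1 / z) * (1 / (2 * pi * \<i>)) = of_real (- 1 / x)"
      using x by (simp add: z_def field_simps)
    also have "of_real pi * (cos (of_real pi * z) / sin (of_real pi * z)) * (1 / (2 * pi * \<i>)) =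
        of_real (- ((q + inverse q) / (q - inverse q)) / 2)"
    proof -
      have "of_real pi * (- \<i> * of_real X) * (1 / (2 * pi * \<i>)) = of_real (- X / 2)" for X
        by (simp add: field_simps)
      then show ?thesis unfolding cs by (simp only: mult_minus_left)
    qed
    also have "(q + inverse q) / (q - inverse q) = 1 + 2 / (exp x - 1)"
    proof -
      have q2: "q\<^sup>2 - 1 > 0" using one_less_power[OF q(1), of 2] by simp
      have "(q + inverse q) / (q - inverse q) = (q * (q + inverse q)) / (q * (q - inverse q))"
        using q by simp
      also have "\<dots> = (q\<^sup>2 + 1) / (q\<^sup>2 - 1)" using q by (simp add: algebra_simps power2_eq_square)
      also have "\<dots> = 1 + 2 / (q\<^sup>2 - 1)" using q2 by (simp add: field_simps)
      finally show ?thesis using q by simp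
    qed
    also have "complex_of_real (- 1 / x) - of_real (- (1 + 2 / (exp x - 1)) / 2) = of_real (1 / (exp x - 1) - 1 / x + 1 / 2)"
      unfolding of_real_diff [symmetric] using x e1 by (intro arg_cong[where f = of_real]) (simp add: field_simps)
    finally show ?thesis .
  qed
  ultimately have "(\<lambda>n. complex_of_real (2 * x / (x\<^sup>2 + 4 * pi\<^sup>2 * real (Suc n) ^ 2))) sums
      of_real (1 / (exp x - 1) - 1 / x + 1 / 2)" by (simp only:)
  then show ?thesis by (simp only: sums_of_real_iff)
qed

section \<open>One function as two integrals of the fractional part\<close>

lemma frac_exp_integral:
  fixes x :: real
  assumes x: "x > 0"
  shows "(LINT u:{0<..}|lborel. frac u * (x * exp (- u * x))) = 1 / x - 1 / (exp x - 1)"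
proof -
  have e: "exp (- x) < 1" "exp x \<noteq> 1" using x by auto
  have "(LINT u:{0<..}|lborel. frac u * (x * exp (- u * x))) = 0 - (- exp (- 0 * x) / x) - 1 / (exp x - 1)"
  proof (rule frac_kernel_integral[where h = "\<lambda>u. exp (- u * x)"])
    show "DERIV (\<lambda>u. - exp (- u * x) / x) u :> exp (- u * x)" for u
      using x by (auto intro!: derivative_eq_intros)
    show "DERIV (\<lambda>u. exp (- u * x)) u :> - (x * exp (- u * x))" for u
      by (auto intro!: derivative_eq_intros)
    have "(\<lambda>n. - (exp (- x) ^ n) / x) \<longlonglongrightarrow> (- 0 / x)"
      using e by (intro tendsto_intros LIMSEQ_realpow_zero) auto
    then show "(\<lambda>n. - exp (- real n * x) / x) \<longlonglongrightarrow> 0"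
      by (simp flip: exp_of_nat_mult)
    have "(\<lambda>n. exp (- x) * exp (- x) ^ n) sums (exp (- x) * (1 / (1 - exp (- x))))"
      using e by (intro sums_mult geometric_sums) auto
    moreover have "exp (- x) * (1 / (1 - exp (- x))) = 1 / (exp x - 1)"
      using e by (simp add: exp_minus field_simps)
    moreover have "exp (- x) * exp (- x) ^ n = exp (- real (Suc n) * x)" for n
      using exp_of_nat_mult[of "Suc n" "- x"] by (simp del: of_nat_Suc)
    ultimately show "(\<lambda>n. exp (- real (Suc n) * x)) sums (1 / (exp x - 1))" by simp
  qed (use x in auto)
  then show ?thesis by simp
qed

text \<open>The function \<open>2 * x / (x\<^sup>2 + 4 * pi\<^sup>2 * u\<^sup>2)\<close> is the
  Fourier transform of \<open>exp (- x * \<bar>v\<bar>)\<close> at \<open>u\<close>. That its kernel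
  gives the same value as the exponential one in \<open>frac_exp_integral\<close> is thus an
  instance of Poisson summation, obtained here from \<open>coth_partial_fractions\<close>.\<close>

lemma frac_rational_integral:
  assumes x: "x > 0"
  shows "(LINT u:{0<..}|lborel. frac u * (16 * pi\<^sup>2 * u * x / (x\<^sup>2 + 4 * pi\<^sup>2 * u\<^sup>2)\<^sup>2)) = 1 / x - 1 / (exp x - 1)"
proof -
  have pos: "x\<^sup>2 + 4 * pi\<^sup>2 * u\<^sup>2 > 0" for u using x by (intro add_pos_nonneg) auto
  \<comment> \<open>The arctangent primitive tends to \<open>1 / 2\<close>, which cancels the
    \<open>1 / 2\<close> in the value of the series.\<close>
  have "(LINT u:{0<..}|lborel. frac u * (16 * pi\<^sup>2 * u * x / (x\<^sup>2 + 4 * pi\<^sup>2 * u\<^sup>2)\<^sup>2)) =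
      (1 / pi) * (pi / 2) - (1 / pi) * arctan (2 * pi * 0 / x) - (1 / (exp x - 1) - 1 / x + 1 / 2)"
  proof (rule frac_kernel_integral[where h = "\<lambda>u. 2 * x / (x\<^sup>2 + 4 * pi\<^sup>2 * u\<^sup>2)"])
    show "DERIV (\<lambda>u. (1 / pi) * arctan (2 * pi * u / x)) u :> 2 * x / (x\<^sup>2 + 4 * pi\<^sup>2 * u\<^sup>2)" for u
    proof -
      have "DERIV (\<lambda>u. (1 / pi) * arctan (2 * pi * u / x)) u :> (1 / pi) * (inverse (1 + (2 * pi * u / x)\<^sup>2) * (2 * pi / x))"
        using x by (auto intro!: derivative_eq_intros)
      moreover have "1 + (2 * pi * u / x)\<^sup>2 = (x\<^sup>2 + 4 * pi\<^sup>2 * u\<^sup>2) / x\<^sup>2"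
        using x by (simp add: power2_eq_square field_simps)
      moreover have "(1 / pi) * (inverse ((x\<^sup>2 + 4 * pi\<^sup>2 * u\<^sup>2) / x\<^sup>2) * (2 * pi / x)) = 2 * x / (x\<^sup>2 + 4 * pi\<^sup>2 * u\<^sup>2)"
        using x by (simp add: power2_eq_square)
      ultimately show ?thesis by (simp only:)
    qed
    show "DERIV (\<lambda>u. 2 * x / (x\<^sup>2 + 4 * pi\<^sup>2 * u\<^sup>2)) u :> - (16 * pi\<^sup>2 * u * x / (x\<^sup>2 + 4 * pi\<^sup>2 * u\<^sup>2)\<^sup>2)" for u
      using pos[of u] by (auto intro!: derivative_eq_intros simp: power2_eq_square)
    show "(\<lambda>n. (1 / pi) * arctan (2 * pi * real n / x)) \<longlonglongrightarrow> (1 / pi) * (pi / 2)"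
    proof (intro tendsto_mult tendsto_const filterlim_compose[OF tendsto_arctan_at_top])
      have "filterlim (\<lambda>n. (2 * pi / x) * real n) at_top sequentially"
        using x by (intro filterlim_tendsto_pos_mult_at_top[OF tendsto_const] filterlim_real_sequentially) auto
      then show "filterlim (\<lambda>n. 2 * pi * real n / x) at_top sequentially" by simp
    qed
  qed (use x coth_partial_fractions[OF x] in \<open>auto intro!: divide_nonneg_nonneg mult_nonneg_nonneg\<close>)
  then show ?thesis by simp
qed


lemma exp_kernel_mellin:
  assumes s: "0 < Re s" "Re s < 1"
  shows "mellin_integrable (\<lambda>y. of_real (y * exp (- y))) (- s)"
    and "mellin (\<lambda>y. of_real (y * exp (- y))) (- s) = Gamma (s + 1)"
proof -
  let ?g = "\<lambda>y :: real. complex_of_real (y * exp (- y))"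
  show I: "mellin_integrable ?g (- s)"
  proof (rule mellin_integrable_boundI[where C = 2 and \<alpha> = "-1" and \<beta> = 1])
    show "?g \<in> borel_measurable borel" by measurable
    fix t :: real
    show "norm (?g t) \<le> 2 * t powr (-1)" if t: "t \<ge> 1"
    proof -
      have "1 + t + t\<^sup>2 / 2 \<le> exp t" using t by (intro exp_lower_Taylor_quadratic) auto
      then have "t\<^sup>2 \<le> 2 * exp t" using t by linarith
      then show ?thesis unfolding norm_of_real
        using t by (simp add: powr_minus exp_minus field_simps power2_eq_square)
    qed
    show "norm (?g t) \<le> 2 * t powr 1" if "0 < t" "t < 1"
    proof -
      have "exp (- t) \<le> 2" using that by (smt (verit) exp_le_one_iff)
      then show ?thesis unfolding norm_of_real using that by simp
    qed
  qed (use s in auto)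
  have eq: "complex_of_real t powr (- (- s) - 1) * ?g t = of_real t powr (s + 1 - 1) / of_real (exp t)" if "t > 0" for t
  proof -
    have "complex_of_real t powr s = of_real t powr (s - 1) * of_real t"
      using powr_add[of "complex_of_real t" "s - 1" 1] that by simp
    then show ?thesis by (simp add: exp_minus divide_inverse)
  qed
  have "mellin ?g (- s) = integral {0<..} (\<lambda>t. complex_of_real t powr (- (- s) - 1) * ?g t)"
    unfolding mellin_def using I unfolding mellin_integrable_def by (rule set_borel_integral_eq_integral(2))
  also have "\<dots> = integral {0<..} (\<lambda>t. of_real t powr (s + 1 - 1) / of_real (exp t))"
    by (rule Henstock_Kurzweil_Integration.integral_cong) (use eq in auto)
  also have "\<dots> = Gamma (s + 1)"
    by (rule integral_unique[OF Gamma_integral_complex']) (use s in auto)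
  finally show "mellin ?g (- s) = Gamma (s + 1)" .
qed

text \<open>The transform of this kernel becomes the factor \<open>c\<close> in
  \<open>mellin_frac_reflection\<close>. Finiteness is enough there, because it is the other factor
  that has to vanish.\<close>

lemma rational_kernel_mellin_integrable:
  assumes s: "0 < Re s" "Re s < 1"
  shows "mellin_integrable (\<lambda>y. of_real (16 * pi\<^sup>2 * y / (y\<^sup>2 + 4 * pi\<^sup>2)\<^sup>2)) (- s)"
proof (rule mellin_integrable_boundI[where C = "16 * pi\<^sup>2" and \<alpha> = "-1" and \<beta> = 1])
  let ?g = "\<lambda>y :: real. complex_of_real (16 * pi\<^sup>2 * y / (y\<^sup>2 + 4 * pi\<^sup>2)\<^sup>2)"
  show "?g \<in> borel_measurable borel" by measurable
  fix t :: real
  have pi1: "1 \<le> 4 * pi\<^sup>2" using pi_ge_two power_mono[of 2 pi 2] by simp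
  show "norm (?g t) \<le> 16 * pi\<^sup>2 * t powr (-1)" if t: "t \<ge> 1"
  proof -
    have "t * t \<le> (t\<^sup>2 + 4 * pi\<^sup>2)\<^sup>2"
    proof -
      have "t * t * 1 \<le> (t\<^sup>2 + 4 * pi\<^sup>2) * (t\<^sup>2 + 4 * pi\<^sup>2)"
        using pi1 by (intro mult_mono) (auto simp: power2_eq_square intro: add_increasing)
      then show ?thesis by (simp add: power2_eq_square)
    qed
    moreover have "(t\<^sup>2 + 4 * pi\<^sup>2)\<^sup>2 > 0" using t by (intro zero_less_power add_pos_pos) auto
    ultimately have "t / (t\<^sup>2 + 4 * pi\<^sup>2)\<^sup>2 \<le> 1 / t" using t by (simp add: field_simps)
    then have "16 * pi\<^sup>2 * (t / (t\<^sup>2 + 4 * pi\<^sup>2)\<^sup>2) \<le> 16 * pi\<^sup>2 * (1 / t)" by (intro mult_left_mono) auto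
    then show ?thesis unfolding norm_of_real using t by (simp add: powr_minus divide_inverse abs_mult)
  qed
  show "norm (?g t) \<le> 16 * pi\<^sup>2 * t powr 1" if t: "0 < t" "t < 1"
  proof -
    have "1 \<le> (t\<^sup>2 + 4 * pi\<^sup>2)\<^sup>2"
      using pi1 by (intro one_le_power) (auto intro: add_increasing)
    then have "t / (t\<^sup>2 + 4 * pi\<^sup>2)\<^sup>2 \<le> t / 1" using t by (intro divide_left_mono) auto
    then have "16 * pi\<^sup>2 * (t / (t\<^sup>2 + 4 * pi\<^sup>2)\<^sup>2) \<le> 16 * pi\<^sup>2 * (t / 1)" by (intro mult_left_mono) auto
    then show ?thesis unfolding norm_of_real using t by (simp add: abs_mult)
  qed
qed (use s in auto)

text \<open>
  Both sides are the Mellin transform of \<open>1/x - 1/(e\<^sup>x - 1)\<close>, written as a superposition of dilations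
  in two ways.
\<close>

lemma mellin_frac_reflection:
  assumes s: "0 < Re s" "Re s < 1"
  shows "\<exists>c. mellin (\<lambda>t. of_real (frac t)) s * Gamma (s + 1) = mellin (\<lambda>t. of_real (frac t)) (1 - s) * c"
proof -
  let ?fr = "\<lambda>t :: real. complex_of_real (frac t)"
  let ?E = "\<lambda>x. complex_of_real (1 / x - 1 / (exp x - 1))"
  have [measurable]: "(\<lambda>u :: real. frac u) \<in> borel_measurable borel" unfolding frac_def by measurable
  have s': "0 < Re (1 - s)" "Re (1 - s) < 1" using s by auto
  \<comment> \<open>In the exponential formula the integrand is \<open>frac u / u\<close> times the
    kernel \<open>y * exp (- y)\<close> at \<open>y = u * x\<close>. In the rational one it is
    \<open>frac u / u\<^sup>2\<close> times the other kernel at \<open>y = x / u\<close>. The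
    dilation by \<open>1 / u\<close> in place of \<open>u\<close> is what exchanges \<open>s\<close>
    with \<open>1 - s\<close>.\<close>
  define w1 where "w1 = (\<lambda>u :: real. indicator {0<..} u *\<^sub>R complex_of_real (frac u / u))"
  define w2 where "w2 = (\<lambda>u :: real. indicator {0<..} u *\<^sub>R complex_of_real (frac u / u\<^sup>2))"
  let ?g1 = "\<lambda>y :: real. complex_of_real (y * exp (- y))"
  let ?g2 = "\<lambda>y :: real. complex_of_real (16 * pi\<^sup>2 * y / (y\<^sup>2 + 4 * pi\<^sup>2)\<^sup>2)"
  have e1: "(\<lambda>u. w1 u * of_real u powr (- (- s) * (-1))) = (\<lambda>u. indicator {0<..} u *\<^sub>R (complex_of_real u powr (- s - 1) * ?fr u))"
  proof
    fix u :: real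
    show "w1 u * of_real u powr (- (- s) * (-1)) = indicator {0<..} u *\<^sub>R (complex_of_real u powr (- s - 1) * ?fr u)"
    proof (cases "u > 0")
      case True
      have "complex_of_real u powr (- s) = of_real u powr (- s - 1) * of_real u"
        using powr_add[of "complex_of_real u" "- s - 1" 1] True by simp
      then show ?thesis using True by (simp add: w1_def)
    qed (simp add: w1_def)
  qed
  have e2: "(\<lambda>u. w2 u * of_real (1 / u) powr (- s)) = (\<lambda>u. indicator {0<..} u *\<^sub>R (complex_of_real u powr (- (1 - s) - 1) * ?fr u))"
  proof
    fix u :: real
    show "w2 u * of_real (1 / u) powr (- s) = indicator {0<..} u *\<^sub>R (complex_of_real u powr (- (1 - s) - 1) * ?fr u)"
    proof (cases "u > 0")
      case True
      have "complex_of_real (1 / u) powr (- s) = of_real u powr s"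
        using powr_of_real_pos[of "1 / u" "- s"] powr_of_real_pos[of u s] True by (simp add: ln_div)
      also have "\<dots> = of_real u powr (s - 2) * of_real u powr 2"
        using powr_add[of "complex_of_real u" "s - 2" 2] by simp
      also have "complex_of_real u powr 2 = of_real u ^ 2" using True by (simp add: powr_nat')
      finally have "complex_of_real (1 / u) powr (- s) = of_real u powr (s - 2) * of_real u ^ 2" .
      then show ?thesis using True by (simp add: w2_def del: of_real_divide) (simp add: power2_eq_square algebra_simps)
    qed (simp add: w2_def)
  qed
  have I1: "mellin_integrable ?fr s" and I2: "mellin_integrable ?fr (1 - s)"
    using mellin_frac(1)[OF s] mellin_frac(1)[OF s'] .
  have "mellin ?E (- s) = (LINT u|lborel. w1 u * of_real u powr (- s)) * mellin ?g1 (- s)"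
  proof (rule mellin_superposition[OF lborel.sigma_finite_measure_axioms])
    show "w1 \<in> borel_measurable lborel" unfolding w1_def by measurable
    show "integrable lborel (\<lambda>u. w1 u * of_real u powr (- s))"
      using I1 e1 by (simp add: mellin_integrable_def set_integrable_def)
    show "mellin_integrable ?g1 (- s)" by (rule exp_kernel_mellin[OF s])
    fix x :: real assume x: "x > 0"
    have "(LINT u|lborel. w1 u * ?g1 (u * x)) = complex_of_real (LINT u:{0<..}|lborel. frac u * (x * exp (- u * x)))"
      unfolding set_lebesgue_integral_def integral_complex_of_real [symmetric]
      by (rule Bochner_Integration.integral_cong) (auto simp: w1_def indicator_def)
    then show "?E x = (LINT u|lborel. w1 u * ?g1 (u * x))"
      unfolding frac_exp_integral[OF x] by simp
  qed (auto simp: w1_def)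
  also have "(LINT u|lborel. w1 u * of_real u powr (- s)) = mellin ?fr s"
    using e1 by (simp add: mellin_def set_lebesgue_integral_def)
  also have "mellin ?g1 (- s) = Gamma (s + 1)" by (rule exp_kernel_mellin[OF s])
  finally have A: "mellin ?E (- s) = mellin ?fr s * Gamma (s + 1)" .
  have "mellin ?E (- s) = (LINT u|lborel. w2 u * of_real (1 / u) powr (- s)) * mellin ?g2 (- s)"
  proof (rule mellin_superposition[OF lborel.sigma_finite_measure_axioms])
    show "w2 \<in> borel_measurable lborel" unfolding w2_def by measurable
    show "integrable lborel (\<lambda>u. w2 u * of_real (1 / u) powr (- s))"
      using I2 unfolding e2 by (simp add: mellin_integrable_def set_integrable_def)
    show "mellin_integrable ?g2 (- s)" by (rule rational_kernel_mellin_integrable[OF s])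
    fix x :: real assume x: "x > 0"
    have "(LINT u|lborel. w2 u * ?g2 (1 / u * x)) = complex_of_real (LINT u:{0<..}|lborel. frac u * (16 * pi\<^sup>2 * u * x / (x\<^sup>2 + 4 * pi\<^sup>2 * u\<^sup>2)\<^sup>2))"
      unfolding set_lebesgue_integral_def integral_complex_of_real [symmetric]
    proof (rule Bochner_Integration.integral_cong)
      fix u :: real
      show "w2 u * ?g2 (1 / u * x) = complex_of_real (indicator {0<..} u *\<^sub>R (frac u * (16 * pi\<^sup>2 * u * x / (x\<^sup>2 + 4 * pi\<^sup>2 * u\<^sup>2)\<^sup>2)))"
      proof (cases "u > 0")
        case True
        have "(1 / u * x)\<^sup>2 + 4 * pi\<^sup>2 = (x\<^sup>2 + 4 * pi\<^sup>2 * u\<^sup>2) / u\<^sup>2"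
          using True by (simp add: field_simps power2_eq_square)
        then have "frac u / u\<^sup>2 * (16 * pi\<^sup>2 * (1 / u * x) / ((1 / u * x)\<^sup>2 + 4 * pi\<^sup>2)\<^sup>2) =
            frac u / u\<^sup>2 * (16 * pi\<^sup>2 * (1 / u * x) / ((x\<^sup>2 + 4 * pi\<^sup>2 * u\<^sup>2) / u\<^sup>2)\<^sup>2)" by simp
        also have "\<dots> = frac u * (16 * pi\<^sup>2 * u * x / (x\<^sup>2 + 4 * pi\<^sup>2 * u\<^sup>2)\<^sup>2)"
          using True by (simp add: power_divide power2_eq_square)
        finally have "complex_of_real (frac u / u\<^sup>2 * (16 * pi\<^sup>2 * (1 / u * x) / ((1 / u * x)\<^sup>2 + 4 * pi\<^sup>2)\<^sup>2)) =
            of_real (frac u * (16 * pi\<^sup>2 * u * x / (x\<^sup>2 + 4 * pi\<^sup>2 * u\<^sup>2)\<^sup>2))" by (rule arg_cong)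
        then show ?thesis using True unfolding w2_def
          by (simp only: indicator_simps(1) greaterThan_iff scaleR_one of_real_mult)
      qed (simp add: w2_def)
    qed simp
    then show "?E x = (LINT u|lborel. w2 u * ?g2 (1 / u * x))"
      unfolding frac_rational_integral[OF x] by simp
  qed (auto simp: w2_def zero_le_divide_iff divide_le_0_iff)
  also have "(LINT u|lborel. w2 u * of_real (1 / u) powr (- s)) = mellin ?fr (1 - s)"
    unfolding e2 by (simp add: mellin_def set_lebesgue_integral_def)
  finally have "mellin ?E (- s) = mellin ?fr (1 - s) * mellin ?g2 (- s)" .
  then show ?thesis by (intro exI) (rule trans[OF A [symmetric]])
qed

lemma riemann_zeta_zero_reflection:
  assumes s: "0 < Re s" "Re s < 1" and z: "riemann_zeta s = 0"
  shows "riemann_zeta (1 - s) = 0"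
proof -
  have s': "0 < Re (1 - s)" "Re (1 - s) < 1" using s by auto
  have "mellin (\<lambda>t. of_real (frac t)) s = 0"
    using z mellin_frac(2)[OF s] s by auto
  \<comment> \<open>By convention \<open>Gamma\<close> is 0 at its poles, and it has no other zeros.
    The argument \<open>2 - s\<close> has real part above 1, so it is no pole.\<close>
  moreover have "Gamma (1 - s + 1) \<noteq> 0"
  proof
    assume "Gamma (1 - s + 1) = 0"
    then obtain n where "1 - s + 1 = of_int n" "n \<le> 0"
      by (auto simp: Gamma_eq_zero_iff elim!: nonpos_Ints_cases)
    then have "2 - Re s = of_int n" "n \<le> 0" by (auto simp: complex_eq_iff)
    then show False using s by linarith
  qed
  ultimately have "mellin (\<lambda>t. of_real (frac t)) (1 - s) = 0"
    using mellin_frac_reflection[OF s'] by auto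
  then show ?thesis using mellin_frac(2)[OF s'] by simp
qed

section \<open>Growth of the reciprocal zeta function\<close>

text \<open>The map \<open>w \<mapsto> w / (2 * A - w)\<close> sends the half-plane
  \<open>Re w < A\<close> into the unit disc and fixes 0. The Schwarz lemma bounds the composition
  with \<open>g\<close>, and solving for \<open>g z\<close> gives the estimate.\<close>

lemma borel_caratheodory:
  assumes g: "g holomorphic_on ball 0 R" and g0: "g 0 = 0" and A: "A > 0"
    and Re: "\<And>z. norm z < R \<Longrightarrow> Re (g z) < A" and r: "r < R" and z: "norm z \<le> r"
  shows "norm (g z) \<le> 2 * A * r / (R - r)"
proof -
  have R: "R > 0" using z r norm_ge_zero[of z] by linarith
  define h where "h = (\<lambda>w. g (of_real R * w) / (of_real (2 * A) - g (of_real R * w)))"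
  have inR: "norm (of_real R * w) < R" if "norm w < 1" for w :: complex
    using that R by (simp add: norm_mult)
  have lt: "norm (g w) < norm (of_real (2 * A) - g w)" if "norm w < R" for w
  proof -
    have "(Re (g w))\<^sup>2 < (2 * A - Re (g w))\<^sup>2"
      using Re[OF that] A by (simp add: power2_eq_square algebra_simps)
    then have "norm (g w) ^ 2 < norm (of_real (2 * A) - g w) ^ 2"
      by (simp add: cmod_power2)
    then show ?thesis by (rule power_less_imp_less_base) simp
  qed
  have hol: "(\<lambda>w. g (of_real R * w)) holomorphic_on ball 0 1"
  proof -
    have "(g \<circ> (\<lambda>w. of_real R * w)) holomorphic_on ball 0 1"
      by (rule holomorphic_on_compose_gen[OF _ g]) (auto intro!: holomorphic_intros inR)
    then show ?thesis by (simp add: o_def)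
  qed
  have "h holomorphic_on ball 0 1"
    unfolding h_def using lt[OF inR] by (intro holomorphic_intros hol) force
  moreover have "h 0 = 0" by (simp add: h_def g0)
  moreover have "norm (h w) < 1" if "norm w < 1" for w
  proof -
    have "norm (of_real (2 * A) - g (of_real R * w)) > 0"
      using lt[OF inR[OF that]] norm_ge_zero order.strict_trans1 by blast
    then show ?thesis using lt[OF inR[OF that]] unfolding h_def norm_divide by simp
  qed
  moreover have "norm (z / of_real R) < 1" using z r R by (simp add: norm_divide)
  ultimately have "norm (h (z / of_real R)) \<le> norm (z / of_real R)"
    by (rule Schwarz_Lemma(1))
  then have "norm (g z) / norm (of_real (2 * A) - g z) \<le> norm z / R"
    using R by (simp add: h_def norm_divide)
  moreover have "norm (of_real (2 * A) - g z) > 0"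
    using lt[of z] z r norm_ge_zero order.strict_trans1 by (metis order.strict_trans1)
  ultimately have "norm (g z) * R \<le> norm z * norm (of_real (2 * A) - g z)"
    using R by (simp add: field_simps)
  also have "\<dots> \<le> r * (2 * A + norm (g z))"
    using z A norm_triangle_ineq4[of "of_real (2 * A)" "g z"] order.trans[OF norm_ge_zero z]
    by (intro mult_mono) auto
  finally have "norm (g z) * (R - r) \<le> 2 * A * r" by (simp add: algebra_simps)
  then show ?thesis using r by (simp add: field_simps)
qed

text \<open>
  The power series coefficients of \<open>g\<close> are bounded in terms of \<open>B\<close> alone on the small disc and in
  terms of \<open>A\<close> on the large one; the second estimate is used only for the tail, whose
  contribution is a small multiple of \<open>A\<close>. This replaces Hadamard's three circles theorem.
\<close>

lemma two_circles_growth: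
  fixes r1 \<rho> R B \<epsilon> :: real
  assumes r1: "0 < r1" "r1 \<le> R" and \<rho>: "0 < \<rho>" "\<rho> < R" and B: "B > 0" and \<epsilon>: "\<epsilon> > 0"
  shows "\<exists>K. \<forall>g A (z :: complex). g holomorphic_on ball 0 R \<longrightarrow> g 0 = 0 \<longrightarrow> A > 0 \<longrightarrow>
    (\<forall>z. norm z < R \<longrightarrow> Re (g z) < A) \<longrightarrow> (\<forall>z. norm z < r1 \<longrightarrow> Re (g z) < B) \<longrightarrow>
    norm z \<le> \<rho> \<longrightarrow> norm (g z) \<le> K + \<epsilon> * A"
proof -
  define r3 where "r3 = (\<rho> + R) / 2"
  have r3: "\<rho> < r3" "r3 < R" "0 < r3" using \<rho> by (auto simp: r3_def)
  define C where "C = 2 * r3 / (R - r3)"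
  have C: "C > 0" using r3 by (simp add: C_def)
  define q where "q = \<rho> / r3"
  have q: "0 < q" "q < 1" using r3 \<rho> by (auto simp: q_def)
  have "(\<lambda>N. C * (q ^ N / (1 - q))) \<longlonglongrightarrow> C * (0 / (1 - q))"
    using q by (intro tendsto_intros LIMSEQ_realpow_zero) auto
  then have "\<forall>\<^sub>F N in sequentially. C * (q ^ N / (1 - q)) < \<epsilon>"
    using \<epsilon> by (intro order_tendstoD(2)) auto
  then obtain N where N: "C * (q ^ N / (1 - q)) < \<epsilon>" by (auto simp: eventually_at_top_linorder)
  define r2 where "r2 = r1 / 2"
  define K where "K = (\<Sum>k<N. 2 * B * (\<rho> / r2) ^ k)"
  show ?thesis
  proof (intro exI[of _ K] allI impI)
    fix g :: "complex \<Rightarrow> complex" and A :: real and z :: complex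
    assume g: "g holomorphic_on ball 0 R" and g0: "g 0 = 0" and A: "A > 0"
      and RA: "\<forall>z. norm z < R \<longrightarrow> Re (g z) < A" and RB: "\<forall>z. norm z < r1 \<longrightarrow> Re (g z) < B"
      and z: "norm z \<le> (\<rho> :: real)"
    define c where "c = (\<lambda>k. (deriv ^^ k) g 0 / fact k)"
    have cb: "norm (c k) \<le> M / r ^ k" if "0 < r" "r < R" "\<And>w. norm w = r \<Longrightarrow> norm (g w) \<le> M" for r M k
    proof -
      have "norm ((deriv ^^ k) g 0) \<le> fact k * M / r ^ k"
      proof (rule Cauchy_inequality)
        show "g holomorphic_on ball 0 r" "continuous_on (cball 0 r) g"
          using that by (auto intro!: holomorphic_on_subset[OF g] holomorphic_on_imp_continuous_on)
      qed (use that in \<open>auto simp: dist_norm\<close>)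
      then show ?thesis by (simp add: c_def norm_divide field_simps)
    qed
    have c3: "norm (c k) \<le> C * A / r3 ^ k" for k
    proof (rule cb)
      fix w :: complex assume "norm w = r3"
      then have "norm (g w) \<le> 2 * A * r3 / (R - r3)"
        using r3 RA by (intro borel_caratheodory[OF g g0 A]) auto
      then show "norm (g w) \<le> C * A" by (simp add: C_def mult_ac)
    qed (use r3 in auto)
    \<comment> \<open>As \<open>r2\<close> is half of \<open>r1\<close>, the factor
      \<open>2 * r2 / (r1 - r2)\<close> from \<open>borel_caratheodory\<close> equals 2.\<close>
    have c2: "norm (c k) \<le> 2 * B / r2 ^ k" for k
    proof (rule cb)
      fix w :: complex assume "norm w = r2"
      then have "norm (g w) \<le> 2 * B * r2 / (r1 - r2)"
        using r1 RB by (intro borel_caratheodory[OF holomorphic_on_subset[OF g] g0 B]) (auto simp: r2_def)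
      then show "norm (g w) \<le> 2 * B" using r1 by (simp add: r2_def)
    qed (use r1 in \<open>auto simp: r2_def\<close>)
    have sums: "(\<lambda>k. c k * z ^ k) sums g z"
      using holomorphic_power_series[OF g, of z] z \<rho> by (simp add: c_def)
    have t3: "norm (c k * z ^ k) \<le> C * A * q ^ k" for k
    proof -
      have "norm (c k * z ^ k) \<le> (C * A / r3 ^ k) * \<rho> ^ k"
        unfolding norm_mult norm_power using z C A r3 by (intro mult_mono c3 power_mono) auto
      then show ?thesis by (simp add: q_def power_divide)
    qed
    have t2: "norm (c k * z ^ k) \<le> 2 * B * (\<rho> / r2) ^ k" for k
    proof -
      have "norm (c k * z ^ k) \<le> (2 * B / r2 ^ k) * \<rho> ^ k"
        unfolding norm_mult norm_power using z B r1 by (intro mult_mono c2 power_mono) (auto simp: r2_def)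
      then show ?thesis by (simp add: power_divide)
    qed
    have gs: "(\<lambda>k. C * A * q ^ (k + N)) sums (C * A * (q ^ N * (1 / (1 - q))))"
    proof -
      have "(\<lambda>k. C * A * (q ^ N * q ^ k)) sums (C * A * (q ^ N * (1 / (1 - q))))"
        using q by (intro sums_mult geometric_sums) auto
      then show ?thesis by (simp add: power_add mult_ac)
    qed
    have "g z = (\<Sum>k. c (k + N) * z ^ (k + N)) + (\<Sum>k<N. c k * z ^ k)"
      using suminf_split_initial_segment[OF sums_summable[OF sums], of N] sums_unique[OF sums] by simp
    also have "norm \<dots> \<le> norm (\<Sum>k. c (k + N) * z ^ (k + N)) + norm (\<Sum>k<N. c k * z ^ k)"
      by (rule norm_triangle_ineq)
    also have "norm (\<Sum>k. c (k + N) * z ^ (k + N)) \<le> (\<Sum>k. C * A * q ^ (k + N))"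
      by (intro norm_suminf_le t3 sums_summable[OF gs])
    also have "\<dots> = (C * (q ^ N / (1 - q))) * A" using sums_unique[OF gs, symmetric] by (simp add: mult_ac)
    also have "\<dots> \<le> \<epsilon> * A" using N A by (intro mult_right_mono) auto
    also have "norm (\<Sum>k<N. c k * z ^ k) \<le> K"
      unfolding K_def by (rule order.trans[OF norm_sum sum_mono[OF t2]])
    finally show "norm (g z) \<le> K + \<epsilon> * A" by simp
  qed
qed

section \<open>Bounds for zeta and its reciprocal\<close>

lemma norm_mellin_frac1_le:
  assumes s: "Re s > 0" shows "norm (mellin frac1 s) \<le> 1 / Re s"
proof -
  have I: "set_integrable lborel {1<..} (\<lambda>t. complex_of_real t powr (- of_real (Re s) - 1))"
    "(LINT t:{1<..}|lborel. complex_of_real t powr (- of_real (Re s) - 1)) = 1 / of_real (Re s)"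
    using powr_tail_integral[of "of_real (Re s)" 1] s by simp_all
  have eq: "indicator {1<..} t *\<^sub>R (complex_of_real t powr (- of_real (Re s) - 1)) =
      of_real (indicator {1<..} t * t powr (- Re s - 1))" for t
    using powr_of_real[of t "- Re s - 1"] by (cases "t > 1") auto
  have "complex_of_real (LINT t|lborel. indicator {1<..} t * t powr (- Re s - 1)) = of_real (1 / Re s)"
    using I(2) unfolding set_lebesgue_integral_def eq integral_complex_of_real by simp
  then have val: "(LINT t|lborel. indicator {1<..} t * t powr (- Re s - 1)) = 1 / Re s"
    by (simp only: of_real_eq_iff)
  have int: "integrable lborel (\<lambda>t. indicator {1<..} t * t powr (- Re s - 1))"
    using I(1) unfolding set_integrable_def eq complex_of_real_integrable_eq .
  have "norm (mellin frac1 s) \<le> (LINT t|lborel. indicator {1<..} t * t powr (- Re s - 1))"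
    unfolding mellin_def set_lebesgue_integral_def
  proof (rule Bochner_Integration.integral_norm_bound_integral[OF _ int])
    show "integrable lborel (\<lambda>t. indicator {0<..} t *\<^sub>R (complex_of_real t powr (- s - 1) * frac1 t))"
      using mellin_integrable_frac1[OF s] by (simp add: mellin_integrable_def set_integrable_def)
    fix t :: real
    consider "t \<le> 0" | "0 < t" "t < 1" | "t = 1" | "t > 1" by linarith
    then show "norm (indicator {0<..} t *\<^sub>R (complex_of_real t powr (- s - 1) * frac1 t)) \<le> indicator {1<..} t * t powr (- Re s - 1)"
    proof cases
      case 4
      have "t powr (- Re s - 1) * norm (frac1 t) \<le> t powr (- Re s - 1) * 1"
        by (intro mult_left_mono norm_frac1_le) simp
      then show ?thesis using 4 by (simp add: norm_mult norm_powr_of_real_pos)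
    qed (simp_all add: frac1_def)
  qed
  then show ?thesis unfolding val .
qed

text \<open>Any polynomial bound would serve: it enters \<open>inverse_zeta_growth\<close> through
  its logarithm only.\<close>

lemma riemann_zeta_linear_bound:
  assumes s: "Re s \<ge> 1 / 2" "\<bar>Im s\<bar> \<ge> 1 / 2"
  shows "norm (riemann_zeta s) \<le> 4 * norm s"
proof -
  have "s \<noteq> 1" using s by auto
  then have "norm (riemann_zeta s) \<le> norm (s / (s - 1)) + norm (s * mellin frac1 s)"
    using riemann_zeta_frac1[of s] s norm_triangle_ineq4 by simp
  also have "norm (s * mellin frac1 s) \<le> norm s * 2"
    unfolding norm_mult
  proof (rule mult_left_mono)
    have "norm (mellin frac1 s) \<le> 1 / Re s" using s by (intro norm_mellin_frac1_le) auto
    also have "\<dots> \<le> 1 / (1 / 2)" using s by (intro divide_left_mono) auto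
    finally show "norm (mellin frac1 s) \<le> 2" by simp
  qed simp
  also have "norm (s / (s - 1)) \<le> norm s * 2"
  proof -
    have "1 / 2 \<le> norm (s - 1)" using abs_Im_le_cmod[of "s - 1"] s by simp
    then have "norm s / norm (s - 1) \<le> norm s / (1 / 2)" by (intro divide_left_mono) auto
    then show ?thesis by (simp add: norm_divide)
  qed
  finally show ?thesis by simp
qed

text \<open>The value of zeta at \<open>3 / 2\<close>. It bounds both zeta and its reciprocal
  wherever the real part is at least \<open>3 / 2\<close>.\<close>

definition zeta_majorant :: real where
  "zeta_majorant = (\<Sum>k. real (Suc k) powr (- (3 / 2)))"

lemma zeta_majorant_ge_1: "zeta_majorant \<ge> 1"
proof -
  have "(\<Sum>k\<in>{0}. real (Suc k) powr (- (3 / 2))) \<le> zeta_majorant"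
    unfolding zeta_majorant_def using summable_Suc_powr[of "3 / 2"] by (intro sum_le_suminf) auto
  then show ?thesis by simp
qed

lemma zeta_majorant_bounds:
  assumes s: "Re s \<ge> 3 / 2"
  shows "norm (riemann_zeta s) \<le> zeta_majorant" "norm (1 / riemann_zeta s) \<le> zeta_majorant"
proof -
  have le: "norm (complex_of_nat (Suc k) powr (- s)) \<le> real (Suc k) powr (- (3 / 2))" for k
    unfolding norm_of_nat_Suc_powr using s by (intro powr_mono) auto
  have summ: "summable (\<lambda>k. real (Suc k) powr (- (3 / 2)))" by (rule summable_Suc_powr) simp
  have s1: "Re s > 1" using s by simp
  show "norm (riemann_zeta s) \<le> zeta_majorant"
    unfolding sums_unique[OF riemann_zeta_sums[OF s1]] zeta_majorant_def
    by (rule norm_suminf_le[OF le summ])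
  have "norm (of_real (moebius (Suc k)) * complex_of_nat (Suc k) powr (- s)) \<le> real (Suc k) powr (- (3 / 2))" for k
  proof -
    have "norm (of_real (moebius (Suc k)) * complex_of_nat (Suc k) powr (- s)) \<le> 1 * real (Suc k) powr (- (3 / 2))"
      unfolding norm_mult using abs_moebius_le[of "Suc k"] by (intro mult_mono le) auto
    then show ?thesis by simp
  qed
  then show "norm (1 / riemann_zeta s) \<le> zeta_majorant"
    unfolding sums_unique[OF moebius_sums[OF s1]] zeta_majorant_def
    by (rule norm_suminf_le[OF _ summ])
qed

text \<open>On the disc of radius \<open>3 / 2\<close> around \<open>2 + \<i>t\<close> zeta has a
  holomorphic logarithm, whose real part is bounded by a multiple of \<open>ln \<bar>t\<bar>\<close>
  there and by a constant on the disc of radius \<open>1 / 2\<close>.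
  \<open>two_circles_growth\<close> reduces the logarithmic bound to an arbitrarily small multiple
  of itself on the disc of radius \<open>3 / 2 - \<delta>\<close>, and exponentiating gives a small
  power of \<open>\<bar>t\<bar>\<close>.\<close>

lemma inverse_zeta_growth:
  assumes nz: "\<And>s. Re s > 1 / 2 \<Longrightarrow> s \<noteq> 1 \<Longrightarrow> riemann_zeta s \<noteq> 0"
    and \<delta>: "0 < \<delta>" "\<delta> < 1" and \<epsilon>: "\<epsilon> > 0"
  shows "\<exists>C. \<forall>s. 1 / 2 + \<delta> \<le> Re s \<longrightarrow> Re s \<le> 2 \<longrightarrow> \<bar>Im s\<bar> \<ge> 2 \<longrightarrow> norm (1 / riemann_zeta s) \<le> C * \<bar>Im s\<bar> powr \<epsilon>"
proof -
  let ?Z = "zeta_majorant"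
  have Z: "?Z \<ge> 1" by (rule zeta_majorant_ge_1)
  define B where "B = ln (?Z * ?Z) + 1"
  have B: "B > 0" using Z mult_mono[OF Z Z] by (simp add: B_def add_nonneg_pos)
  obtain K where K: "\<And>g A z. g holomorphic_on ball 0 (3 / 2) \<Longrightarrow> g 0 = 0 \<Longrightarrow> A > 0 \<Longrightarrow>
    (\<And>z. norm z < 3 / 2 \<Longrightarrow> Re (g z) < A) \<Longrightarrow> (\<And>z. norm z < 1 / 2 \<Longrightarrow> Re (g z) < B) \<Longrightarrow>
    norm z \<le> 3 / 2 - \<delta> \<Longrightarrow> norm (g z) \<le> K + \<epsilon> * A"
  proof -
    have "\<exists>K. \<forall>g A (z :: complex). g holomorphic_on ball 0 (3 / 2) \<longrightarrow> g 0 = 0 \<longrightarrow> A > 0 \<longrightarrow>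
      (\<forall>z. norm z < 3 / 2 \<longrightarrow> Re (g z) < A) \<longrightarrow> (\<forall>z. norm z < 1 / 2 \<longrightarrow> Re (g z) < B) \<longrightarrow>
      norm z \<le> 3 / 2 - \<delta> \<longrightarrow> norm (g z) \<le> K + \<epsilon> * A"
      by (rule two_circles_growth) (use \<delta> B \<epsilon> in auto)
    then show ?thesis using that by blast
  qed
  show ?thesis
  proof (intro exI[of _ "?Z * exp K * exp \<epsilon> * (11 * ?Z) powr \<epsilon>"] allI impI)
    fix s assume s: "1 / 2 + \<delta> \<le> Re s" "Re s \<le> 2" and t: "\<bar>Im s\<bar> \<ge> 2"
    \<comment> \<open>The open disc of radius \<open>3 / 2\<close> around \<open>s0\<close> stays to
      the right of the critical line, and away from the pole because
      \<open>\<bar>Im s\<bar> \<ge> 2\<close>. The disc of radius \<open>1 / 2\<close> lies where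
      \<open>zeta_majorant\<close> applies.\<close>
    define s0 where "s0 = Complex 2 (Im s)"
    have reg: "Re (s0 + z) > 1 / 2" "\<bar>Im (s0 + z)\<bar> \<ge> 1 / 2" "s0 + z \<noteq> 1" if "norm z < 3 / 2" for z
    proof -
      show "Re (s0 + z) > 1 / 2" using abs_Re_le_cmod[of z] that by (simp add: s0_def)
      have "Im (s0 + z) = Im s + Im z" by (simp add: s0_def)
      then show *: "\<bar>Im (s0 + z)\<bar> \<ge> 1 / 2" using abs_Im_le_cmod[of z] that t by linarith
      show "s0 + z \<noteq> 1"
      proof
        assume "s0 + z = 1"
        then have "Im (s0 + z) = 0" by (simp only: one_complex.simps)
        with * show False by linarith
      qed
    qed
    have z0: "riemann_zeta (s0 + z) \<noteq> 0" if "norm z < 3 / 2" for z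
      using nz reg[OF that] by auto
    have hol: "riemann_zeta holomorphic_on {s. 0 < Re s} - {1}"
    proof (rule holomorphic_transform[where f = "\<lambda>s. s / (s - 1) - s * mellin frac1 s"])
      show "(\<lambda>s. s / (s - 1) - s * mellin frac1 s) holomorphic_on {s. 0 < Re s} - {1}"
        by (intro holomorphic_intros holomorphic_on_subset[OF mellin_frac1_holomorphic]) auto
    qed (use riemann_zeta_frac1 in auto)
    have hol2: "(\<lambda>z. riemann_zeta (s0 + z)) holomorphic_on ball 0 (3 / 2)"
    proof -
      have "(riemann_zeta \<circ> (\<lambda>z. s0 + z)) holomorphic_on ball 0 (3 / 2)"
      proof (rule holomorphic_on_compose_gen[OF _ hol])
        show "(+) s0 ` ball 0 (3 / 2) \<subseteq> {s. 0 < Re s} - {1}"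
        proof
          fix w assume "w \<in> (+) s0 ` ball 0 (3 / 2)"
          then obtain z where z: "w = s0 + z" "z \<in> ball 0 (3 / 2)" by (elim imageE)
          then have "norm z < 3 / 2" by simp
          from reg[OF this] show "w \<in> {s. 0 < Re s} - {1}" using z(1) by simp
        qed
      qed (intro holomorphic_intros)
      then show ?thesis by (simp add: o_def)
    qed
    obtain g0 where g0: "g0 holomorphic_on ball 0 (3 / 2)" "\<And>z. z \<in> ball 0 (3 / 2) \<Longrightarrow> riemann_zeta (s0 + z) = exp (g0 z)"
      using contractible_imp_holomorphic_log[OF hol2 convex_imp_contractible[OF convex_ball]] z0 by auto
    \<comment> \<open>A logarithm of zeta normalised by its value at \<open>s0\<close>, so that
      \<open>g 0 = 0\<close> as \<open>two_circles_growth\<close> requires.\<close>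
    define g where "g = (\<lambda>z. g0 z - g0 0)"
    have eg: "norm (riemann_zeta (s0 + z)) = norm (riemann_zeta s0) * exp (Re (g z))" if "norm z < 3 / 2" for z
      using g0(2)[of z] g0(2)[of 0] that by (simp add: g_def norm_mult flip: exp_add)
    have s0b: "norm (riemann_zeta s0) \<le> ?Z" "norm (1 / riemann_zeta s0) \<le> ?Z"
      by (rule zeta_majorant_bounds; simp add: s0_def)+
    have nz0: "norm (riemann_zeta s0) > 0" using z0[of 0] by simp
    have Reg: "Re (g z) < ln (X * ?Z) + 1" if "norm z < 3 / 2" "norm (riemann_zeta (s0 + z)) \<le> X" for z X
    proof -
      have "exp (Re (g z)) = norm (riemann_zeta (s0 + z)) * norm (1 / riemann_zeta s0)"
        using eg[OF that(1)] nz0 by (simp add: norm_divide)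
      also have "\<dots> \<le> X * ?Z" using that(2) s0b by (intro mult_mono) (auto intro: order.trans[OF norm_ge_zero])
      finally have "exp (Re (g z)) \<le> X * ?Z" .
      then have "Re (g z) \<le> ln (X * ?Z)"
        by (metis exp_gt_zero ln_exp ln_le_cancel_iff order.strict_trans2)
      then show ?thesis by simp
    qed
    define T where "T = \<bar>Im s\<bar>"
    have T: "T \<ge> 2" using t by (simp add: T_def)
    \<comment> \<open>The 11 comes from \<open>4 * (2 + T + 3 / 2) \<le> 11 * T\<close> for
      \<open>T \<ge> 2\<close>, and the 1 makes the bound strict. Since \<open>A\<close> is a
      constant plus \<open>ln T\<close>, \<open>exp (\<epsilon> * A)\<close> is a constant times
      \<open>T powr \<epsilon>\<close>.\<close>
    define A where "A = ln (11 * T * ?Z) + 1"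
    have TZ: "11 * T * ?Z \<ge> 1" using T Z mult_mono[of 1 "11 * T" 1 ?Z] by simp
    have A: "A > 0" using TZ by (simp add: A_def add_nonneg_pos)
    have "norm (g (s - s0)) \<le> K + \<epsilon> * A"
    proof (rule K[of g A "s - s0"])
      show "g holomorphic_on ball 0 (3 / 2)" unfolding g_def by (intro holomorphic_intros g0)
      show "Re (g z) < B" if "norm z < 1 / 2" for z
        unfolding B_def
      proof (rule Reg)
        show "norm (riemann_zeta (s0 + z)) \<le> ?Z"
          using that abs_Re_le_cmod[of z] by (intro zeta_majorant_bounds) (simp add: s0_def)
      qed (use that in simp)
      show "Re (g z) < A" if z: "norm z < 3 / 2" for z
        unfolding A_def
      proof (rule Reg[OF z])
        have "norm (riemann_zeta (s0 + z)) \<le> 4 * norm (s0 + z)"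
          using reg[OF z] by (intro riemann_zeta_linear_bound) auto
        also have "norm (s0 + z) \<le> norm s0 + norm z" by (rule norm_triangle_ineq)
        also have "norm s0 \<le> 2 + T" using cmod_le[of s0] by (simp add: s0_def T_def)
        also have "4 * (2 + T + norm z) \<le> 11 * T" using z T by simp
        finally show "norm (riemann_zeta (s0 + z)) \<le> 11 * T" by simp
      qed
      have "s - s0 = of_real (Re s - 2)" by (simp add: s0_def complex_eq_iff)
      then have "norm (s - s0) = \<bar>Re s - 2\<bar>" by (simp only: norm_of_real)
      then show "norm (s - s0) \<le> 3 / 2 - \<delta>" using s by simp
    qed (use A in \<open>auto simp: g_def\<close>)
    then have "- Re (g (s - s0)) \<le> K + \<epsilon> * A"
      using abs_Re_le_cmod[of "g (s - s0)"] by linarith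
    have "s - s0 = of_real (Re s - 2)" by (simp add: s0_def complex_eq_iff)
    then have "norm (s - s0) = \<bar>Re s - 2\<bar>" by (simp only: norm_of_real)
    then have "norm (s - s0) < 3 / 2" using s \<delta> by simp
    from eg[OF this] have "norm (1 / riemann_zeta s) = norm (1 / riemann_zeta s0) * exp (- Re (g (s - s0)))"
      by (simp add: norm_divide exp_minus field_simps)
    also have "\<dots> \<le> ?Z * exp (K + \<epsilon> * A)"
      using s0b \<open>- Re (g (s - s0)) \<le> K + \<epsilon> * A\<close> Z by (intro mult_mono) auto
    also have "exp (K + \<epsilon> * A) = exp K * exp \<epsilon> * (11 * ?Z) powr \<epsilon> * T powr \<epsilon>"
      using T Z by (simp add: A_def powr_def ln_mult exp_add [symmetric] algebra_simps)
    finally show "norm (1 / riemann_zeta s) \<le> ?Z * exp K * exp \<epsilon> * (11 * ?Z) powr \<epsilon> * \<bar>Im s\<bar> powr \<epsilon>"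
      by (simp add: T_def mult_ac)
  qed
qed

lemma zeta_reg_nonzero:
  assumes nz: "\<And>s. Re s > 1 / 2 \<Longrightarrow> s \<noteq> 1 \<Longrightarrow> riemann_zeta s \<noteq> 0" and s: "Re s > - 1 / 2"
  shows "zeta_reg s \<noteq> 0"
proof (cases "s = 0")
  case False
  have "Re (1 + s) > 1 / 2" "1 + s \<noteq> 1" using s False by auto
  then show ?thesis using nz False s zeta_reg_eq[of s] by auto
qed simp

text \<open>Away from the real axis the factor \<open>s\<close> of \<open>zeta_reg\<close> turns the
  growth \<open>\<epsilon>\<close> of the reciprocal zeta function into decay of order
  \<open>1 - \<epsilon>\<close>. Near the real axis the bound comes from compactness, which includes
  the point 0 since \<open>zeta_reg 0 = 1\<close>.\<close>

lemma inverse_zeta_reg_growth: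
  assumes nz: "\<And>s. Re s > 1 / 2 \<Longrightarrow> s \<noteq> 1 \<Longrightarrow> riemann_zeta s \<noteq> 0"
    and \<delta>: "0 < \<delta>" "\<delta> < 1" and \<epsilon>: "\<epsilon> > 0" "\<epsilon> < 1"
  shows "\<exists>C>0. \<forall>s. - 1 / 2 + \<delta> \<le> Re s \<longrightarrow> Re s \<le> 1 \<longrightarrow> norm (1 / zeta_reg s) \<le> C * (1 + \<bar>Im s\<bar>) powr (\<epsilon> - 1)"
proof -
  obtain C1 where C1: "\<And>s. 1 / 2 + \<delta> \<le> Re s \<Longrightarrow> Re s \<le> 2 \<Longrightarrow> \<bar>Im s\<bar> \<ge> 2 \<Longrightarrow> norm (1 / riemann_zeta s) \<le> C1 * \<bar>Im s\<bar> powr \<epsilon>"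
    using inverse_zeta_growth[OF nz \<delta> \<epsilon>(1)] by blast
  define S where "S = cbox (Complex (- 1 / 2 + \<delta>) (-2)) (Complex 1 2)"
  have "continuous_on S (\<lambda>s. 1 / zeta_reg s)"
  proof (intro continuous_intros continuous_on_subset[OF holomorphic_on_imp_continuous_on[OF zeta_reg_holomorphic]] ballI zeta_reg_nonzero[OF nz])
    show "S \<subseteq> {s. - 1 < Re s}" using \<delta> by (auto simp: S_def in_cbox_complex_iff)
    show "- 1 / 2 < Re s" if "s \<in> S" for s using \<delta> that by (auto simp: S_def in_cbox_complex_iff)
  qed
  then have "compact ((\<lambda>s. 1 / zeta_reg s) ` S)"
    by (rule compact_continuous_image) (simp add: S_def)
  then obtain M where M: "\<And>s. s \<in> S \<Longrightarrow> norm (1 / zeta_reg s) \<le> M"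
    by (metis bounded_iff compact_imp_bounded image_eqI)
  \<comment> \<open>The 3 stems from \<open>1 + T \<le> 3\<close> on the compact part, the
    \<open>2 / 3\<close> from \<open>T \<ge> (2 / 3) * (1 + T)\<close> for \<open>T \<ge> 2\<close>;
    the last summand makes \<open>C\<close> positive.\<close>
  define C where "C = \<bar>M\<bar> * 3 powr (1 - \<epsilon>) + \<bar>C1\<bar> * (2 / 3) powr (\<epsilon> - 1) + 1"
  have C0: "C > 0" by (simp add: C_def add_nonneg_pos)
  show ?thesis
  proof (intro exI[of _ C] conjI C0 allI impI)
    fix s assume s: "- 1 / 2 + \<delta> \<le> Re s" "Re s \<le> 1"
    define T where "T = \<bar>Im s\<bar>"
    have T0: "T \<ge> 0" by (simp add: T_def)
    show "norm (1 / zeta_reg s) \<le> C * (1 + \<bar>Im s\<bar>) powr (\<epsilon> - 1)"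
    proof (cases "T \<le> 2")
      case True
      then have "s \<in> S" using s by (auto simp: S_def in_cbox_complex_iff T_def)
      then have "norm (1 / zeta_reg s) \<le> \<bar>M\<bar>" using M by fastforce
      also have "\<dots> = \<bar>M\<bar> * 3 powr (1 - \<epsilon>) * 3 powr (\<epsilon> - 1)"
        by (simp add: powr_add [symmetric])
      also have "\<dots> \<le> C * (1 + T) powr (\<epsilon> - 1)"
      proof (rule mult_mono)
        show "3 powr (\<epsilon> - 1) \<le> (1 + T) powr (\<epsilon> - 1)"
          using True \<epsilon> T0 by (intro powr_mono2') auto
      qed (use C0 in \<open>auto simp: C_def\<close>)
      finally show ?thesis by (simp add: T_def)
    next
      case False
      then have s0: "s \<noteq> 0" by (auto simp: T_def)
      have "norm (1 / zeta_reg s) = norm (1 / riemann_zeta (1 + s)) * (1 / norm s)"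
        using zeta_reg_eq[of s] s s0 \<delta> by (simp add: norm_divide norm_mult)
      also have "\<dots> \<le> (\<bar>C1\<bar> * T powr \<epsilon>) * (1 / T)"
      proof (rule mult_mono)
        have "norm (1 / riemann_zeta (1 + s)) \<le> C1 * T powr \<epsilon>"
          using C1[of "1 + s"] s False by (simp add: T_def)
        also have "\<dots> \<le> \<bar>C1\<bar> * T powr \<epsilon>" by (intro mult_right_mono) auto
        finally show "norm (1 / riemann_zeta (1 + s)) \<le> \<bar>C1\<bar> * T powr \<epsilon>" .
        show "1 / norm s \<le> 1 / T" using abs_Im_le_cmod[of s] False s0
          by (intro divide_left_mono mult_pos_pos) (auto simp: T_def)
      qed auto
      also have "\<dots> = \<bar>C1\<bar> * T powr (\<epsilon> - 1)" using False by (simp add: powr_diff)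
      also have "\<dots> \<le> \<bar>C1\<bar> * ((2 / 3) * (1 + T)) powr (\<epsilon> - 1)"
        using False \<epsilon> by (intro mult_left_mono powr_mono2') auto
      also have "\<dots> = \<bar>C1\<bar> * (2 / 3) powr (\<epsilon> - 1) * (1 + T) powr (\<epsilon> - 1)"
        using T0 by (subst powr_mult) auto
      also have "\<dots> \<le> C * (1 + T) powr (\<epsilon> - 1)"
        by (rule mult_right_mono) (auto simp: C_def)
      finally show ?thesis by (simp add: T_def)
    qed
  qed
qed

section \<open>The Perron kernel\<close>

lemma integrable_one_plus_abs_powr:
  fixes \<eta> :: real assumes "\<eta> > 0"
  shows "integrable lborel (\<lambda>t :: real. (1 + \<bar>t\<bar>) powr (- 1 - \<eta>))"
proof -
  define f where "f = (\<lambda>t :: real. indicator {1<..} t * t powr (- 1 - \<eta>))"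
  have e: "- \<eta> - 1 = - 1 - \<eta>" by simp
  have f: "integrable lborel f"
    using set_integrable_powr_tail[OF assms, of 1] unfolding e by (simp add: set_integrable_def f_def)
  have 1: "integrable lborel (\<lambda>t. f (1 + 1 * t))"
    by (rule lborel_integrable_real_affine[OF f]) simp
  have 2: "integrable lborel (\<lambda>t. f (1 + (-1) * t))"
    by (rule lborel_integrable_real_affine[OF f]) simp
  show ?thesis
  proof (rule integrable_cong_AE_imp[OF Bochner_Integration.integrable_add[OF 1 2]])
    have "AE t in lborel. t \<noteq> (0 :: real)" by (rule AE_lborel_singleton)
    then show "AE t in lborel. f (1 + 1 * t) + f (1 + (-1) * t) = (1 + \<bar>t\<bar>) powr (- 1 - \<eta>)"
    proof eventually_elim
      case (elim t)
      then show ?case by (cases "t > 0") (simp_all add: f_def)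
    qed
  qed measurable
qed

lemma line_integrable:
  fixes H :: "complex \<Rightarrow> complex"
  assumes S: "H holomorphic_on S" "\<And>t. Complex c t \<in> S"
    and H: "\<And>t. norm (H (Complex c t)) \<le> C * (1 + \<bar>t\<bar>) powr (- 1 - \<eta>)" and \<eta>: "\<eta> > 0"
  shows "integrable lborel (\<lambda>t. H (Complex c t))"
proof (rule Bochner_Integration.integrable_bound)
  show "integrable lborel (\<lambda>t. C * (1 + \<bar>t\<bar>) powr (- 1 - \<eta>))"
    by (intro integrable_mult_right integrable_one_plus_abs_powr \<eta>)
  have "continuous_on UNIV (\<lambda>t. H (Complex c t))"
    by (rule continuous_on_compose2[OF holomorphic_on_imp_continuous_on[OF S(1)]])
      (use S(2) in \<open>auto intro!: continuous_intros simp: Complex_eq\<close>)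
  then show "(\<lambda>t. H (Complex c t)) \<in> borel_measurable lborel"
    using borel_measurable_continuous_onI by simp
  show "AE t in lborel. norm (H (Complex c t)) \<le> norm (C * (1 + \<bar>t\<bar>) powr (- 1 - \<eta>))"
    using H by (intro AE_I2) (metis abs_ge_self order.trans real_norm_def)
qed

lemma truncated_integral_LIMSEQ:
  fixes h :: "real \<Rightarrow> complex"
  assumes h: "integrable lborel h"
  shows "(\<lambda>n. integral {- real n..real n} h) \<longlonglongrightarrow> integral\<^sup>L lborel h"
proof -
  have "(\<lambda>n. LINT t|lborel. indicator {- real n..real n} t *\<^sub>R h t) \<longlonglongrightarrow> integral\<^sup>L lborel h"
  proof (rule integral_dominated_convergence[where w = "\<lambda>t. norm (h t)"])
    show "AE t in lborel. (\<lambda>n. indicator {- real n..real n} t *\<^sub>R h t) \<longlonglongrightarrow> h t"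
    proof (rule AE_I2, rule tendsto_eventually)
      fix t :: real
      show "\<forall>\<^sub>F n in sequentially. indicator {- real n..real n} t *\<^sub>R h t = h t"
        using eventually_ge_at_top[of "nat \<lceil>\<bar>t\<bar>\<rceil>"]
      proof eventually_elim
        case (elim n)
        then have "\<bar>t\<bar> \<le> real n" by linarith
        then show ?case by (simp add: abs_le_iff)
      qed
    qed
    show "AE t in lborel. norm (indicator {- real n..real n} t *\<^sub>R h t) \<le> norm (h t)" for n
      by (intro AE_I2) (simp add: indicator_def)
  qed (use h in auto)
  moreover have "(LINT t|lborel. indicator {- real n..real n} t *\<^sub>R h t) = integral {- real n..real n} h" for n
  proof -
    have "set_integrable lborel {- real n..real n} h"
      unfolding set_integrable_def by (rule integrable_mult_indicator[OF _ h]) simp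
    from set_borel_integral_eq_integral(2)[OF this] show ?thesis by (simp add: set_lebesgue_integral_def)
  qed
  ultimately show ?thesis by simp
qed

text \<open>A primitive of \<open>H\<close> on the convex set \<open>S\<close> does the work of
  Cauchy's theorem for rectangles. Truncated integrals over the two lines are differences of its
  values at corners, so they differ by the increments along the horizontal sides, and these vanish
  in the limit by the decay of \<open>H\<close>.\<close>

lemma vertical_line_shift:
  fixes H :: "complex \<Rightarrow> complex"
  assumes ab: "a \<le> b" and S: "open S" "convex S" "\<And>s. a \<le> Re s \<Longrightarrow> Re s \<le> b \<Longrightarrow> s \<in> S"
    and hol: "H holomorphic_on S"
    and H: "\<And>s. a \<le> Re s \<Longrightarrow> Re s \<le> b \<Longrightarrow> norm (H s) \<le> C * (1 + \<bar>Im s\<bar>) powr (- 1 - \<eta>)" and \<eta>: "\<eta> > 0"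
  shows "(LINT t|lborel. H (Complex a t)) = (LINT t|lborel. H (Complex b t))"
proof -
  obtain P where P: "\<And>s. s \<in> S \<Longrightarrow> (P has_field_derivative H s) (at s)"
    using holomorphic_convex_primitive'[OF S(2,1) hol] S(1) by (metis at_within_open)
  have int: "integrable lborel (\<lambda>t. H (Complex c t))" if "a \<le> c" "c \<le> b" for c
    using that by (intro line_integrable[OF hol _ _ \<eta>, where C = C] S(3)) (use H[of "Complex c _"] in auto)
  \<comment> \<open>The factor \<open>- \<i>\<close> appears because the integrals are taken with
    respect to \<open>t\<close>, whereas \<open>Complex c t\<close> moves with velocity
    \<open>\<i>\<close>.\<close>
  have seg: "integral {- T..T} (\<lambda>t. H (Complex c t)) = - \<i> * (P (Complex c T) - P (Complex c (- T)))"
    if "a \<le> c" "c \<le> b" "T \<ge> 0" for c T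
  proof (rule integral_unique)
    have "((\<lambda>t. H (Complex c t)) has_integral (- \<i> * P (Complex c T) - (- \<i> * P (Complex c (- T))))) {- T..T}"
    proof (rule fundamental_theorem_of_calculus)
      fix t :: real
      have "((\<lambda>t. Complex c t) has_vector_derivative \<i>) (at t within {- T..T})"
        unfolding Complex_eq by (auto intro!: derivative_eq_intros)
      moreover have "(P has_field_derivative H (Complex c t)) (at (Complex c t) within (\<lambda>t. Complex c t) ` {- T..T})"
        by (rule has_field_derivative_at_within[OF P[OF S(3)]]) (use that in simp_all)
      ultimately have "(P \<circ> (\<lambda>t. Complex c t) has_vector_derivative \<i> * H (Complex c t)) (at t within {- T..T})"
        by (rule field_vector_diff_chain_within)
      then have "((\<lambda>t. - \<i> * P (Complex c t)) has_vector_derivative - \<i> * (\<i> * H (Complex c t))) (at t within {- T..T})"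
        unfolding o_def by (rule has_vector_derivative_mult_right)
      then show "((\<lambda>t. - \<i> * P (Complex c t)) has_vector_derivative H (Complex c t)) (at t within {- T..T})"
        by (simp flip: mult.assoc)
    qed (use that in auto)
    then show "((\<lambda>t. H (Complex c t)) has_integral - \<i> * (P (Complex c T) - P (Complex c (- T)))) {- T..T}"
      by (simp add: algebra_simps)
  qed
  have hor: "norm (P (Complex b u) - P (Complex a u)) \<le> C * (1 + \<bar>u\<bar>) powr (- 1 - \<eta>) * (b - a)" for u
  proof -
    have "norm (P (Complex b u) - P (Complex a u)) \<le> C * (1 + \<bar>u\<bar>) powr (- 1 - \<eta>) * norm (Complex b u - Complex a u)"
    proof (rule field_differentiable_bound[of "closed_segment (Complex a u) (Complex b u)"])
      fix s assume s: "s \<in> closed_segment (Complex a u) (Complex b u)"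
      then have s': "a \<le> Re s" "Re s \<le> b" "Im s = u"
        using ab closed_segment_same_Im[of "Complex a u" "Complex b u"] by (auto simp: closed_segment_eq_real_ivl)
      show "(P has_field_derivative H s) (at s within closed_segment (Complex a u) (Complex b u))"
        by (rule has_field_derivative_at_within[OF P[OF S(3)[OF s'(1,2)]]])
      show "norm (H s) \<le> C * (1 + \<bar>u\<bar>) powr (- 1 - \<eta>)"
        using H[of s] s' by simp
    qed auto
    also have "Complex b u - Complex a u = of_real (b - a)" by (simp add: complex_eq_iff)
    also have "norm (complex_of_real (b - a)) = b - a" using ab by (simp only: norm_of_real)
    finally show ?thesis .
  qed
  have "(\<lambda>n. integral {- real n..real n} (\<lambda>t. H (Complex a t)) - integral {- real n..real n} (\<lambda>t. H (Complex b t)))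
      \<longlonglongrightarrow> (LINT t|lborel. H (Complex a t)) - (LINT t|lborel. H (Complex b t))"
    using ab by (intro tendsto_diff truncated_integral_LIMSEQ int) auto
  moreover have "(\<lambda>n. integral {- real n..real n} (\<lambda>t. H (Complex a t)) - integral {- real n..real n} (\<lambda>t. H (Complex b t))) \<longlonglongrightarrow> 0"
  proof (rule Lim_null_comparison)
    have "(\<lambda>n. 2 * (C * (1 + real n) powr (- 1 - \<eta>) * (b - a))) \<longlonglongrightarrow> 2 * (C * 0 * (b - a))"
      using \<eta> by (intro tendsto_intros tendsto_neg_powr filterlim_tendsto_add_at_top[OF tendsto_const] filterlim_real_sequentially) auto
    then show "(\<lambda>n. 2 * (C * (1 + real n) powr (- 1 - \<eta>) * (b - a))) \<longlonglongrightarrow> 0" by simp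
    show "\<forall>\<^sub>F n in sequentially. norm (integral {- real n..real n} (\<lambda>t. H (Complex a t)) - integral {- real n..real n} (\<lambda>t. H (Complex b t)))
       \<le> 2 * (C * (1 + real n) powr (- 1 - \<eta>) * (b - a))"
    proof (rule always_eventually, rule allI)
      fix n :: nat
      have "integral {- real n..real n} (\<lambda>t. H (Complex a t)) - integral {- real n..real n} (\<lambda>t. H (Complex b t)) =
          \<i> * ((P (Complex b (real n)) - P (Complex a (real n))) - (P (Complex b (- real n)) - P (Complex a (- real n))))"
        using ab by (simp add: seg algebra_simps)
      then have "norm (integral {- real n..real n} (\<lambda>t. H (Complex a t)) - integral {- real n..real n} (\<lambda>t. H (Complex b t))) =
          norm ((P (Complex b (real n)) - P (Complex a (real n))) - (P (Complex b (- real n)) - P (Complex a (- real n))))"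
        by (simp only: norm_mult norm_ii mult_1)
      also have "\<dots> \<le> norm (P (Complex b (real n)) - P (Complex a (real n))) + norm (P (Complex b (- real n)) - P (Complex a (- real n)))"
        by (rule norm_triangle_ineq4)
      also have "\<dots> \<le> 2 * (C * (1 + real n) powr (- 1 - \<eta>) * (b - a))"
        using hor[of "real n"] hor[of "- real n"] by simp
      finally show "norm (integral {- real n..real n} (\<lambda>t. H (Complex a t)) - integral {- real n..real n} (\<lambda>t. H (Complex b t)))
       \<le> 2 * (C * (1 + real n) powr (- 1 - \<eta>) * (b - a))" .
    qed
  qed
  ultimately show ?thesis using LIMSEQ_unique by fastforce
qed

text \<open>Converts decay like the inverse square of \<open>Im s\<close> into the form expected by
  \<open>line_integrable\<close> and \<open>vertical_line_shift\<close>, with exponent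
  \<open>\<eta> = 1 / 2\<close>; the part near the real axis is compact.\<close>

lemma quadratic_decay_bound:
  fixes f :: "complex \<Rightarrow> complex"
  assumes f: "continuous_on {s. a \<le> Re s \<and> Re s \<le> b} f"
    and bd: "\<And>s. a \<le> Re s \<Longrightarrow> Re s \<le> b \<Longrightarrow> \<bar>Im s\<bar> \<ge> 1 \<Longrightarrow> norm (f s) \<le> C / \<bar>Im s\<bar>\<^sup>2"
  shows "\<exists>C'. \<forall>s. a \<le> Re s \<longrightarrow> Re s \<le> b \<longrightarrow> norm (f s) \<le> C' * (1 + \<bar>Im s\<bar>) powr (- 1 - 1 / 2)"
proof -
  define S where "S = cbox (Complex a (-1)) (Complex b 1)"
  have "compact (f ` S)"
    by (rule compact_continuous_image[OF continuous_on_subset[OF f]]) (auto simp: S_def in_cbox_complex_iff)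
  then obtain M where M: "\<And>s. s \<in> S \<Longrightarrow> norm (f s) \<le> M"
    by (metis bounded_iff compact_imp_bounded image_eqI)
  define C' where "C' = \<bar>M\<bar> * 4 + \<bar>C\<bar> * 4"
  show ?thesis
  proof (intro exI[of _ C'] allI impI)
    fix s assume s: "a \<le> Re s" "Re s \<le> b"
    define T where "T = \<bar>Im s\<bar>"
    have T0: "T \<ge> 0" by (simp add: T_def)
    have sq: "(1 + T) powr (- 2) = 1 / (1 + T)\<^sup>2" using T0 by (simp add: powr_minus divide_inverse)
    have le: "(1 + T) powr (- 2) \<le> (1 + T) powr (- 1 - 1 / 2)"
      using T0 by (intro powr_mono) auto
    have "norm (f s) \<le> C' * (1 + T) powr (- 2)"
    proof (cases "T \<le> 1")
      case True
      then have "s \<in> S" using s by (auto simp: S_def in_cbox_complex_iff T_def)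
      then have "norm (f s) \<le> \<bar>M\<bar>" using M by fastforce
      also have "\<dots> \<le> \<bar>M\<bar> * (4 * (1 + T) powr (- 2))"
      proof -
        have "(1 + T)\<^sup>2 \<le> 2\<^sup>2" using True T0 by (intro power_mono) auto
        then have "1 \<le> 4 * (1 + T) powr (- 2)" unfolding sq using T0 by (simp add: field_simps)
        then show ?thesis using mult_left_mono[of 1 _ "\<bar>M\<bar>"] by simp
      qed
      also have "\<dots> \<le> C' * (1 + T) powr (- 2)"
        by (simp add: C'_def distrib_right mult.assoc)
      finally show ?thesis .
    next
      case False
      then have "norm (f s) \<le> C / T\<^sup>2" using bd[OF s] by (simp add: T_def)
      also have "\<dots> \<le> \<bar>C\<bar> / T\<^sup>2" by (intro divide_right_mono) auto
      also have "\<dots> \<le> \<bar>C\<bar> * (4 * (1 + T) powr (- 2))"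
      proof -
        have "(1 + T)\<^sup>2 \<le> (2 * T)\<^sup>2" using False by (intro power_mono) auto
        then have "1 / T\<^sup>2 \<le> 4 * (1 + T) powr (- 2)" unfolding sq using False by (simp add: field_simps)
        then show ?thesis using mult_left_mono[of "1 / T\<^sup>2" _ "\<bar>C\<bar>"] by simp
      qed
      also have "\<dots> \<le> C' * (1 + T) powr (- 2)"
        by (simp add: C'_def distrib_right mult.assoc)
      finally show ?thesis .
    qed
    also have "\<dots> \<le> C' * (1 + T) powr (- 1 - 1 / 2)"
      using le by (intro mult_left_mono) (auto simp: C'_def)
    finally show "norm (f s) \<le> C' * (1 + \<bar>Im s\<bar>) powr (- 1 - 1 / 2)" by (simp add: T_def)
  qed
qed

text \<open>The second linear factor in the denominator makes the integral over a vertical line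
  absolutely convergent. The price is that the integral detects \<open>y > 1\<close> by the
  continuous weight \<open>max 0 (y - 1)\<close> instead of a jump.\<close>

definition perron_kernel :: "real \<Rightarrow> complex \<Rightarrow> complex" where
  "perron_kernel y s = of_real y powr (s + 1) / (s * (s + 1))"

lemma powr_strip_bound:
  assumes "y > 0" "a \<le> Re s" "Re s \<le> b"
  shows "norm (complex_of_real y powr (s + 1)) \<le> y powr (a + 1) + y powr (b + 1)"
proof -
  have "norm (complex_of_real y powr (s + 1)) = y powr (Re s + 1)"
    using assms by (simp add: norm_powr_of_real_pos)
  also have "\<dots> \<le> y powr (a + 1) + y powr (b + 1)"
  proof (cases "y \<ge> 1")
    case True
    then have "y powr (Re s + 1) \<le> y powr (b + 1)" using assms by (intro powr_mono) auto
    then show ?thesis by (smt (verit) powr_ge_zero)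
  next
    case False
    then have "y powr (Re s + 1) \<le> y powr (a + 1)" using assms by (intro powr_mono') auto
    then show ?thesis by (smt (verit) powr_ge_zero)
  qed
  finally show ?thesis .
qed

lemma powr_of_real_holomorphic: "y > 0 \<Longrightarrow> (\<lambda>s. complex_of_real y powr (s + 1)) holomorphic_on S"
  by (simp only: powr_of_real_pos) (intro holomorphic_intros)

lemma norm_product_ge_Im_square: "\<bar>Im s\<bar>\<^sup>2 \<le> norm (s * (s + 1))"
proof -
  have "\<bar>Im s\<bar> * \<bar>Im (s + 1)\<bar> \<le> norm s * norm (s + 1)" by (intro mult_mono abs_Im_le_cmod) auto
  then show ?thesis by (simp add: norm_mult power2_eq_square)
qed

lemma perron_kernel_integrable:
  assumes y: "y > 0" and c: "c > - 1" "c \<noteq> 0"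
  shows "integrable lborel (\<lambda>t. perron_kernel y (Complex c t))"
proof -
  let ?S = "{s. Re s = c}"
  have nz: "s \<noteq> 0" "s + 1 \<noteq> 0" if "Re s = c" for s
    using that c by (auto simp: complex_eq_iff)
  have hol: "perron_kernel y holomorphic_on ?S"
    unfolding perron_kernel_def using nz by (intro holomorphic_intros powr_of_real_holomorphic y) auto
  have "\<exists>C'. \<forall>s. c \<le> Re s \<longrightarrow> Re s \<le> c \<longrightarrow> norm (perron_kernel y s) \<le> C' * (1 + \<bar>Im s\<bar>) powr (- 1 - 1 / 2)"
  proof (rule quadratic_decay_bound)
    have "{s. c \<le> Re s \<and> Re s \<le> c} = ?S" by auto
    then show "continuous_on {s. c \<le> Re s \<and> Re s \<le> c} (perron_kernel y)"
      using holomorphic_on_imp_continuous_on[OF hol] by simp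
    fix s assume s: "c \<le> Re s" "Re s \<le> c" "\<bar>Im s\<bar> \<ge> 1"
    then have "0 < \<bar>Im s\<bar>\<^sup>2" by simp
    then show "norm (perron_kernel y s) \<le> (y powr (c + 1) + y powr (c + 1)) / \<bar>Im s\<bar>\<^sup>2"
      unfolding perron_kernel_def norm_divide
      using powr_strip_bound[OF y s(1,2)] norm_product_ge_Im_square[of s] by (intro frac_le) auto
  qed
  then obtain C where C: "\<And>s. Re s = c \<Longrightarrow> norm (perron_kernel y s) \<le> C * (1 + \<bar>Im s\<bar>) powr (- 1 - 1 / 2)"
    by auto
  show ?thesis
    by (rule line_integrable[OF hol, where C = C and \<eta> = "1 / 2"]) (use C[of "Complex c _"] in auto)
qed

text \<open>The line is moved to the right without meeting a pole. For \<open>y \<le> 1\<close> the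
  power stays bounded by 1, and the denominator makes the integral tend to 0.\<close>

lemma perron_kernel_zero:
  assumes y: "0 < y" "y \<le> 1" and c: "c > 0"
  shows "(LINT t|lborel. perron_kernel y (Complex c t)) = 0"
proof -
  let ?I = "\<lambda>b. LINT t|lborel. perron_kernel y (Complex b t)"
  let ?J = "LINT t|lborel. (1 + \<bar>t\<bar>) powr (- 1 - 1 / 2)"
  have shift: "?I c = ?I b" if b: "c \<le> b" for b
  proof -
    have hol: "perron_kernel y holomorphic_on {s. 0 < Re s}"
    proof -
      have "s * (s + 1) \<noteq> 0" if "0 < Re s" for s
      proof -
        have "s \<noteq> 0" "s + 1 \<noteq> 0" using that by (auto simp: complex_eq_iff)
        then show ?thesis by simp
      qed
      then show ?thesis
        unfolding perron_kernel_def by (intro holomorphic_intros powr_of_real_holomorphic y) auto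
    qed
    have "\<exists>C'. \<forall>s. c \<le> Re s \<longrightarrow> Re s \<le> b \<longrightarrow> norm (perron_kernel y s) \<le> C' * (1 + \<bar>Im s\<bar>) powr (- 1 - 1 / 2)"
    proof (rule quadratic_decay_bound)
      show "continuous_on {s. c \<le> Re s \<and> Re s \<le> b} (perron_kernel y)"
        using c by (intro continuous_on_subset[OF holomorphic_on_imp_continuous_on[OF hol]]) auto
      fix s assume s: "c \<le> Re s" "Re s \<le> b" "\<bar>Im s\<bar> \<ge> 1"
      then have "0 < \<bar>Im s\<bar>\<^sup>2" by simp
      then show "norm (perron_kernel y s) \<le> (y powr (c + 1) + y powr (b + 1)) / \<bar>Im s\<bar>\<^sup>2"
        unfolding perron_kernel_def norm_divide
        using powr_strip_bound[OF y(1) s(1,2)] norm_product_ge_Im_square[of s] by (intro frac_le) auto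
    qed
    then obtain C where C: "\<And>s. c \<le> Re s \<Longrightarrow> Re s \<le> b \<Longrightarrow> norm (perron_kernel y s) \<le> C * (1 + \<bar>Im s\<bar>) powr (- 1 - 1 / 2)"
      by auto
    show ?thesis
      by (rule vertical_line_shift[OF b open_halfspace_Re_gt convex_halfspace_Re_gt _ hol C]) (use c in auto)
  qed
  have bound: "norm (?I b) \<le> (2 powr (3 / 2) * b powr (- 1 / 2)) * ?J" if b: "b \<ge> 1" for b
  proof -
    have "norm (?I b) \<le> (LINT t|lborel. (2 powr (3 / 2) * b powr (- 1 / 2)) * (1 + \<bar>t\<bar>) powr (- 1 - 1 / 2))"
    proof (rule Bochner_Integration.integral_norm_bound_integral)
      show "integrable lborel (\<lambda>t. perron_kernel y (Complex b t))"
        using b by (intro perron_kernel_integrable y) auto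
      show "integrable lborel (\<lambda>t. (2 powr (3 / 2) * b powr (- 1 / 2)) * (1 + \<bar>t\<bar>) powr (- 1 - 1 / 2))"
        by (intro integrable_mult_right integrable_one_plus_abs_powr) simp
      fix t :: real
      define s where "s = Complex b t"
      define N where "N = norm s"
      have N: "N \<ge> b" "N \<ge> \<bar>t\<bar>" using abs_Re_le_cmod[of s] abs_Im_le_cmod[of s] by (auto simp: N_def s_def)
      then have N0: "N > 0" "N \<ge> (1 + \<bar>t\<bar>) / 2" using b by auto
      have N1: "N \<le> norm (s + 1)"
        unfolding N_def cmod_def using b by (intro real_sqrt_le_mono add_right_mono power_mono) (auto simp: s_def)
      have "norm (perron_kernel y s) \<le> 1 / (N * N)"
        unfolding perron_kernel_def norm_divide norm_mult
      proof (rule frac_le)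
        have "y powr (b + 1) \<le> 1 powr (b + 1)" using y b by (intro powr_mono2) auto
        then show "norm (complex_of_real y powr (s + 1)) \<le> 1"
          using y by (simp add: norm_powr_of_real_pos s_def)
        show "N * N \<le> norm s * norm (s + 1)" using N1 N0 by (intro mult_mono) (auto simp: N_def)
      qed (use N0 in auto)
      \<comment> \<open>The inverse square is split: three quarters of the exponent keep the
        integrand integrable in \<open>t\<close>, the rest yields the decay
        \<open>b powr (- 1 / 2)\<close>.\<close>
      also have "1 / (N * N) = N powr (- 1 / 2) * N powr (- 3 / 2)"
      proof -
        have "N powr (- 1 / 2) * N powr (- 3 / 2) = N powr (- 2)"
          unfolding powr_add [symmetric] by (rule arg_cong) simp
        also have "\<dots> = inverse (N ^ 2)" using N0(1) by (simp only: powr_minus powr_numeral)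
        finally have e: "N powr (- 1 / 2) * N powr (- 3 / 2) = inverse (N ^ 2)" .
        show ?thesis unfolding e by (simp only: power2_eq_square inverse_eq_divide)
      qed
      also have "\<dots> \<le> b powr (- 1 / 2) * ((1 + \<bar>t\<bar>) / 2) powr (- 3 / 2)"
      proof (rule mult_mono)
        show "N powr (- 1 / 2) \<le> b powr (- 1 / 2)" using N(1) b by (intro powr_mono2'[OF _ _ N(1)]; linarith)
        show "N powr (- 3 / 2) \<le> ((1 + \<bar>t\<bar>) / 2) powr (- 3 / 2)" by (rule powr_mono2'[OF _ _ N0(2)]) (simp_all add: add_pos_nonneg)
      qed auto
      also have "((1 + \<bar>t\<bar>) / 2) powr (- 3 / 2) = (1 + \<bar>t\<bar>) powr (- 3 / 2) * 2 powr (3 / 2)"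
      proof -
        have "((1 + \<bar>t\<bar>) / 2) powr (- 3 / 2) = (1 + \<bar>t\<bar>) powr (- 3 / 2) / 2 powr (- 3 / 2)"
          by (rule powr_divide)
        also have "(2 :: real) powr (- 3 / 2) = inverse (2 powr (3 / 2))"
          using powr_minus[of "2 :: real" "3 / 2"] by simp
        finally show ?thesis by (simp only: divide_inverse inverse_inverse_eq)
      qed
      also have "(- 3 / 2 :: real) = - 1 - 1 / 2" by simp
      finally show "norm (perron_kernel y (Complex b t)) \<le> (2 powr (3 / 2) * b powr (- 1 / 2)) * (1 + \<bar>t\<bar>) powr (- 1 - 1 / 2)"
        by (simp add: s_def mult_ac)
    qed
    then show ?thesis by simp
  qed
  have "(\<lambda>n. (2 powr (3 / 2) * real n powr (- 1 / 2)) * ?J) \<longlonglongrightarrow> (2 powr (3 / 2) * 0) * ?J"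
    by (intro tendsto_intros tendsto_neg_powr filterlim_real_sequentially) auto
  moreover have "\<forall>\<^sub>F n in sequentially. norm (?I c) \<le> (2 powr (3 / 2) * real n powr (- 1 / 2)) * ?J"
    using eventually_ge_at_top[of "nat \<lceil>max 1 c\<rceil>"]
  proof eventually_elim
    case (elim n)
    then have "max 1 c \<le> real n" by linarith
    then show ?case using shift[of "real n"] bound[of "real n"] by simp
  qed
  ultimately have "norm (?I c) \<le> (2 powr (3 / 2) * 0) * ?J"
    by (rule tendsto_lowerbound) simp
  then show ?thesis by simp
qed

text \<open>At \<open>s = 0\<close> the kernels for \<open>y\<close> and for 1 have residues
  \<open>y\<close> and 1, so \<open>perron_kernel y - y * perron_kernel 1\<close> extends
  holomorphically across 0 and its line can be moved. On the right-hand line the kernel for 1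
  integrates to 0 by \<open>perron_kernel_zero\<close>.\<close>

lemma perron_kernel_cross_pole:
  assumes y: "0 < y" and c: "c > 0"
  shows "(LINT t|lborel. perron_kernel y (Complex c t)) =
    (LINT t|lborel. perron_kernel y (Complex (- 1 / 2) t)) - of_real y * (LINT t|lborel. perron_kernel 1 (Complex (- 1 / 2) t))"
proof -
  define g where "g = (\<lambda>s. complex_of_real y powr (s + 1) - of_real y)"
  \<comment> \<open>The numerator \<open>g\<close> vanishes at 0; dividing by \<open>s\<close> and
    inserting the derivative at 0 removes the singularity.\<close>
  define Q where "Q = (\<lambda>s. if s = 0 then deriv g 0 else g s / s)"
  define D where "D = (\<lambda>s. Q s / (s + 1))"
  have gh: "g holomorphic_on UNIV"
    unfolding g_def by (intro holomorphic_intros powr_of_real_holomorphic y)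
  have Qh: "Q holomorphic_on UNIV"
    by (rule pole_theorem_open_0[OF gh]) (auto simp: Q_def g_def)
  have hol: "D holomorphic_on {s. - 1 < Re s}"
    unfolding D_def by (intro holomorphic_intros holomorphic_on_subset[OF Qh]) (auto simp: complex_eq_iff)
  have Deq: "D s = perron_kernel y s - of_real y * perron_kernel 1 s" if "s \<noteq> 0" for s
    using that by (simp add: D_def Q_def g_def perron_kernel_def diff_divide_distrib)
  have cb: "- 1 / 2 \<le> c" using c by simp
  have "\<exists>C'. \<forall>s. - 1 / 2 \<le> Re s \<longrightarrow> Re s \<le> c \<longrightarrow> norm (D s) \<le> C' * (1 + \<bar>Im s\<bar>) powr (- 1 - 1 / 2)"
  proof (rule quadratic_decay_bound)
    show "continuous_on {s. - 1 / 2 \<le> Re s \<and> Re s \<le> c} D"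
      by (intro continuous_on_subset[OF holomorphic_on_imp_continuous_on[OF hol]]) auto
    fix s assume s: "- 1 / 2 \<le> Re s" "Re s \<le> c" "\<bar>Im s\<bar> \<ge> 1"
    then have pos: "0 < \<bar>Im s\<bar>\<^sup>2" by simp
    have "s \<noteq> 0" using s by auto
    then have "D s = g s / (s * (s + 1))" by (simp add: D_def Q_def)
    also have "norm \<dots> \<le> (y powr (- 1 / 2 + 1) + y powr (c + 1) + y) / \<bar>Im s\<bar>\<^sup>2"
      unfolding norm_divide
    proof (rule frac_le)
      have "norm (g s) \<le> norm (complex_of_real y powr (s + 1)) + norm (complex_of_real y)"
        unfolding g_def by (rule norm_triangle_ineq4)
      then show "norm (g s) \<le> y powr (- 1 / 2 + 1) + y powr (c + 1) + y"
        using powr_strip_bound[OF y s(1,2)] y by simp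
    qed (use pos norm_product_ge_Im_square[of s] y in auto)
    finally show "norm (D s) \<le> (y powr (- 1 / 2 + 1) + y powr (c + 1) + y) / \<bar>Im s\<bar>\<^sup>2" .
  qed
  then obtain C where C: "\<And>s. - 1 / 2 \<le> Re s \<Longrightarrow> Re s \<le> c \<Longrightarrow> norm (D s) \<le> C * (1 + \<bar>Im s\<bar>) powr (- 1 - 1 / 2)"
    by auto
  have "(LINT t|lborel. D (Complex (- 1 / 2) t)) = (LINT t|lborel. D (Complex c t))"
    by (rule vertical_line_shift[OF cb open_halfspace_Re_gt convex_halfspace_Re_gt _ hol C]) auto
  moreover have "(LINT t|lborel. D (Complex u t)) = (LINT t|lborel. perron_kernel y (Complex u t)) - of_real y * (LINT t|lborel. perron_kernel 1 (Complex u t))"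
    if u: "u > - 1" "u \<noteq> 0" for u
  proof -
    have "D (Complex u t) = perron_kernel y (Complex u t) - of_real y * perron_kernel 1 (Complex u t)" for t
      using u by (intro Deq) (auto simp: complex_eq_iff)
    then show ?thesis
      using perron_kernel_integrable[OF y u] perron_kernel_integrable[of 1 u] u by simp
  qed
  moreover have "(LINT t|lborel. perron_kernel 1 (Complex c t)) = 0"
    by (rule perron_kernel_zero) (use c in auto)
  ultimately show ?thesis using c by simp
qed

text \<open>Its value is \<open>2 * pi\<close>, but only positivity matters.\<close>

definition perron_const :: real where
  "perron_const = (LINT t|lborel. 1 / (1 / 4 + t\<^sup>2))"

lemma perron_kernel_half:
  "perron_kernel 1 (Complex (- 1 / 2) t) = - of_real (1 / (1 / 4 + t\<^sup>2))"
proof -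
  have "Complex (- 1 / 2) t * (Complex (- 1 / 2) t + 1) = - of_real (1 / 4 + t\<^sup>2)"
    by (simp add: complex_eq_iff power2_eq_square)
  moreover have "1 / (- complex_of_real d) = - of_real (1 / d)" for d by simp
  ultimately show ?thesis by (simp only: perron_kernel_def powr_one_eq_one of_real_1)
qed

lemma perron_const_pos: "perron_const > 0"
  and perron_const_eq: "(LINT t|lborel. perron_kernel 1 (Complex (- 1 / 2) t)) = - of_real perron_const"
proof -
  have int: "integrable lborel (\<lambda>t :: real. 1 / (1 / 4 + t\<^sup>2))"
  proof -
    have "integrable lborel (\<lambda>t. perron_kernel 1 (Complex (- 1 / 2) t))"
      by (rule perron_kernel_integrable) auto
    then have "integrable lborel (\<lambda>t. - complex_of_real (1 / (1 / 4 + t\<^sup>2)))"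
      unfolding perron_kernel_half .
    from integrable_minus[OF this] have "integrable lborel (\<lambda>t. complex_of_real (1 / (1 / 4 + t\<^sup>2)))"
      by (simp only: minus_minus)
    then show ?thesis by (simp only: complex_of_real_integrable_eq)
  qed
  show "(LINT t|lborel. perron_kernel 1 (Complex (- 1 / 2) t)) = - of_real perron_const"
    unfolding perron_kernel_half perron_const_def integral_minus integral_complex_of_real ..
  have "(LINT t|lborel. indicator {0..1 :: real} t *\<^sub>R (4 / 5 :: real)) \<le> perron_const"
    unfolding perron_const_def
  proof (rule integral_mono[OF _ int])
    fix t :: real
    show "indicator {0..1} t *\<^sub>R (4 / 5 :: real) \<le> 1 / (1 / 4 + t\<^sup>2)"
    proof (cases "t \<in> {0..1}")
      case True
      then have "t\<^sup>2 \<le> 1" by (simp add: power_le_one)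
      then have "1 / (5 / 4) \<le> 1 / (1 / 4 + t\<^sup>2)"
        by (intro divide_left_mono mult_pos_pos add_pos_nonneg) auto
      then show ?thesis using True by simp
    qed (simp add: add_nonneg_nonneg)
  qed simp
  then show "perron_const > 0" by simp
qed

text \<open>The substitution \<open>s \<mapsto> - 1 - s\<close> preserves the line of real part
  \<open>- 1 / 2\<close> and the denominator, and turns the kernel for \<open>y\<close> into
  \<open>y\<close> times the kernel for \<open>1 / y\<close>. Hence for \<open>y > 1\<close> the
  integral over that line is known from the case \<open>1 / y < 1\<close>, and crossing the pole
  yields the value to the right of 0.\<close>

lemma perron_kernel_integral:
  assumes y: "y > 0" and c: "c > 0"
  shows "(LINT t|lborel. perron_kernel y (Complex c t)) = of_real (perron_const * max 0 (y - 1))"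
proof (cases "y \<le> 1")
  case True
  then show ?thesis using perron_kernel_zero[OF y _ c] by simp
next
  case False
  let ?J = "\<lambda>y. LINT t|lborel. perron_kernel y (Complex (- 1 / 2) t)"
  have y': "0 < 1 / y" "1 / y \<le> 1" using False by auto
  \<comment> \<open>To the right of 0 the integral for \<open>1 / y\<close> vanishes, so crossing
    the pole determines its value on the line \<open>- 1 / 2\<close>.\<close>
  have J1: "?J (1 / y) = of_real (1 / y) * ?J 1"
    using perron_kernel_zero[OF y' c] perron_kernel_cross_pole[OF y'(1) c] by simp
  have "?J y = (LINT t|lborel. perron_kernel y (Complex (- 1 / 2) (0 + (- 1) * t)))"
    using lborel_integral_real_affine[of "-1" "\<lambda>t. perron_kernel y (Complex (- 1 / 2) t)" 0] by simp
  also have "\<dots> = (LINT t|lborel. of_real y * perron_kernel (1 / y) (Complex (- 1 / 2) t))"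
  proof (rule Bochner_Integration.integral_cong)
    fix t :: real
    define s where "s = Complex (- 1 / 2) t"
    have s': "Complex (- 1 / 2) (0 + (- 1) * t) = - 1 - s" by (simp add: s_def complex_eq_iff)
    have "complex_of_real y powr (- 1 - s + 1) = of_real y * of_real (1 / y) powr (s + 1)"
    proof -
      have "of_real y * of_real (1 / y) powr (s + 1) = exp (of_real (ln y)) * exp ((s + 1) * of_real (ln (1 / y)))"
        using powr_of_real_pos[OF y'(1), of "s + 1"] y by (simp add: exp_of_real)
      also have "\<dots> = exp ((- 1 - s + 1) * of_real (ln y))"
        using y by (simp add: ln_div exp_add [symmetric] algebra_simps)
      finally show ?thesis using powr_of_real_pos[OF y] by simp
    qed
    moreover have "(- 1 - s) * (- 1 - s + 1) = s * (s + 1)" by (simp add: algebra_simps)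
    ultimately show "perron_kernel y (Complex (- 1 / 2) (0 + (- 1) * t)) = of_real y * perron_kernel (1 / y) (Complex (- 1 / 2) t)"
      unfolding s' s_def [symmetric] perron_kernel_def by simp
  qed simp
  also have "\<dots> = of_real y * ?J (1 / y)" by simp
  also have "\<dots> = ?J 1" unfolding J1 using y by simp
  finally have "?J y = ?J 1" .
  then show ?thesis using perron_kernel_cross_pole[OF y c] False perron_const_eq
    by (simp add: algebra_simps)
qed

section \<open>Partial sums of the Moebius function\<close>

definition moebius_harmonic :: "nat \<Rightarrow> real" where
  "moebius_harmonic n = (\<Sum>k<n. moebius (Suc k) / real (Suc k))"

lemma sum_positive_part:
  "(\<lambda>k. moebius (Suc k) * max 0 (real n / real (Suc k) - 1)) sums
    (\<Sum>k<n. moebius (Suc k) * (real n / real (Suc k) - 1))"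
proof -
  have "(\<lambda>k. moebius (Suc k) * max 0 (real n / real (Suc k) - 1)) sums
    (\<Sum>k<n. moebius (Suc k) * max 0 (real n / real (Suc k) - 1))"
    by (rule sums_finite) (auto simp: divide_le_eq_1 max_def field_simps)
  also have "(\<Sum>k<n. moebius (Suc k) * max 0 (real n / real (Suc k) - 1)) = (\<Sum>k<n. moebius (Suc k) * (real n / real (Suc k) - 1))"
    by (rule sum.cong) (auto simp: max_def field_simps)
  finally show ?thesis .
qed

text \<open>Away from 0 this is \<open>perron_kernel x s\<close> divided by zeta at
  \<open>1 + s\<close>. Written with \<open>zeta_reg\<close> it is regular at 0 as well.\<close>

definition smoothed_kernel :: "real \<Rightarrow> complex \<Rightarrow> complex" where
  "smoothed_kernel x s = of_real x powr (s + 1) / ((s + 1) * zeta_reg s)"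

text \<open>On the line \<open>Re s = 1\<close> the Dirichlet series of the reciprocal of zeta at
  \<open>1 + s\<close> converges absolutely, and its terms turn the kernel for \<open>n\<close> into
  dilated kernels whose integrals are known.\<close>

lemma perron_formula:
  assumes n: "n > 0"
  shows "(LINT t|lborel. smoothed_kernel (real n) (Complex 1 t)) =
    of_real (perron_const * (\<Sum>k<n. moebius (Suc k) * (real n / real (Suc k) - 1)))"
proof -
  let ?f = "\<lambda>k t. of_real (moebius (Suc k)) * perron_kernel (real n / real (Suc k)) (Complex 1 t)"
  let ?D = "\<lambda>t. real n ^ 2 * norm (perron_kernel 1 (Complex 1 t))"
  have y: "real n / real (Suc k) > 0" for k using n by simp
  have int: "integrable lborel (?f k)" for k
    by (intro integrable_mult_right perron_kernel_integrable y) auto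
  have D: "integrable lborel ?D"
    by (intro integrable_mult_right integrable_norm perron_kernel_integrable) auto
  have dil: "perron_kernel (real n / real (Suc k)) s = of_real (real n) powr (s + 1) * of_nat (Suc k) powr (- (1 + s)) / (s * (s + 1))" for k s
  proof -
    have "complex_of_real (real n / real (Suc k)) powr (s + 1) = of_real (real n) powr (s + 1) * of_nat (Suc k) powr (- (1 + s))"
      using powr_of_real_pos[OF y[of k], of "s + 1"] powr_of_real_pos[of "real n" "s + 1"] powr_of_real_pos[of "real (Suc k)" "- (1 + s)"] n
      by (simp add: ln_div exp_add [symmetric] algebra_simps del: of_nat_Suc)
    then show ?thesis by (simp only: perron_kernel_def)
  qed
  \<comment> \<open>The dilation contributes the power \<open>- 2\<close> of \<open>k + 1\<close>,
    which makes both the pointwise series and the series of norms converge.\<close>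
  have nb: "norm (?f k t) \<le> ?D t * real (Suc k) powr (- 2)" for k t
  proof -
    have "norm (?f k t) \<le> 1 * norm (perron_kernel (real n / real (Suc k)) (Complex 1 t))"
      unfolding norm_mult using abs_moebius_le[of "Suc k"] by (intro mult_right_mono) auto
    also have "norm (perron_kernel (real n / real (Suc k)) (Complex 1 t)) = ?D t * real (Suc k) powr (- 2)"
    proof -
      have "norm (complex_of_real (real n) powr (Complex 1 t + 1)) = real n ^ 2"
        using n norm_powr_of_real_pos[of "real n" "Complex 1 t + 1"] by (simp add: powr_numeral)
      moreover have "norm (complex_of_nat (Suc k) powr (- (1 + Complex 1 t))) = real (Suc k) powr (- 2)"
        unfolding norm_of_nat_Suc_powr by simp
      ultimately show ?thesis unfolding dil by (simp add: norm_mult norm_divide perron_kernel_def del: of_nat_Suc)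
    qed
    finally show ?thesis by simp
  qed
  have summ2: "summable (\<lambda>k. real (Suc k) powr (- 2))" by (rule summable_Suc_powr) simp
  have AEs: "AE t in lborel. summable (\<lambda>k. norm (?f k t))"
  proof (rule AE_I2)
    fix t :: real
    show "summable (\<lambda>k. norm (?f k t))"
      by (rule summable_comparison_test'[OF summable_mult[OF summ2, of "?D t"], where N = 0]) (simp only: real_norm_def abs_norm_cancel nb)
  qed
  have summ: "summable (\<lambda>k. LINT t|lborel. norm (?f k t))"
  proof (rule summable_comparison_test'[OF summable_mult[OF summ2], where N = 0])
    fix k
    have "(LINT t|lborel. norm (?f k t)) \<le> (LINT t|lborel. ?D t * real (Suc k) powr (- 2))"
      by (intro integral_mono integrable_norm int integrable_mult_left D nb)
    then show "norm (LINT t|lborel. norm (?f k t)) \<le> integral\<^sup>L lborel ?D * real (Suc k) powr (- 2)"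
      by (simp add: Bochner_Integration.integral_nonneg)
  qed
  have val: "integral\<^sup>L lborel (?f k) = of_real (perron_const * (moebius (Suc k) * max 0 (real n / real (Suc k) - 1)))" for k
  proof -
    have "integral\<^sup>L lborel (?f k) = of_real (moebius (Suc k)) * of_real (perron_const * max 0 (real n / real (Suc k) - 1))"
      unfolding integral_mult_right_zero by (subst perron_kernel_integral[OF y]) auto
    then show ?thesis by (simp only: of_real_mult mult_ac)
  qed
  have "(LINT t|lborel. smoothed_kernel (real n) (Complex 1 t)) = (LINT t|lborel. (\<Sum>k. ?f k t))"
  proof (rule Bochner_Integration.integral_cong)
    fix t :: real
    define s where "s = Complex 1 t"
    have s: "Re (1 + s) > 1" "s \<noteq> 0" by (auto simp: s_def complex_eq_iff)
    have "(\<lambda>k. of_real (moebius (Suc k)) * of_nat (Suc k) powr (- (1 + s)) * (of_real (real n) powr (s + 1) / (s * (s + 1))))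
      sums (1 / riemann_zeta (1 + s) * (of_real (real n) powr (s + 1) / (s * (s + 1))))"
      by (intro sums_mult2 moebius_sums s)
    also have "(\<lambda>k. of_real (moebius (Suc k)) * of_nat (Suc k) powr (- (1 + s)) * (of_real (real n) powr (s + 1) / (s * (s + 1)))) = (\<lambda>k. ?f k t)"
      unfolding dil s_def by (simp add: mult_ac)
    finally have "(\<Sum>k. ?f k t) = 1 / riemann_zeta (1 + s) * (of_real (real n) powr (s + 1) / (s * (s + 1)))"
      by (rule sums_unique [symmetric])
    also have "\<dots> = smoothed_kernel (real n) s"
      unfolding smoothed_kernel_def using zeta_reg_eq[of s] s by (simp add: s_def mult_ac)
    finally show "smoothed_kernel (real n) (Complex 1 t) = (\<Sum>k. ?f k t)" by (simp add: s_def)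
  qed simp
  also have "\<dots> = (\<Sum>k. integral\<^sup>L lborel (?f k))"
    by (rule integral_suminf[where f = ?f, OF int AEs summ])
  also have "\<dots> = (\<Sum>k. complex_of_real (perron_const * (moebius (Suc k) * max 0 (real n / real (Suc k) - 1))))"
    by (simp only: val)
  also have "(\<Sum>k. complex_of_real (perron_const * (moebius (Suc k) * max 0 (real n / real (Suc k) - 1)))) =
      of_real (perron_const * (\<Sum>k<n. moebius (Suc k) * (real n / real (Suc k) - 1)))"
    by (rule sums_unique [symmetric], rule sums_of_real, rule sums_mult, rule sum_positive_part)
  finally show ?thesis .
qed

text \<open>
  Consecutive values of the smoothed sum differ by exactly one value of the sharp sum, so that no
  truncated Perron formula is needed.
\<close>

lemma smoothed_difference:
  "(\<Sum>k<Suc n. moebius (Suc k) * (real (Suc n) / real (Suc k) - 1)) -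
    (\<Sum>k<n. moebius (Suc k) * (real n / real (Suc k) - 1)) = moebius_harmonic n"
proof -
  have "(\<Sum>k<Suc n. moebius (Suc k) * (real (Suc n) / real (Suc k) - 1)) =
      (\<Sum>k<n. moebius (Suc k) * (real (Suc n) / real (Suc k) - 1))" by simp
  then have "(\<Sum>k<Suc n. moebius (Suc k) * (real (Suc n) / real (Suc k) - 1)) -
    (\<Sum>k<n. moebius (Suc k) * (real n / real (Suc k) - 1)) =
    (\<Sum>k<n. moebius (Suc k) * (real (Suc n) / real (Suc k) - 1) - moebius (Suc k) * (real n / real (Suc k) - 1))"
    by (simp only: sum_subtractf)
  also have "\<dots> = moebius_harmonic n"
    unfolding moebius_harmonic_def
  proof (rule sum.cong)
    fix k
    have "a * ((c + 1) / b - 1) - a * (c / b - 1) = a / b" for a b c :: real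
      by (simp add: algebra_simps add_divide_distrib)
    from this[of _ "real n"] show "moebius (Suc k) * (real (Suc n) / real (Suc k) - 1) - moebius (Suc k) * (real n / real (Suc k) - 1) = moebius (Suc k) / real (Suc k)"
      by (simp add: add.commute[of 1])
  qed simp
  finally show ?thesis .
qed

text \<open>The mean value theorem bounds the quotient by \<open>real n powr Re s\<close>, the
  triangle inequality by that times \<open>X = 4 * real n / norm (s + 1)\<close>; and
  \<open>min 1 X \<le> X powr \<theta>\<close>. A small \<open>\<theta>\<close> loses only
  \<open>n powr \<theta>\<close> but gains enough decay in \<open>s\<close> for the integral against
  \<open>1 / zeta_reg s\<close> to converge.\<close>

lemma powr_increment_bound:
  fixes s :: complex
  assumes n: "n > 0" and s: "- 1 < Re s" "Re s \<le> 0" and \<theta>: "0 \<le> \<theta>" "\<theta> \<le> 1"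
  shows "norm ((of_real (real (Suc n)) powr (s + 1) - of_real (real n) powr (s + 1)) / (s + 1)) \<le>
    real n powr (Re s) * (4 * real n / norm (s + 1)) powr \<theta>"
proof -
  let ?d = "of_real (real (Suc n)) powr (s + 1) - complex_of_real (real n) powr (s + 1)"
  define N where "N = norm (s + 1)"
  have N: "N > 0" using s by (auto simp: N_def complex_eq_iff)
  have n1: "real n \<ge> 1" using n by simp
  have seg: "\<exists>x. z = of_real x \<and> real n \<le> x" if "z \<in> closed_segment (complex_of_real (real n)) (of_real (real (Suc n)))" for z
    using that unfolding closed_segment_of_real by (auto simp: closed_segment_eq_real_ivl)
  have "norm ?d \<le> (N * real n powr (Re s)) * norm (complex_of_real (real (Suc n)) - of_real (real n))"
  proof (rule field_differentiable_bound[of "closed_segment (complex_of_real (real n)) (of_real (real (Suc n)))"])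
    fix z assume "z \<in> closed_segment (complex_of_real (real n)) (of_real (real (Suc n)))"
    then obtain x where x: "z = of_real x" "real n \<le> x" using seg by blast
    then have "x > 0" using n1 by linarith
    then show "((\<lambda>z. z powr (s + 1)) has_field_derivative (s + 1) * z powr (s + 1 - 1)) (at z within closed_segment (complex_of_real (real n)) (of_real (real (Suc n))))"
      using x by (intro has_field_derivative_powr has_field_derivative_at_within) (auto simp: complex_nonpos_Reals_iff)
    have "x powr (Re s) \<le> real n powr (Re s)" using x n1 s by (intro powr_mono2') auto
    then show "norm ((s + 1) * z powr (s + 1 - 1)) \<le> N * real n powr (Re s)"
      using \<open>x > 0\<close> x N by (simp add: norm_mult norm_powr_of_real_pos N_def mult_left_mono)
  qed auto
  then have a: "norm ?d / N \<le> real n powr (Re s)" using N by (simp add: field_simps)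
  have "norm ?d \<le> norm (complex_of_real (real (Suc n)) powr (s + 1)) + norm (complex_of_real (real n) powr (s + 1))"
    by (rule norm_triangle_ineq4)
  also have "\<dots> = real (Suc n) powr (Re s + 1) + real n powr (Re s + 1)"
    using n norm_powr_of_real_pos[of "real (Suc n)" "s + 1"] norm_powr_of_real_pos[of "real n" "s + 1"]
    by (simp del: of_nat_Suc)
  also have "real (Suc n) powr (Re s + 1) \<le> (2 * real n) powr (Re s + 1)"
    using s n1 by (intro powr_mono2) auto
  also have "(2 * real n) powr (Re s + 1) = 2 powr (Re s + 1) * real n powr (Re s + 1)"
    by (rule powr_mult)
  also have "(2 :: real) powr (Re s + 1) \<le> 2 powr 1" using s by (intro powr_mono) auto
  finally have "norm ?d \<le> 2 powr 1 * real n powr (Re s + 1) + real n powr (Re s + 1)"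
    by (simp add: mult_right_mono)
  also have "\<dots> \<le> 4 * (real n powr (Re s) * real n)" using n1 by (simp add: powr_add)
  finally have b: "norm ?d / N \<le> real n powr (Re s) * (4 * real n / N)"
    using N by (simp add: field_simps)
  define X where "X = 4 * real n / N"
  have X: "X > 0" using N n by (simp add: X_def)
  have "norm ?d / N \<le> real n powr (Re s) * X powr \<theta>"
  proof (cases "X \<ge> 1")
    case True
    then have "1 \<le> X powr \<theta>" using \<theta> by (intro ge_one_powr_ge_zero) auto
    then have "real n powr (Re s) * 1 \<le> real n powr (Re s) * X powr \<theta>" by (intro mult_left_mono) auto
    then show ?thesis using a by linarith
  next
    case False
    then have "X powr 1 \<le> X powr \<theta>" using X \<theta> by (intro powr_mono') auto
    then have "real n powr (Re s) * X \<le> real n powr (Re s) * X powr \<theta>" using X by (intro mult_left_mono) auto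
    then show ?thesis using b by (simp add: X_def)
  qed
  then show ?thesis by (simp add: norm_divide N_def X_def)
qed

lemma moebius_harmonic_bound:
  assumes nz: "\<And>s. Re s > 1 / 2 \<Longrightarrow> s \<noteq> 1 \<Longrightarrow> riemann_zeta s \<noteq> 0"
    and e: "0 < e" "e < 1"
  shows "\<exists>C. \<forall>n>0. \<bar>moebius_harmonic n\<bar> \<le> C * real n powr (- 1 / 2 + e)"
proof -
  \<comment> \<open>The loss \<open>e\<close> in the exponent of \<open>n\<close> is shared equally
    between the distance of the line from \<open>- 1 / 2\<close> and \<open>\<theta>\<close>. With
    growth \<open>e / 4\<close> allowed for the reciprocal zeta function, the integrand decays with
    exponent \<open>- 1 - e / 4\<close>.\<close>
  define a where "a = - 1 / 2 + e / 2"
  define \<theta> where "\<theta> = e / 2"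
  have a: "- 1 / 2 < a" "a \<le> 0" "a \<le> 1" using e by (auto simp: a_def)
  have \<theta>: "0 \<le> \<theta>" "\<theta> \<le> 1" using e by (auto simp: \<theta>_def)
  obtain C where C: "C > 0" "\<And>s. a \<le> Re s \<Longrightarrow> Re s \<le> 1 \<Longrightarrow> norm (1 / zeta_reg s) \<le> C * (1 + \<bar>Im s\<bar>) powr (e / 4 - 1)"
    using inverse_zeta_reg_growth[OF nz, of "e / 2" "e / 4"] e unfolding a_def by auto
  have s1: "(1 + \<bar>Im s\<bar>) / 4 \<le> norm (s + 1)" if "a \<le> Re s" for s
  proof -
    have "1 / 2 \<le> norm (s + 1)" using abs_Re_le_cmod[of "s + 1"] that a by simp
    moreover have "\<bar>Im s\<bar> \<le> norm (s + 1)" using abs_Im_le_cmod[of "s + 1"] by simp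
    ultimately show ?thesis by (simp add: field_simps)
  qed
  have hol: "smoothed_kernel x holomorphic_on {s. - 1 / 2 < Re s}" if x: "x > 0" for x
  proof -
    have "(s + 1) * zeta_reg s \<noteq> 0" if "- 1 / 2 < Re s" for s
    proof -
      have "s + 1 \<noteq> 0" using that by (auto simp: complex_eq_iff)
      then show ?thesis using zeta_reg_nonzero[OF nz that] by simp
    qed
    then show ?thesis unfolding smoothed_kernel_def
      by (intro holomorphic_intros powr_of_real_holomorphic x holomorphic_on_subset[OF zeta_reg_holomorphic]) auto
  qed
  have bd: "norm (smoothed_kernel x s) \<le> ((x powr (a + 1) + x powr (1 + 1)) * 4 * C) * (1 + \<bar>Im s\<bar>) powr (- 1 - (1 - e / 4))"
    if x: "x > 0" and s: "a \<le> Re s" "Re s \<le> 1" for x s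
  proof -
    have "norm (smoothed_kernel x s) = norm (complex_of_real x powr (s + 1)) * (1 / norm (s + 1)) * norm (1 / zeta_reg s)"
      unfolding smoothed_kernel_def by (simp add: norm_mult norm_divide)
    also have "\<dots> \<le> (x powr (a + 1) + x powr (1 + 1)) * (4 * (1 + \<bar>Im s\<bar>) powr (- 1)) * (C * (1 + \<bar>Im s\<bar>) powr (e / 4 - 1))"
    proof (intro mult_mono powr_strip_bound x s C mult_nonneg_nonneg)
      have "1 / norm (s + 1) \<le> 1 / ((1 + \<bar>Im s\<bar>) / 4)"
        using s1[OF s(1)] by (intro divide_left_mono mult_pos_pos) (auto simp: add_pos_nonneg intro: less_le_trans[of _ "(1 + \<bar>Im s\<bar>) / 4"])
      also have "\<dots> = 4 * (1 / (1 + \<bar>Im s\<bar>))" by simp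
      also have "1 / (1 + \<bar>Im s\<bar>) = (1 + \<bar>Im s\<bar>) powr (- 1)"
        by (rule powr_neg_one [symmetric]) (simp add: add_pos_nonneg)
      finally show "1 / norm (s + 1) \<le> 4 * (1 + \<bar>Im s\<bar>) powr (- 1)" .
    qed (use C in auto)
    also have "\<dots> = ((x powr (a + 1) + x powr (1 + 1)) * 4 * C) * ((1 + \<bar>Im s\<bar>) powr (- 1) * (1 + \<bar>Im s\<bar>) powr (e / 4 - 1))"
      by (simp only: mult_ac)
    also have "(1 + \<bar>Im s\<bar>) powr (- 1) * (1 + \<bar>Im s\<bar>) powr (e / 4 - 1) = (1 + \<bar>Im s\<bar>) powr (- 1 - (1 - e / 4))"
      unfolding powr_add [symmetric] by (rule arg_cong) simp
    finally show ?thesis .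
  qed
  \<comment> \<open>No residue arises: \<open>smoothed_kernel\<close> is regular at 0, and its other
    singularities in the half-plane would be zeros of \<open>zeta_reg\<close>, which
    \<open>nz\<close> excludes.\<close>
  have shift: "(LINT t|lborel. smoothed_kernel x (Complex 1 t)) = (LINT t|lborel. smoothed_kernel x (Complex a t))"
    if x: "x > 0" for x
    by (rule vertical_line_shift[OF a(3) open_halfspace_Re_gt convex_halfspace_Re_gt _ hol[OF x] bd[OF x], symmetric])
      (use a e in auto)
  have int: "integrable lborel (\<lambda>t. smoothed_kernel x (Complex a t))" if x: "x > 0" for x
    by (rule line_integrable[OF hol[OF x], where \<eta> = "1 - e / 4"]) (use a e bd[OF x, of "Complex a _"] in auto)
  let ?J = "LINT t|lborel. (1 + \<bar>t\<bar>) powr (- 1 - e / 4)"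
  show ?thesis
  proof (intro exI[of _ "C * 16 powr \<theta> * ?J / perron_const"] allI impI)
    fix n :: nat assume n: "n > 0"
    then have x: "real n > 0" "real (Suc n) > 0" by auto
    \<comment> \<open>The differencing of the smoothed sums is carried out under the integral sign
      after the shift, where \<open>powr_increment_bound\<close> can exploit the cancellation
      between the two powers.\<close>
    have "complex_of_real (perron_const * moebius_harmonic n) =
        (LINT t|lborel. smoothed_kernel (real (Suc n)) (Complex a t)) - (LINT t|lborel. smoothed_kernel (real n) (Complex a t))"
      unfolding smoothed_difference [symmetric] shift[OF x(1), symmetric] shift[OF x(2), symmetric]
        perron_formula[OF n] perron_formula[OF zero_less_Suc] right_diff_distrib of_real_diff ..
    also have "\<dots> = (LINT t|lborel. smoothed_kernel (real (Suc n)) (Complex a t) - smoothed_kernel (real n) (Complex a t))"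
      by (rule Bochner_Integration.integral_diff [symmetric]; rule int; rule x)
    finally have eq: "complex_of_real (perron_const * moebius_harmonic n) = \<dots>" .
    have "norm (complex_of_real (perron_const * moebius_harmonic n)) \<le>
        (LINT t|lborel. (C * 16 powr \<theta> * real n powr (- 1 / 2 + e)) * (1 + \<bar>t\<bar>) powr (- 1 - e / 4))"
      unfolding eq
    proof (rule Bochner_Integration.integral_norm_bound_integral)
      show "integrable lborel (\<lambda>t. smoothed_kernel (real (Suc n)) (Complex a t) - smoothed_kernel (real n) (Complex a t))"
        by (intro Bochner_Integration.integrable_diff int x)
      show "integrable lborel (\<lambda>t. (C * 16 powr \<theta> * real n powr (- 1 / 2 + e)) * (1 + \<bar>t\<bar>) powr (- 1 - e / 4))"
        using e by (intro integrable_mult_right integrable_one_plus_abs_powr) auto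
      fix t :: real
      define s where "s = Complex a t"
      have s: "Re s = a" "Im s = t" by (auto simp: s_def)
      have "smoothed_kernel (real (Suc n)) s - smoothed_kernel (real n) s =
          ((of_real (real (Suc n)) powr (s + 1) - of_real (real n) powr (s + 1)) / (s + 1)) * (1 / zeta_reg s)"
        unfolding smoothed_kernel_def by (simp add: diff_divide_distrib)
      also have "norm \<dots> \<le> (real n powr a * (16 * real n / (1 + \<bar>t\<bar>)) powr \<theta>) * (C * (1 + \<bar>t\<bar>) powr (e / 4 - 1))"
        unfolding norm_mult
      proof (rule mult_mono)
        have "norm ((of_real (real (Suc n)) powr (s + 1) - complex_of_real (real n) powr (s + 1)) / (s + 1)) \<le> real n powr a * (4 * real n / norm (s + 1)) powr \<theta>"
          using powr_increment_bound[OF n, of s \<theta>] a \<theta> by (simp only: s)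
        \<comment> \<open>The lower bound \<open>(1 + \<bar>t\<bar>) / 4\<close> for the denominator
          together with the 4 already present gives the 16 of the final constant.\<close>
        also have "\<dots> \<le> real n powr a * (4 * real n / ((1 + \<bar>t\<bar>) / 4)) powr \<theta>"
        proof (intro mult_left_mono powr_mono2 divide_left_mono mult_pos_pos)
          have *: "(1 + \<bar>t\<bar>) / 4 \<le> norm (s + 1)" using s1[of s] by (simp add: s)
          then show "(1 + \<bar>t\<bar>) / 4 \<le> norm (s + 1)" .
          have "0 < (1 + \<bar>t\<bar>) / 4" by (simp add: add_pos_nonneg)
          with * show "0 < norm (s + 1)" by linarith
        qed (use \<theta> in \<open>auto simp: add_pos_nonneg\<close>)
        finally show "norm ((of_real (real (Suc n)) powr (s + 1) - complex_of_real (real n) powr (s + 1)) / (s + 1)) \<le> real n powr a * (16 * real n / (1 + \<bar>t\<bar>)) powr \<theta>"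
          by simp
        show "norm (1 / zeta_reg s) \<le> C * (1 + \<bar>t\<bar>) powr (e / 4 - 1)"
          using C(2)[of s] a by (simp add: s)
      qed auto
      also have "(16 * real n / (1 + \<bar>t\<bar>)) powr \<theta> = 16 powr \<theta> * real n powr \<theta> * (1 + \<bar>t\<bar>) powr (- \<theta>)"
        by (simp only: powr_divide powr_mult powr_minus) (simp only: divide_inverse)
      also have "(real n powr a * (16 powr \<theta> * real n powr \<theta> * (1 + \<bar>t\<bar>) powr (- \<theta>))) * (C * (1 + \<bar>t\<bar>) powr (e / 4 - 1)) =
          (C * 16 powr \<theta> * (real n powr a * real n powr \<theta>)) * ((1 + \<bar>t\<bar>) powr (- \<theta>) * (1 + \<bar>t\<bar>) powr (e / 4 - 1))"
        by (simp only: mult_ac)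
      also have "real n powr a * real n powr \<theta> = real n powr (- 1 / 2 + e)"
        unfolding powr_add [symmetric] by (rule arg_cong) (simp add: a_def \<theta>_def)
      also have "(1 + \<bar>t\<bar>) powr (- \<theta>) * (1 + \<bar>t\<bar>) powr (e / 4 - 1) = (1 + \<bar>t\<bar>) powr (- 1 - e / 4)"
        unfolding powr_add [symmetric] by (rule arg_cong) (simp add: \<theta>_def)
      finally show "norm (smoothed_kernel (real (Suc n)) (Complex a t) - smoothed_kernel (real n) (Complex a t)) \<le>
          (C * 16 powr \<theta> * real n powr (- 1 / 2 + e)) * (1 + \<bar>t\<bar>) powr (- 1 - e / 4)"
        by (simp only: s_def)
    qed
    then have "perron_const * \<bar>moebius_harmonic n\<bar> \<le> (C * 16 powr \<theta> * real n powr (- 1 / 2 + e)) * ?J"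
      using perron_const_pos unfolding norm_of_real abs_mult by simp
    then show "\<bar>moebius_harmonic n\<bar> \<le> C * 16 powr \<theta> * ?J / perron_const * real n powr (- 1 / 2 + e)"
      using perron_const_pos by (simp add: field_simps)
  qed
qed

lemma moebius_harmonic_floor_bound:
  assumes nz: "\<And>s. Re s > 1 / 2 \<Longrightarrow> s \<noteq> 1 \<Longrightarrow> riemann_zeta s \<noteq> 0"
    and e: "0 < e" "e \<le> 1 / 2"
  shows "\<exists>C\<ge>0. \<forall>u>0. \<bar>moebius_harmonic (nat \<lfloor>u\<rfloor>)\<bar> \<le> C * u powr (- 1 / 2 + e)"
proof -
  obtain C where C: "\<And>n. n > 0 \<Longrightarrow> \<bar>moebius_harmonic n\<bar> \<le> C * real n powr (- 1 / 2 + e)"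
    using moebius_harmonic_bound[OF nz e(1)] e by auto
  show ?thesis
  \<comment> \<open>For \<open>u \<ge> 1\<close> the floor is at least \<open>u / 2\<close>; as the
    exponent is not positive, this costs the factor \<open>(1 / 2) powr (- 1 / 2 + e)\<close>. For
    \<open>u < 1\<close> the sum is empty.\<close>
  proof (intro exI[of _ "\<bar>C\<bar> * (1 / 2) powr (- 1 / 2 + e)"] conjI allI impI)
    fix u :: real assume u: "u > 0"
    show "\<bar>moebius_harmonic (nat \<lfloor>u\<rfloor>)\<bar> \<le> \<bar>C\<bar> * (1 / 2) powr (- 1 / 2 + e) * u powr (- 1 / 2 + e)"
    proof (cases "u \<ge> 1")
      case True
      define n where "n = nat \<lfloor>u\<rfloor>"
      have "real n = of_int \<lfloor>u\<rfloor>" "1 \<le> real_of_int \<lfloor>u\<rfloor>" "u < of_int \<lfloor>u\<rfloor> + 1"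
        using True by (simp_all add: n_def)
      then have "0 < real n" and n2: "1 / 2 * u \<le> real n" by linarith+
      then have n: "n > 0" "1 / 2 * u \<le> real n" by simp_all
      have "\<bar>moebius_harmonic n\<bar> \<le> C * real n powr (- 1 / 2 + e)" by (rule C[OF n(1)])
      also have "\<dots> \<le> \<bar>C\<bar> * real n powr (- 1 / 2 + e)" by (intro mult_right_mono) auto
      also have "\<dots> \<le> \<bar>C\<bar> * (1 / 2 * u) powr (- 1 / 2 + e)"
        using n(2) e u by (intro mult_left_mono powr_mono2') auto
      also have "(1 / 2 * u) powr (- 1 / 2 + e) = (1 / 2) powr (- 1 / 2 + e) * u powr (- 1 / 2 + e)"
        by (rule powr_mult)
      finally show ?thesis by (simp add: n_def mult.assoc)
    next
      case False
      then have "nat \<lfloor>u\<rfloor> = 0" using u by simp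
      then show ?thesis by (simp add: moebius_harmonic_def)
    qed
  qed simp
qed

section \<open>Moments of the Moebius sums\<close>

lemma has_bochner_integral_power_0:
  assumes "b \<ge> 0"
  shows "has_bochner_integral lborel (\<lambda>t. complex_of_real (indicator {0..b} t * t ^ n)) (of_real (b ^ Suc n / real (Suc n)))"
proof -
  have "has_bochner_integral lborel (\<lambda>t. t ^ n * indicator {0..b} t) (b ^ Suc n / real (Suc n) - 0 ^ Suc n / real (Suc n))"
  proof (rule has_bochner_integral_FTC_Icc_nonneg)
    show "DERIV (\<lambda>t. t ^ Suc n / real (Suc n)) t :> t ^ n" for t
      by (rule DERIV_cong[OF DERIV_cdivide[OF DERIV_pow]]) (simp del: of_nat_Suc)
  qed (use assms in auto)
  then have "has_bochner_integral lborel (\<lambda>t. complex_of_real (t ^ n * indicator {0..b} t)) (of_real (b ^ Suc n / real (Suc n) - 0 ^ Suc n / real (Suc n)))"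
    by (rule has_bochner_integral_of_real)
  then show ?thesis by (simp add: mult.commute del: of_nat_Suc)
qed

text \<open>The index \<open>k\<close> occurs in the sum at \<open>x / t\<close> precisely when
  \<open>t \<le> x / (k + 1)\<close>. Integrating \<open>t ^ n\<close> over that range gives a
  multiple of the power \<open>- (n + 2)\<close> of \<open>k + 1\<close>, and the Moebius series
  sums these to the reciprocal of zeta at \<open>n + 2\<close>. This is the integral representation
  of \<open>star_series\<close> for a single monomial.\<close>

lemma moebius_harmonic_moment:
  assumes x: "x > 0"
  shows "integrable lborel (\<lambda>t. indicator {0<..} t *\<^sub>R (complex_of_real (moebius_harmonic (nat \<lfloor>x / t\<rfloor>)) * of_real t ^ n))"
    and "(LINT t|lborel. indicator {0<..} t *\<^sub>R (complex_of_real (moebius_harmonic (nat \<lfloor>x / t\<rfloor>)) * of_real t ^ n)) =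
      of_real x ^ Suc n / (of_nat (Suc n) * riemann_zeta (of_nat (Suc n) + 1))"
proof -
  let ?f = "\<lambda>k t. of_real (moebius (Suc k) / real (Suc k)) * complex_of_real (indicator {0..x / real (Suc k)} t * t ^ n)"
  let ?g = "\<lambda>t. indicator {0<..} t *\<^sub>R (complex_of_real (moebius_harmonic (nat \<lfloor>x / t\<rfloor>)) * of_real t ^ n)"
  have bi: "has_bochner_integral lborel (?f k) (of_real (moebius (Suc k) / real (Suc k)) * of_real ((x / real (Suc k)) ^ Suc n / real (Suc n)))" for k
    using x by (intro has_bochner_integral_mult_right has_bochner_integral_power_0) auto
  have int: "integrable lborel (?f k)" for k using bi[of k] by (simp only: has_bochner_integral_iff)
  let ?s = "of_nat (Suc n) + 1 :: complex"
  have s: "Re ?s > 1" by simp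
  have val: "integral\<^sup>L lborel (?f k) = (of_real (moebius (Suc k)) * of_nat (Suc k) powr (- ?s)) * (of_real x ^ Suc n / of_nat (Suc n))" for k
  proof -
    have p: "complex_of_nat (Suc k) powr (- ?s) = inverse (of_nat (Suc k) ^ (n + 2))"
    proof -
      have "complex_of_nat (Suc k) powr (of_nat (n + 2)) = of_nat (Suc k) ^ (n + 2)"
        by (intro powr_nat') auto
      moreover have "?s = of_nat (n + 2)" by simp
      ultimately show ?thesis by (simp only: powr_minus)
    qed
    have "integral\<^sup>L lborel (?f k) = of_real (moebius (Suc k) / real (Suc k)) * of_real ((x / real (Suc k)) ^ Suc n / real (Suc n))"
      using bi[of k] by (simp only: has_bochner_integral_iff)
    also have "\<dots> = (of_real (moebius (Suc k)) * inverse (of_nat (Suc k) ^ (n + 2))) * (of_real x ^ Suc n / of_nat (Suc n))"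
      by (simp add: power_divide divide_inverse power_inverse power_mult_distrib mult_ac del: of_nat_Suc)
    finally show ?thesis unfolding p .
  qed
  have normval: "(LINT t|lborel. norm (?f k t)) \<le> real (Suc k) powr (- 2) * (x ^ Suc n / real (Suc n))" for k
  proof -
    have "norm (?f k t) = \<bar>moebius (Suc k) / real (Suc k)\<bar> * (indicator {0..x / real (Suc k)} t * t ^ n)" for t
      unfolding norm_mult norm_of_real by (cases "t \<ge> 0") (auto simp: indicator_def abs_mult)
    moreover have "(LINT t|lborel. indicator {0..x / real (Suc k)} t * t ^ n) = (x / real (Suc k)) ^ Suc n / real (Suc n)"
    proof -
      have "complex_of_real (LINT t|lborel. indicator {0..x / real (Suc k)} t * t ^ n) = of_real ((x / real (Suc k)) ^ Suc n / real (Suc n))"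
        unfolding integral_complex_of_real [symmetric]
        using has_bochner_integral_power_0[of "x / real (Suc k)" n] x
        by (simp only: has_bochner_integral_iff) simp
      then show ?thesis by (simp only: of_real_eq_iff)
    qed
    ultimately have "(LINT t|lborel. norm (?f k t)) = \<bar>moebius (Suc k) / real (Suc k)\<bar> * ((x / real (Suc k)) ^ Suc n / real (Suc n))"
      by (simp only: integral_mult_right_zero)
    also have "\<dots> \<le> (1 / real (Suc k)) * ((x ^ Suc n / real (Suc k)) / real (Suc n))"
    proof (intro mult_mono divide_right_mono)
      show "\<bar>moebius (Suc k) / real (Suc k)\<bar> \<le> 1 / real (Suc k)"
        unfolding abs_divide abs_of_nat by (intro divide_right_mono abs_moebius_le) auto
      have "real (Suc k) ^ 1 \<le> real (Suc k) ^ Suc n" by (intro power_increasing) auto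
      then show "(x / real (Suc k)) ^ Suc n \<le> x ^ Suc n / real (Suc k)"
        unfolding power_divide using x by (intro divide_left_mono) auto
    qed (use x in auto)
    also have "\<dots> = real (Suc k) powr (- 2) * (x ^ Suc n / real (Suc n))"
    proof -
      have "real (Suc k) powr (- 2) = inverse (real (Suc k) ^ 2)" by (simp only: powr_minus powr_numeral of_nat_0_le_iff)
      then show ?thesis by (simp add: power2_eq_square divide_inverse del: of_nat_Suc)
    qed
    finally show ?thesis .
  qed
  have summ: "summable (\<lambda>k. LINT t|lborel. norm (?f k t))"
  proof (rule summable_comparison_test'[where N = 0])
    show "summable (\<lambda>k. real (Suc k) powr (- 2) * (x ^ Suc n / real (Suc n)))"
      by (intro summable_mult2 summable_Suc_powr) simp
    fix k
    have "0 \<le> (LINT t|lborel. norm (?f k t))" by (rule Bochner_Integration.integral_nonneg) simp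
    then show "norm (LINT t|lborel. norm (?f k t)) \<le> real (Suc k) powr (- 2) * (x ^ Suc n / real (Suc n))"
      using normval[of k] by (simp only: real_norm_def abs_of_nonneg)
  qed
  have fin: "?f k t = 0" if "t > 0" "k \<notin> {..<nat \<lfloor>x / t\<rfloor>}" for k t
  proof -
    have "nat \<lfloor>x / t\<rfloor> \<le> k" using that by simp
    then have "x / t < real (Suc k)" by linarith
    then have "x / real (Suc k) < t" using that(1) by (simp add: field_simps)
    then show ?thesis by simp
  qed
  have pt: "(\<lambda>k. ?f k t) sums ?g t" if t: "t > 0" for t
  proof -
    have "(\<lambda>k. ?f k t) sums (\<Sum>k<nat \<lfloor>x / t\<rfloor>. ?f k t)"
      by (rule sums_finite) (use fin[OF t] in auto)
    also have "(\<Sum>k<nat \<lfloor>x / t\<rfloor>. ?f k t) = (\<Sum>k<nat \<lfloor>x / t\<rfloor>. of_real (moebius (Suc k) / real (Suc k)) * of_real t ^ n)"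
    proof (rule sum.cong)
      fix k assume "k \<in> {..<nat \<lfloor>x / t\<rfloor>}"
      then have "real (Suc k) \<le> x / t" by simp linarith
      then have "t \<le> x / real (Suc k)" using t by (simp add: field_simps)
      then show "?f k t = of_real (moebius (Suc k) / real (Suc k)) * of_real t ^ n" using t by simp
    qed simp
    also have "\<dots> = ?g t" using t by (simp add: moebius_harmonic_def sum_distrib_right)
    finally show ?thesis .
  qed
  \<comment> \<open>All the closed intervals contain 0, and for \<open>n = 0\<close> the power there
    is \<open>0 ^ 0 = 1\<close>, so that no decay beyond \<open>1 / k\<close> remains; the point is
    discarded as a null set.\<close>
  have AEs: "AE t in lborel. summable (\<lambda>k. norm (?f k t))"
  proof (rule AE_mp[OF AE_lborel_singleton[of 0]], rule AE_I2, rule impI)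
    fix t :: real assume "t \<noteq> 0"
    show "summable (\<lambda>k. norm (?f k t))"
    proof (cases "t > 0")
      case True
      show ?thesis by (rule summable_finite[of "{..<nat \<lfloor>x / t\<rfloor>}"]) (use fin[OF True] in auto)
    qed (use \<open>t \<noteq> 0\<close> in simp)
  qed
  have AEeq: "AE t in lborel. (\<Sum>k. ?f k t) = ?g t"
  proof (rule AE_mp[OF AE_lborel_singleton[of 0]], rule AE_I2, rule impI)
    fix t :: real assume "t \<noteq> 0"
    then show "(\<Sum>k. ?f k t) = ?g t"
      using sums_unique[OF pt, of t] by (cases "t > 0") auto
  qed
  have I: "integrable lborel (\<lambda>t. \<Sum>k. ?f k t)"
    by (rule integrable_suminf[where f = ?f, OF int AEs summ])
  have J: "integral\<^sup>L lborel (\<lambda>t. \<Sum>k. ?f k t) = (\<Sum>k. integral\<^sup>L lborel (?f k))"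
    by (rule integral_suminf[where f = ?f, OF int AEs summ])
  have meas: "?g \<in> borel_measurable lborel"
  proof -
    have [measurable]: "(\<lambda>t. moebius_harmonic (nat \<lfloor>x / t\<rfloor>)) \<in> borel_measurable borel"
      by (rule measurable_compose[where g = "\<lambda>i :: int. moebius_harmonic (nat i)" and N = "count_space UNIV"]) measurable
    show ?thesis by measurable
  qed
  show "integrable lborel ?g"
    by (rule integrable_cong_AE_imp[OF I meas AEeq])
  have "integral\<^sup>L lborel ?g = integral\<^sup>L lborel (\<lambda>t. \<Sum>k. ?f k t)"
    by (rule integral_cong_AE[OF meas borel_measurable_integrable[OF I]]) (use AEeq in \<open>auto elim: eventually_mono\<close>)
  also have "\<dots> = (1 / riemann_zeta ?s) * (of_real x ^ Suc n / of_nat (Suc n))"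
    unfolding J val by (rule sums_unique [symmetric], rule sums_mult2, rule moebius_sums, rule s)
  finally show "integral\<^sup>L lborel ?g = of_real x ^ Suc n / (of_nat (Suc n) * riemann_zeta (of_nat (Suc n) + 1))"
    by (simp add: mult.commute del: of_nat_Suc)
qed

section \<open>The associated entire function\<close>

locale entire_series =
  fixes \<phi> :: "complex \<Rightarrow> complex" and a :: "nat \<Rightarrow> complex"
  assumes series: "\<And>z. (\<lambda>n. a (Suc n) * z ^ Suc n) sums \<phi> z"
begin

text \<open>Convergence at a point of larger modulus, here \<open>norm z + 1\<close>, gives absolute
  convergence at \<open>z\<close>.\<close>

lemma abs_summable: "summable (\<lambda>n. norm (a (Suc n)) * norm z ^ Suc n)" for z :: complex
proof -
  define x where "x = complex_of_real (norm z + 1)"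
  have "x = 0 \<longleftrightarrow> norm z + 1 = 0" unfolding x_def by (rule of_real_eq_0_iff)
  then have x: "x \<noteq> 0" "norm z < norm x"
    using norm_ge_zero[of z] by (linarith, simp add: x_def del: of_real_add)
  have "summable (\<lambda>n. a (Suc n) * x ^ Suc n / x)"
    by (rule summable_divide[OF sums_summable[OF series]])
  then have "summable (\<lambda>n. a (Suc n) * x ^ n)" using x by simp
  then have "summable (\<lambda>n. norm (a (Suc n) * z ^ n))" by (rule powser_insidea[OF _ x(2)])
  then have "summable (\<lambda>n. norm (a (Suc n) * z ^ n) * norm z)" by (rule summable_mult2)
  then show ?thesis by (simp add: norm_mult norm_power mult_ac)
qed

definition star_coeff :: "nat \<Rightarrow> complex" where
  "star_coeff n = a (Suc n) / (of_nat (Suc n) * riemann_zeta (of_nat (Suc n) + 1))"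

lemma star_series_eq: "star_series a z = (\<Sum>n. star_coeff n * z ^ Suc n)"
  by (simp add: star_series_def star_coeff_def)

lemma norm_star_coeff_le: "norm (star_coeff n) \<le> zeta_majorant * norm (a (Suc n))"
proof -
  have "norm (star_coeff n) = norm (a (Suc n)) * (1 / real (Suc n)) * norm (1 / riemann_zeta (of_nat (Suc n) + 1))"
    by (simp add: star_coeff_def norm_divide norm_mult del: of_nat_Suc)
  also have "\<dots> \<le> norm (a (Suc n)) * 1 * zeta_majorant"
    by (intro mult_mono zeta_majorant_bounds) auto
  finally show ?thesis by (simp add: mult.commute)
qed

lemma abs_summable_star_coeff: "summable (\<lambda>n. norm (star_coeff n) * norm z ^ Suc n)" for z :: complex
proof (rule summable_comparison_test'[OF summable_mult[OF abs_summable[of z], of zeta_majorant], where N = 0])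
  fix n
  have "norm (star_coeff n) * norm z ^ Suc n \<le> (zeta_majorant * norm (a (Suc n))) * norm z ^ Suc n"
    by (intro mult_right_mono norm_star_coeff_le) auto
  then show "norm (norm (star_coeff n) * norm z ^ Suc n) \<le> zeta_majorant * (norm (a (Suc n)) * norm z ^ Suc n)"
    by (simp add: mult.assoc)
qed

lemma star_sums: "(\<lambda>n. star_coeff n * z ^ Suc n) sums star_series a z"
  unfolding star_series_eq
  by (rule summable_sums[OF summable_norm_cancel]) (use abs_summable_star_coeff[of z] in \<open>simp add: norm_mult norm_power\<close>)

lemma continuous_series:
  fixes c :: "nat \<Rightarrow> complex"
  assumes c: "\<And>z :: complex. summable (\<lambda>n. norm (c n) * norm z ^ Suc n)" and f: "\<And>z. (\<lambda>n. c n * z ^ Suc n) sums f z"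
  shows "continuous_on UNIV (\<lambda>t. f (complex_of_real t))"
proof -
  have "isCont f z" for z
  proof -
    have summ: "summable (\<lambda>n. c n * w ^ n)" for w
    proof (cases "w = 0")
      case False
      have "summable (\<lambda>n. c n * w ^ Suc n / w)" by (rule summable_divide[OF sums_summable[OF f]])
      then show ?thesis using False by simp
    qed (auto intro: summable_finite[of "{0}"])
    have "isCont (\<lambda>z. \<Sum>n. c n * z ^ n) z"
      by (rule isCont_powser_converges_everywhere[OF summ])
    moreover have "f w = w * (\<Sum>n. c n * w ^ n)" for w
      using sums_unique[OF f[of w]] suminf_mult[OF summ[of w], of w] by (simp add: mult_ac)
    then have "f = (\<lambda>w. w * (\<Sum>n. c n * w ^ n))" by auto
    ultimately show ?thesis by (auto intro!: continuous_intros)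
  qed
  then have "continuous_on UNIV f" by (simp add: continuous_at_imp_continuous_on)
  then show ?thesis by (rule continuous_on_compose2) (auto intro!: continuous_intros)
qed

lemma phi_continuous: "continuous_on UNIV (\<lambda>t. \<phi> (complex_of_real t))"
  by (rule continuous_series[OF abs_summable series])

lemma star_continuous: "continuous_on UNIV (\<lambda>t. star_series a (complex_of_real t))"
  by (rule continuous_series[OF abs_summable_star_coeff star_sums])

lemma phi_measurable: "(\<lambda>t. \<phi> (complex_of_real t)) \<in> borel_measurable borel"
  by (rule borel_measurable_continuous_onI[OF phi_continuous])

lemma star_measurable: "(\<lambda>t. star_series a (complex_of_real t)) \<in> borel_measurable borel"
  by (rule borel_measurable_continuous_onI[OF star_continuous])

text \<open>Integrates the power series term by term against the Moebius sums. These vanish for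
  \<open>t > x\<close> and are bounded by \<open>B\<close>, so the norms of the terms are at most
  \<open>B\<close> times those of the series at \<open>x\<close>.\<close>

lemma star_series_integral:
  assumes x: "x > 0" and M: "\<And>u :: real. u > 0 \<Longrightarrow> \<bar>moebius_harmonic (nat \<lfloor>u\<rfloor>)\<bar> \<le> B"
  shows "star_series a (of_real x) =
    (LINT t|lborel. indicator {0<..} t *\<^sub>R (complex_of_real (moebius_harmonic (nat \<lfloor>x / t\<rfloor>)) * (\<phi> (of_real t) / of_real t)))"
proof -
  let ?h = "\<lambda>n t. indicator {0<..} t *\<^sub>R (complex_of_real (moebius_harmonic (nat \<lfloor>x / t\<rfloor>)) * of_real t ^ n)"
  let ?f = "\<lambda>n t. a (Suc n) * ?h n t"
  have int: "integrable lborel (?f n)" for n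
    by (intro integrable_mult_right moebius_harmonic_moment x)
  have val: "integral\<^sup>L lborel (?f n) = star_coeff n * of_real x ^ Suc n" for n
    unfolding integral_mult_right_zero moebius_harmonic_moment(2)[OF x] by (simp add: star_coeff_def)
  have pt: "(\<lambda>n. ?f n t) sums (indicator {0<..} t *\<^sub>R (complex_of_real (moebius_harmonic (nat \<lfloor>x / t\<rfloor>)) * (\<phi> (of_real t) / of_real t)))" for t
  proof (cases "t > 0")
    case True
    have "(\<lambda>n. complex_of_real (moebius_harmonic (nat \<lfloor>x / t\<rfloor>)) * (a (Suc n) * of_real t ^ Suc n / of_real t)) sums
      (complex_of_real (moebius_harmonic (nat \<lfloor>x / t\<rfloor>)) * (\<phi> (of_real t) / of_real t))"
      by (intro sums_mult sums_divide series)
    then show ?thesis using True by (simp add: mult_ac)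
  qed simp
  have AEs: "AE t in lborel. summable (\<lambda>n. norm (?f n t))"
  proof (rule AE_I2)
    fix t :: real
    show "summable (\<lambda>n. norm (?f n t))"
    proof (cases "t > 0")
      case True
      have "summable (\<lambda>n. \<bar>moebius_harmonic (nat \<lfloor>x / t\<rfloor>)\<bar> * (norm (a (Suc n)) * norm (complex_of_real t) ^ Suc n / t))"
        by (intro summable_mult summable_divide abs_summable)
      then show ?thesis using True by (simp add: norm_mult norm_power mult_ac)
    qed simp
  qed
  have B: "B \<ge> 0" using M[of 1] by simp
  have nb: "(LINT t|lborel. norm (?f n t)) \<le> B * (norm (a (Suc n)) * norm (complex_of_real x) ^ Suc n)" for n
  proof -
    have "(LINT t|lborel. norm (?f n t)) \<le> (LINT t|lborel. indicator {0..x} t *\<^sub>R (norm (a (Suc n)) * (B * x ^ n)))"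
    proof (rule integral_mono)
      show "integrable lborel (\<lambda>t. norm (?f n t))" by (intro integrable_norm int)
      show "integrable lborel (\<lambda>t. indicator {0..x} t *\<^sub>R (norm (a (Suc n)) * (B * x ^ n)))"
      proof -
        have "integrable lborel (indicat_real {0..x})"
          using x by (intro integrable_real_indicator) simp_all
        then show ?thesis by simp
      qed
      fix t :: real
      consider "t \<le> 0" | "0 < t" "t \<le> x" | "t > x" "t > 0" using x by linarith
      then show "norm (?f n t) \<le> indicator {0..x} t *\<^sub>R (norm (a (Suc n)) * (B * x ^ n))"
      proof cases
        case 1
        then show ?thesis using B x by (simp add: indicator_def)
      next
        case 2
        then have "\<bar>moebius_harmonic (nat \<lfloor>x / t\<rfloor>)\<bar> * t ^ n \<le> B * x ^ n"
          using x B by (intro mult_mono M power_mono) auto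
        then have "norm (a (Suc n)) * (\<bar>moebius_harmonic (nat \<lfloor>x / t\<rfloor>)\<bar> * t ^ n) \<le> norm (a (Suc n)) * (B * x ^ n)"
          by (rule mult_left_mono) simp
        then show ?thesis using 2 by (simp add: norm_mult norm_power)
      next
        case 3
        then have "nat \<lfloor>x / t\<rfloor> = 0" using x by simp
        then show ?thesis using 3 by (simp add: moebius_harmonic_def)
      qed
    qed
    also have "\<dots> = B * (norm (a (Suc n)) * norm (complex_of_real x) ^ Suc n)" using x by simp
    finally show ?thesis .
  qed
  have summ: "summable (\<lambda>n. LINT t|lborel. norm (?f n t))"
  proof (rule summable_comparison_test'[OF summable_mult[OF abs_summable[of "of_real x"], of B], where N = 0])
    fix n
    have "0 \<le> (LINT t|lborel. norm (?f n t))" by (rule Bochner_Integration.integral_nonneg) simp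
    then show "norm (LINT t|lborel. norm (?f n t)) \<le> B * (norm (a (Suc n)) * norm (complex_of_real x) ^ Suc n)"
      using nb[of n] by (simp only: real_norm_def abs_of_nonneg)
  qed
  have "star_series a (of_real x) = (\<Sum>n. integral\<^sup>L lborel (?f n))"
    unfolding val star_series_eq ..
  also have "\<dots> = (LINT t|lborel. (\<Sum>n. ?f n t))"
    by (rule integral_suminf[where f = ?f, OF int AEs summ, symmetric])
  also have "(\<lambda>t. \<Sum>n. ?f n t) = (\<lambda>t. indicator {0<..} t *\<^sub>R (complex_of_real (moebius_harmonic (nat \<lfloor>x / t\<rfloor>)) * (\<phi> (of_real t) / of_real t)))"
    by (intro ext sums_unique[OF pt, symmetric])
  finally show ?thesis .
qed

text \<open>Inserting the bound for \<open>moebius_harmonic\<close> at \<open>x / t\<close> into the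
  integral representation lets \<open>x powr (- 1 / 2 + e)\<close> factor out. What remains is the
  norm of \<open>\<phi>\<close> at \<open>- 1 / 2 + e\<close>, which is finite.\<close>

lemma star_series_decay:
  assumes nz: "\<And>s. Re s > 1 / 2 \<Longrightarrow> s \<noteq> 1 \<Longrightarrow> riemann_zeta s \<noteq> 0"
    and e: "0 < e" "e \<le> 1 / 2" and \<phi>: "mellin_integrable (\<lambda>t. \<phi> (of_real t)) (of_real (- 1 / 2 + e))"
  shows "\<exists>K. \<forall>x>0. norm (star_series a (of_real x)) \<le> K * x powr (- 1 / 2 + e)"
proof -
  define p where "p = - 1 / 2 + e"
  have p0: "p \<le> 0" using e by (simp add: p_def)
  obtain C where C: "C \<ge> 0" "\<And>u :: real. u > 0 \<Longrightarrow> \<bar>moebius_harmonic (nat \<lfloor>u\<rfloor>)\<bar> \<le> C * u powr p"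
    using moebius_harmonic_floor_bound[OF nz e] unfolding p_def by blast
  \<comment> \<open>The representation asks for a constant bound: for \<open>u \<ge> 1\<close> the
    power is at most 1, and for \<open>u < 1\<close> the sum is empty.\<close>
  have bd: "\<bar>moebius_harmonic (nat \<lfloor>u\<rfloor>)\<bar> \<le> C" if "u > 0" for u :: real
  proof (cases "u \<ge> 1")
    case True
    then have "u powr p \<le> u powr 0" using p0 by (intro powr_mono) auto
    then have "C * u powr p \<le> C * 1" using C(1) True by (intro mult_left_mono) auto
    then show ?thesis using C(2)[OF that] by simp
  next
    case False
    then have "nat \<lfloor>u\<rfloor> = 0" using that by simp
    then show ?thesis using C by (simp add: moebius_harmonic_def)
  qed
  let ?g = "\<lambda>t. indicator {0<..} t *\<^sub>R (complex_of_real t powr (- of_real p - 1) * \<phi> (of_real t))"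
  have g: "integrable lborel ?g" using \<phi> by (simp only: mellin_integrable_def set_integrable_def p_def)
  show ?thesis unfolding p_def [symmetric]
  proof (intro exI[of _ "C * (LINT t|lborel. norm (?g t))"] allI impI)
    fix x :: real assume x: "x > 0"
    let ?h = "\<lambda>t. indicator {0<..} t *\<^sub>R (complex_of_real (moebius_harmonic (nat \<lfloor>x / t\<rfloor>)) * (\<phi> (of_real t) / of_real t))"
    have le: "norm (?h t) \<le> (C * x powr p) * norm (?g t)" for t
    proof (cases "t > 0")
      case True
      have "norm (?h t) = \<bar>moebius_harmonic (nat \<lfloor>x / t\<rfloor>)\<bar> * (norm (\<phi> (of_real t)) / t)"
        using True by (simp add: norm_mult norm_divide)
      also have "\<dots> \<le> (C * (x / t) powr p) * (norm (\<phi> (of_real t)) / t)"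
        using True x by (intro mult_right_mono C(2)) auto
      also have "(x / t) powr p = x powr p * t powr (- p)"
        by (simp only: powr_divide powr_minus) (simp only: divide_inverse)
      also have "(C * (x powr p * t powr (- p))) * (norm (\<phi> (of_real t)) / t) = (C * x powr p) * (t powr (- p - 1) * norm (\<phi> (of_real t)))"
      proof -
        have "t powr (- p - 1) = t powr (- p) / t" using True by (simp add: powr_diff)
        then show ?thesis by (simp add: mult_ac)
      qed
      also have "t powr (- p - 1) = norm (complex_of_real t powr (- of_real p - 1))"
        using True by (simp add: norm_powr_of_real_pos)
      finally show ?thesis using True by (simp add: norm_mult)
    qed simp
    have "norm (star_series a (of_real x)) = norm (LINT t|lborel. ?h t)"
      using star_series_integral[OF x bd] by simp
    also have "\<dots> \<le> (LINT t|lborel. norm (?h t))" by (rule integral_norm_bound)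
    also have "\<dots> \<le> (LINT t|lborel. (C * x powr p) * norm (?g t))"
    proof (rule Bochner_Integration.integral_mono')
      show "integrable lborel (\<lambda>t. (C * x powr p) * norm (?g t))"
        by (intro integrable_mult_right integrable_norm g)
      fix t
      show "norm (?h t) \<le> (C * x powr p) * norm (?g t)" by (rule le)
      then show "0 \<le> (C * x powr p) * norm (?g t)" using norm_ge_zero order.trans by blast
    qed
    also have "\<dots> = C * (LINT t|lborel. norm (?g t)) * x powr p"
      by (simp only: integral_mult_right_zero mult_ac)
    finally show "norm (star_series a (of_real x)) \<le> C * (LINT t|lborel. norm (?g t)) * x powr p" .
  qed
qed

text \<open>The integral of \<open>\<phi>(t)/t\<close> from 0 to \<open>x\<close>. It links the two
  functions, being a superposition of dilates of \<open>star_series\<close> with weights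
  \<open>1 / (k + 1)\<close> and of dilates of \<open>\<phi>\<close> with weight
  \<open>1 / v\<close> on the unit interval.\<close>

definition primitive :: "real \<Rightarrow> complex" where
  "primitive x = (\<Sum>n. a (Suc n) * of_real x ^ Suc n / of_nat (Suc n))"

text \<open>In degree \<open>n + 1\<close> the dilations by \<open>1 / (k + 1)\<close> and the
  weights sum to zeta at \<open>n + 2\<close>, the factor by which \<open>star_coeff\<close> was
  divided. The series is written as an integral over the counting measure in order to fit
  \<open>mellin_superposition\<close>.\<close>

lemma primitive_eq_sum:
  assumes x: "x > 0"
  shows "primitive x = (LINT k|count_space (UNIV :: nat set). of_real (1 / real (Suc k)) * star_series a (of_real (1 / real (Suc k) * x)))"
proof -
  define f where "f = (\<lambda>(k, n). of_real (1 / real (Suc k)) * (star_coeff n * complex_of_real (1 / real (Suc k) * x) ^ Suc n))"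
  have fk: "norm (f (k, n)) = real (Suc k) powr (- 1 - real (Suc n)) * (norm (star_coeff n) * x ^ Suc n)" for k n
  proof -
    have "real (Suc k) powr (- 1 - real (Suc n)) = real (Suc k) powr (- 1) / real (Suc k) powr (real (Suc n))"
      by (rule powr_diff)
    also have "\<dots> = (1 / real (Suc k)) / real (Suc k) ^ Suc n"
      by (simp only: powr_realpow of_nat_0_less_iff zero_less_Suc powr_neg_one)
    finally have p: "real (Suc k) powr (- 1 - real (Suc n)) = (1 / real (Suc k)) / real (Suc k) ^ Suc n" .
    show ?thesis unfolding p f_def case_prod_conv norm_mult norm_power norm_of_real
      using x by (simp add: power_divide power_mult_distrib abs_mult del: of_nat_Suc power_Suc)
  qed
  \<comment> \<open>The degree is at least 1, so every term has the factor
    \<open>real (Suc k) powr (- 2)\<close>; this majorant splits into a function of \<open>k\<close>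
    times one of \<open>n\<close>.\<close>
  have le: "norm (f (k, n)) \<le> real (Suc k) powr (- 2) * (norm (star_coeff n) * x ^ Suc n)" for k n
    unfolding fk using x by (intro mult_right_mono powr_mono) auto
  have s1: "(\<lambda>n. norm (star_coeff n) * x ^ Suc n) summable_on UNIV"
    using abs_summable_star_coeff[of "of_real x"] x by (subst summable_on_UNIV_nonneg_real_iff) auto
  have s2: "(\<lambda>k. real (Suc k) powr (- 2)) summable_on UNIV"
    using summable_Suc_powr[of 2] by (subst summable_on_UNIV_nonneg_real_iff) auto
  have fsum: "f summable_on (UNIV \<times> UNIV)"
  proof (rule Infinite_Sum.abs_summable_summable, rule summable_on_comparison_test)
    show "(\<lambda>(k, n). real (Suc k) powr (- 2) * (norm (star_coeff n) * x ^ Suc n)) summable_on (UNIV \<times> UNIV)"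
    proof (rule summable_on_SigmaI)
      fix k
      show "((\<lambda>n. case (k, n) of (k, n) \<Rightarrow> real (Suc k) powr (- 2) * (norm (star_coeff n) * x ^ Suc n)) has_sum real (Suc k) powr (- 2) * infsum (\<lambda>n. norm (star_coeff n) * x ^ Suc n) UNIV) UNIV"
        unfolding case_prod_conv by (intro has_sum_cmult_right has_sum_infsum s1)
      show "(\<lambda>k. real (Suc k) powr (- 2) * infsum (\<lambda>n. norm (star_coeff n) * x ^ Suc n) UNIV) summable_on UNIV"
        by (intro summable_on_cmult_left s2)
    qed (use x in auto)
  qed (use le in auto)
  have row: "((\<lambda>n. f (k, n)) has_sum (of_real (1 / real (Suc k)) * star_series a (of_real (1 / real (Suc k) * x)))) UNIV" for k
    unfolding f_def case_prod_conv
    by (intro has_sum_cmult_right norm_summable_imp_has_sum star_sums)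
      (use abs_summable_star_coeff[of "of_real (1 / real (Suc k) * x)"] in \<open>simp only: norm_mult norm_power\<close>)
  have col: "((\<lambda>k. f (k, n)) has_sum (a (Suc n) * of_real x ^ Suc n / of_nat (Suc n))) UNIV" for n
  proof -
    let ?s = "of_nat (Suc n) + 1 :: complex"
    have s: "Re ?s > 1" by simp
    have "summable (\<lambda>k. norm (complex_of_nat (Suc k) powr (- ?s)))"
      unfolding norm_of_nat_Suc_powr using summable_Suc_powr[OF s] by simp
    then have "((\<lambda>k. complex_of_nat (Suc k) powr (- ?s)) has_sum riemann_zeta ?s) UNIV"
      by (rule norm_summable_imp_has_sum[OF _ riemann_zeta_sums[OF s]])
    then have "((\<lambda>k. star_coeff n * of_real x ^ Suc n * complex_of_nat (Suc k) powr (- ?s)) has_sum (star_coeff n * of_real x ^ Suc n * riemann_zeta ?s)) UNIV"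
      by (rule has_sum_cmult_right)
    moreover have "star_coeff n * of_real x ^ Suc n * complex_of_nat (Suc k) powr (- ?s) = f (k, n)" for k
    proof -
      have "complex_of_nat (Suc k) powr (of_nat (n + 2)) = of_nat (Suc k) ^ (n + 2)"
        by (intro powr_nat') auto
      moreover have "?s = of_nat (n + 2)" by simp
      ultimately have "complex_of_nat (Suc k) powr (- ?s) = inverse (of_nat (Suc k) ^ (n + 2))"
        by (simp only: powr_minus)
      then show ?thesis
        by (simp add: f_def power_mult_distrib power_divide divide_inverse power_inverse del: of_nat_Suc)
    qed
    moreover have "star_coeff n * of_real x ^ Suc n * riemann_zeta ?s = a (Suc n) * of_real x ^ Suc n / of_nat (Suc n)"
      using riemann_zeta_nonzero_gt_1[OF s] by (simp add: star_coeff_def del: of_nat_Suc)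
    ultimately show ?thesis by (simp only:)
  qed
  have F: "(f has_sum infsum f (UNIV \<times> UNIV)) (UNIV \<times> UNIV)" by (rule has_sum_infsum[OF fsum])
  have R: "((\<lambda>k. of_real (1 / real (Suc k)) * star_series a (of_real (1 / real (Suc k) * x))) has_sum infsum f (UNIV \<times> UNIV)) UNIV"
    by (rule has_sum_SigmaD[OF F]) (rule row)
  have F': "((\<lambda>(n, k). f (k, n)) has_sum infsum f (UNIV \<times> UNIV)) (UNIV \<times> UNIV)"
    using F by (subst has_sum_swap) simp
  have "((\<lambda>n. a (Suc n) * of_real x ^ Suc n / of_nat (Suc n)) has_sum infsum f (UNIV \<times> UNIV)) UNIV"
    by (rule has_sum_SigmaD[OF F']) (use col in simp)
  then have "primitive x = infsum f (UNIV \<times> UNIV)"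
    unfolding primitive_def by (metis has_sum_imp_sums sums_unique)
  moreover have "(LINT k|count_space (UNIV :: nat set). of_real (1 / real (Suc k)) * star_series a (of_real (1 / real (Suc k) * x))) = infsum f (UNIV \<times> UNIV)"
  proof -
    have "(\<lambda>k. norm (of_real (1 / real (Suc k)) * star_series a (of_real (1 / real (Suc k) * x)))) summable_on UNIV"
      using R by (simp only: summable_on_iff_abs_summable_on_complex [symmetric] has_sum_imp_summable)
    then have "integrable (count_space UNIV) (\<lambda>k. of_real (1 / real (Suc k)) * star_series a (of_real (1 / real (Suc k) * x)))"
      unfolding integrable_count_space_nat_iff by (simp add: summable_on_UNIV_nonneg_real_iff)
    from integral_count_space_nat[OF this] show ?thesis
      using sums_unique[OF has_sum_imp_sums[OF R]] by simp
  qed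
  ultimately show ?thesis by simp
qed

lemma primitive_eq_integral:
  assumes x: "x > 0"
  shows "primitive x = (LINT v|lborel. (indicator {0<..<1} v *\<^sub>R complex_of_real (1 / v)) * \<phi> (of_real (v * x)))"
proof -
  let ?f = "\<lambda>n v. (a (Suc n) * of_real x ^ Suc n) * complex_of_real (indicator {0..1} v * v ^ n)"
  let ?g = "\<lambda>v. (indicator {0<..<1} v *\<^sub>R complex_of_real (1 / v)) * \<phi> (of_real (v * x))"
  have bi: "has_bochner_integral lborel (?f n) ((a (Suc n) * of_real x ^ Suc n) * of_real (1 ^ Suc n / real (Suc n)))" for n
    by (intro has_bochner_integral_mult_right has_bochner_integral_power_0) auto
  have int: "integrable lborel (?f n)" for n using bi[of n] by (simp only: has_bochner_integral_iff)
  have val: "integral\<^sup>L lborel (?f n) = a (Suc n) * of_real x ^ Suc n / of_nat (Suc n)" for n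
    using bi[of n] by (simp add: has_bochner_integral_iff del: of_nat_Suc power_Suc)
  have le: "norm (?f n v) \<le> indicator {0..1} v *\<^sub>R (norm (a (Suc n)) * norm (complex_of_real x) ^ Suc n)" for n v
    unfolding norm_mult norm_power norm_of_real
    by (cases "v \<in> {0..1}") (auto simp: mult_left_le power_le_one abs_mult simp del: power_Suc)
  have i01: "integrable lborel (indicat_real {0..1 :: real})" by (intro integrable_real_indicator) simp_all
  have summ: "summable (\<lambda>n. LINT v|lborel. norm (?f n v))"
  proof (rule summable_comparison_test'[OF abs_summable[of "of_real x"], where N = 0])
    fix n
    have "(LINT v|lborel. norm (?f n v)) \<le> (LINT v|lborel. indicator {0..1 :: real} v *\<^sub>R (norm (a (Suc n)) * norm (complex_of_real x) ^ Suc n))"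
    proof (rule integral_mono)
      show "integrable lborel (\<lambda>v. norm (?f n v))" by (intro integrable_norm int)
      show "integrable lborel (\<lambda>v. indicator {0..1 :: real} v *\<^sub>R (norm (a (Suc n)) * norm (complex_of_real x) ^ Suc n))"
        using i01 by simp
    qed (rule le)
    moreover have "0 \<le> (LINT v|lborel. norm (?f n v))" by (rule Bochner_Integration.integral_nonneg) simp
    ultimately show "norm (LINT v|lborel. norm (?f n v)) \<le> norm (a (Suc n)) * norm (complex_of_real x) ^ Suc n"
      by simp
  qed
  have AEs: "AE v in lborel. summable (\<lambda>n. norm (?f n v))"
  proof (rule AE_I2)
    fix v :: real
    have "norm (?f n v) \<le> norm (a (Suc n)) * norm (complex_of_real x) ^ Suc n" for n
      using le[of n v] by (cases "v \<in> {0..1}") (auto intro: order.trans)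
    then show "summable (\<lambda>n. norm (?f n v))"
      by (intro summable_comparison_test'[OF abs_summable[of "of_real x"], where N = 0]) simp
  qed
  have meas: "?g \<in> borel_measurable lborel"
  proof -
    have [measurable]: "(\<lambda>v. \<phi> (of_real (v * x))) \<in> borel_measurable borel"
      by (rule measurable_compose[OF _ phi_measurable, where f = "\<lambda>v. v * x"]) measurable
    show ?thesis by measurable
  qed
  have AEeq: "AE v in lborel. (\<Sum>n. ?f n v) = ?g v"
  \<comment> \<open>The terms use the closed unit interval and the integrand the open one; the two
    endpoints are discarded.\<close>
  proof (rule AE_mp[OF AE_lborel_singleton[of 0]], rule AE_mp[OF AE_lborel_singleton[of 1]], rule AE_I2, intro impI)
    fix v :: real assume v: "v \<noteq> 1" "v \<noteq> 0"
    show "(\<Sum>n. ?f n v) = ?g v"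
    proof (cases "v \<in> {0<..<1}")
      case True
      have "(\<lambda>n. a (Suc n) * of_real (v * x) ^ Suc n * complex_of_real (1 / v)) sums (\<phi> (of_real (v * x)) * complex_of_real (1 / v))"
        by (intro sums_mult2 series)
      moreover have "a (Suc n) * of_real (v * x) ^ Suc n * complex_of_real (1 / v) = ?f n v" for n
        using True by (simp add: power_mult_distrib mult_ac)
      ultimately have "(\<lambda>n. ?f n v) sums (\<phi> (of_real (v * x)) * complex_of_real (1 / v))" by (simp only:)
      from sums_unique[OF this] show ?thesis using True by (simp add: mult_ac)
    next
      case False
      then show ?thesis using v by (auto simp: indicator_def)
    qed
  qed
  have I: "integrable lborel (\<lambda>v. \<Sum>n. ?f n v)"
    by (rule integrable_suminf[where f = ?f, OF int AEs summ])
  have "integral\<^sup>L lborel ?g = integral\<^sup>L lborel (\<lambda>v. \<Sum>n. ?f n v)"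
    by (rule integral_cong_AE[OF meas borel_measurable_integrable[OF I]]) (use AEeq in \<open>auto elim: eventually_mono\<close>)
  also have "\<dots> = (\<Sum>n. integral\<^sup>L lborel (?f n))"
    by (rule integral_suminf[where f = ?f, OF int AEs summ])
  finally show ?thesis unfolding val primitive_def by simp
qed

text \<open>The transform of \<open>primitive\<close> is zeta at \<open>1 + s\<close> times that of
  \<open>star_series\<close> by its expansion over \<open>k\<close>, and \<open>1 / s\<close> times
  that of \<open>\<phi>\<close> by its integral over the unit interval. Both weights are absolutely
  integrable exactly because \<open>Re s > 0\<close>.\<close>

lemma mellin_star_series:
  assumes s: "Re s > 0" and \<phi>: "mellin_integrable (\<lambda>t. \<phi> (of_real t)) s"
    and star: "mellin_integrable (\<lambda>t. star_series a (of_real t)) s"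
  shows "zeta_reg s * mellin (\<lambda>t. star_series a (of_real t)) s = mellin (\<lambda>t. \<phi> (of_real t)) s"
proof -
  let ?w = "\<lambda>k. complex_of_real (1 / real (Suc k))"
  have s1: "Re (1 + s) > 1" using s by simp
  have wk: "?w k * ?w k powr s = of_nat (Suc k) powr (- (1 + s))" for k
  proof -
    have "?w k powr s = of_nat (Suc k) powr (- s)"
      using powr_of_real_pos[of "1 / real (Suc k)" s] powr_of_real_pos[of "real (Suc k)" "- s"]
      by (simp add: ln_div del: of_nat_Suc)
    moreover have "complex_of_nat (Suc k) powr (- (1 + s)) = of_nat (Suc k) powr (- s) * of_nat (Suc k) powr (- 1)"
      unfolding powr_add [symmetric] by (rule arg_cong) simp
    moreover have "complex_of_nat (Suc k) powr (- 1) = ?w k"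
      by (simp add: powr_minus divide_inverse del: of_nat_Suc)
    ultimately show ?thesis by (simp only: mult.commute)
  qed
  have w: "integrable (count_space UNIV) (\<lambda>k. ?w k * ?w k powr s)"
    unfolding wk integrable_count_space_nat_iff norm_of_nat_Suc_powr
    using summable_Suc_powr[OF s1] by simp
  have "mellin primitive s = (LINT k|count_space UNIV. ?w k * ?w k powr s) * mellin (\<lambda>t. star_series a (of_real t)) s"
    by (rule mellin_superposition[OF sigma_finite_measure_count_space _ _ star_measurable _ w star])
      (use primitive_eq_sum in \<open>auto simp: divide_le_0_iff simp del: of_nat_Suc\<close>)
  also have "(LINT k|count_space UNIV. ?w k * ?w k powr s) = riemann_zeta (1 + s)"
    unfolding integral_count_space_nat[OF w] unfolding wk
    by (rule sums_unique[OF riemann_zeta_sums[OF s1], symmetric])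
  finally have A: "mellin primitive s = riemann_zeta (1 + s) * mellin (\<lambda>t. star_series a (of_real t)) s" .
  let ?u = "\<lambda>v. indicator {0<..<1} v *\<^sub>R complex_of_real (1 / v)"
  have "Re (- s) < 0" "(1 :: real) > 0" using s by auto
  note H = powr_head_integral[OF this]
  have uv: "?u v * of_real v powr s = indicator {0<..<1} v *\<^sub>R (complex_of_real v powr (- (- s) - 1))" for v
  proof (cases "v \<in> {0<..<1}")
    case True
    have "complex_of_real v powr (- (- s) - 1) = of_real v powr s / of_real v powr 1"
      by (simp add: powr_diff)
    then show ?thesis using True by (simp add: divide_inverse mult.commute)
  qed simp
  have u: "integrable lborel (\<lambda>v. ?u v * of_real v powr s)"
    unfolding uv using H(1) by (simp only: set_integrable_def)
  have "mellin primitive s = (LINT v|lborel. ?u v * of_real v powr s) * mellin (\<lambda>t. \<phi> (of_real t)) s"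
    by (rule mellin_superposition[OF lborel.sigma_finite_measure_axioms _ _ phi_measurable _ u \<phi>])
      (use primitive_eq_integral in auto)
  also have "(LINT v|lborel. ?u v * of_real v powr s) = 1 / s"
    unfolding uv using H(2) by (simp add: set_lebesgue_integral_def)
  finally have B: "mellin primitive s = mellin (\<lambda>t. \<phi> (of_real t)) s / s" by simp
  have "s \<noteq> 0" using s by auto
  moreover have "zeta_reg s = s * riemann_zeta (1 + s)" using s \<open>s \<noteq> 0\<close> by (intro zeta_reg_eq) auto
  ultimately show ?thesis using A B by (simp add: field_simps)
qed

section \<open>The two implications\<close>

lemma star_mellin_integrable:
  assumes O: "\<And>\<epsilon>. \<epsilon> > 0 \<Longrightarrow> (\<lambda>x::real. star_series a (complex_of_real x)) \<in> O[at_top](\<lambda>x. complex_of_real (x powr (- 1 / 2 + \<epsilon>)))"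
    and s: "- 1 / 2 < Re s" "Re s < 1"
  shows "mellin_integrable (\<lambda>t. star_series a (of_real t)) s"
proof -
  \<comment> \<open>The midpoint between \<open>- 1 / 2\<close> and \<open>Re s\<close>: the decay
    hypothesis reaches it, and it leaves room for convergence at infinity.\<close>
  define p where "p = - 1 / 2 + (Re s + 1 / 2) / 2"
  have p: "p < Re s" using s by (simp add: p_def field_simps)
  let ?S = "\<lambda>t. star_series a (complex_of_real t)"
  have "?S \<in> O[at_top](\<lambda>x. complex_of_real (x powr p))"
    unfolding p_def using s by (intro O) auto
  then obtain c where c: "c > 0" "\<forall>\<^sub>F x in at_top. norm (?S x) \<le> c * norm (complex_of_real (x powr p))"
    by (elim landau_o.bigE)
  then obtain T where T: "\<And>x. x \<ge> T \<Longrightarrow> norm (?S x) \<le> c * x powr p"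
    unfolding eventually_at_top_linorder by auto
  \<comment> \<open>Between 1 and the threshold \<open>T\<close> of the asymptotic bound, continuity
    on a compact interval provides the same power with another constant.\<close>
  have "continuous_on {1..max 1 T} (\<lambda>t. norm (?S t) * t powr (- p))"
    by (intro continuous_intros continuous_on_subset[OF star_continuous]) auto
  then have "bounded ((\<lambda>t. norm (?S t) * t powr (- p)) ` {1..max 1 T})"
    by (intro compact_imp_bounded compact_continuous_image compact_Icc)
  then obtain M where M: "\<And>t. t \<in> {1..max 1 T} \<Longrightarrow> norm (norm (?S t) * t powr (- p)) \<le> M"
    unfolding bounded_iff by blast
  \<comment> \<open>The series starts in degree 1, so it is at most \<open>K * t\<close> in norm for
    \<open>t < 1\<close>; this simple zero at the origin sets the limit
    \<open>Re s < 1\<close>.\<close>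
  define K where "K = (\<Sum>n. norm (star_coeff n) * norm (1 :: complex) ^ Suc n)"
  define C where "C = max c (max M K)"
  show ?thesis
  proof (rule mellin_integrable_boundI[OF star_measurable _ p])
    fix t :: real assume t: "t \<ge> 1"
    show "norm (?S t) \<le> C * t powr p"
    proof (cases "t \<ge> T")
      case True
      then have "norm (?S t) \<le> c * t powr p" by (rule T)
      also have "\<dots> \<le> C * t powr p" by (intro mult_right_mono) (auto simp: C_def)
      finally show ?thesis .
    next
      case False
      then have "norm (?S t) * t powr (- p) \<le> M" using M[of t] t by auto
      then have "norm (?S t) * t powr (- p) * t powr p \<le> M * t powr p" by (rule mult_right_mono) simp
      moreover have "t powr (- p) * t powr p = 1" using t by (simp add: powr_add [symmetric])
      ultimately have "norm (?S t) \<le> M * t powr p" by (simp add: mult.assoc)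
      also have "\<dots> \<le> C * t powr p" by (intro mult_right_mono) (auto simp: C_def)
      finally show ?thesis .
    qed
  next
    fix t :: real assume t: "0 < t" "t < 1"
    have "norm (?S t) \<le> (\<Sum>n. t * (norm (star_coeff n) * norm (1 :: complex) ^ Suc n))"
      unfolding star_series_eq
    proof (rule norm_suminf_le)
      show "summable (\<lambda>n. t * (norm (star_coeff n) * norm (1 :: complex) ^ Suc n))"
        by (intro summable_mult abs_summable_star_coeff)
      fix n
      have "t * t ^ n \<le> t * 1" using t by (intro mult_left_mono power_le_one) auto
      then have "norm (star_coeff n) * t ^ Suc n \<le> norm (star_coeff n) * t" by (intro mult_left_mono) auto
      then show "norm (star_coeff n * complex_of_real t ^ Suc n) \<le> t * (norm (star_coeff n) * norm (1 :: complex) ^ Suc n)"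
        using t by (simp add: norm_mult norm_power mult.commute)
    qed
    also have "\<dots> = K * t" unfolding K_def using suminf_mult[OF abs_summable_star_coeff[of 1], of t] by (simp add: mult.commute)
    also have "\<dots> \<le> C * t powr 1" using t by (simp add: C_def mult_right_mono)
    finally show "norm (?S t) \<le> C * t powr 1" .
  qed (use s in auto)
qed

lemma riemann_hypothesis_if_decay:
  assumes mp: "mellin_proper (\<lambda>t. \<phi> (complex_of_real t))"
    and O: "\<And>\<epsilon>. \<epsilon> > 0 \<Longrightarrow> (\<lambda>x::real. star_series a (complex_of_real x)) \<in> O[at_top](\<lambda>x. complex_of_real (x powr (- 1 / 2 + \<epsilon>)))"
  shows riemann_hypothesis
proof -
  let ?F = "\<lambda>t. \<phi> (complex_of_real t)"
  let ?S = "\<lambda>t. star_series a (complex_of_real t)"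
  have F: "mellin_integrable ?F s" if "- 1 / 2 < Re s" "Re s \<le> 1" for s
    using mp that unfolding mellin_proper_def proper_fun_def
    by (intro mellin_integrable_of_norm[OF phi_measurable _ refl]) auto
  define V where "V = {s. Re s \<in> {- 1 / 2<..<1 :: real}}"
  define U where "U = {s. 0 < Re s \<and> Re s < 1}"
  have holF: "mellin ?F holomorphic_on V"
    unfolding V_def by (rule mellin_holomorphic_open) (use F in auto)
  have holS: "mellin ?S holomorphic_on V"
    unfolding V_def by (rule mellin_holomorphic_open) (use star_mellin_integrable[OF O] in auto)
  have Veq: "V = {s. - 1 / 2 < Re s} \<inter> {s. Re s < 1}" by (auto simp: V_def)
  have "open V" unfolding Veq by (intro open_Int open_halfspace_Re_gt open_halfspace_Re_lt)
  moreover have "connected V" unfolding Veq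
    by (intro convex_connected convex_Int convex_halfspace_Re_gt convex_halfspace_Re_lt)
  moreover have "open U" unfolding U_def
    by (intro open_Collect_conj open_halfspace_Re_gt open_halfspace_Re_lt)
  moreover have "of_real (1 / 2) \<in> U" by (simp add: U_def)
  moreover have "U \<subseteq> V" by (auto simp: U_def V_def)
  moreover have "(\<lambda>s. zeta_reg s * mellin ?S s) holomorphic_on V"
    by (intro holomorphic_intros holS holomorphic_on_subset[OF zeta_reg_holomorphic]) (auto simp: V_def)
  moreover have "zeta_reg s * mellin ?S s = mellin ?F s" if "s \<in> U" for s
    using that F[of s] star_mellin_integrable[OF O, of s]
    by (intro mellin_star_series) (auto simp: U_def)
  \<comment> \<open>The identity holds on \<open>U\<close>, where \<open>Re s > 0\<close>, and is
    continued to the left through 0.\<close>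
  ultimately have eq: "zeta_reg s * mellin ?S s = mellin ?F s" if "s \<in> V" for s
    using analytic_continuation_open[of U V "\<lambda>s. zeta_reg s * mellin ?S s" "mellin ?F" s] holF that by blast
  \<comment> \<open>The translate \<open>z - 1\<close> lies in \<open>- 1 / 2 < Re s < 0\<close>,
    where \<open>mellin_proper\<close> forbids zeros of the transform of \<open>\<phi>\<close>,
    while the zero of zeta at \<open>z\<close> is one of \<open>zeta_reg\<close> at
    \<open>z - 1\<close>.\<close>
  have right: False if z: "1 / 2 < Re z" "Re z < 1" "riemann_zeta z = 0" for z
  proof -
    have "z \<noteq> 1" using z by auto
    then have "zeta_reg (z - 1) = 0" using z zeta_reg_eq[of "z - 1"] by auto
    then have "mellin ?F (z - 1) = 0" using eq[of "z - 1"] z by (auto simp: V_def)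
    then show False using mp z by (auto simp: mellin_proper_def)
  qed
  show ?thesis unfolding riemann_hypothesis_def
  proof (intro allI impI)
    fix s assume s: "0 < Re s \<and> Re s < 1 \<and> riemann_zeta s = 0"
    then have "riemann_zeta (1 - s) = 0" by (intro riemann_zeta_zero_reflection) auto
    then show "Re s = 1 / 2" using right[of s] right[of "1 - s"] s by force
  qed
qed

lemma decay_if_riemann_hypothesis:
  assumes RH: riemann_hypothesis and mp: "mellin_proper (\<lambda>t. \<phi> (complex_of_real t))" and \<epsilon>: "\<epsilon> > 0"
  shows "(\<lambda>x::real. star_series a (complex_of_real x)) \<in> O[at_top](\<lambda>x. complex_of_real (x powr (- 1 / 2 + \<epsilon>)))"
proof -
  \<comment> \<open>Inside the strip this is the Riemann hypothesis; for \<open>Re s \<ge> 1\<close>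
    it is \<open>riemann_zeta_nonzero\<close>.\<close>
  have nz: "riemann_zeta s \<noteq> 0" if "Re s > 1 / 2" "s \<noteq> 1" for s
    using RH that riemann_zeta_nonzero[of s] unfolding riemann_hypothesis_def by force
  \<comment> \<open>Capped at \<open>1 / 2\<close>, so that the exponent \<open>- 1 / 2 + e\<close>
    is not positive and lies in the range of \<open>proper_fun\<close>. For larger
    \<open>\<epsilon>\<close> the claim is weaker, as \<open>x \<ge> 1\<close>.\<close>
  define e where "e = min \<epsilon> (1 / 2)"
  have e: "0 < e" "e \<le> 1 / 2" "e \<le> \<epsilon>" using \<epsilon> by (auto simp: e_def)
  have "mellin_integrable (\<lambda>t. \<phi> (complex_of_real t)) (of_real (- 1 / 2 + e))"
    using mp e unfolding mellin_proper_def proper_fun_def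
    by (intro mellin_integrable_of_norm[OF phi_measurable _ refl]) auto
  then obtain K where K: "\<And>x. x > 0 \<Longrightarrow> norm (star_series a (of_real x)) \<le> K * x powr (- 1 / 2 + e)"
    using star_series_decay[OF nz e(1,2)] by blast
  show ?thesis
  proof (rule landau_o.bigI[of "\<bar>K\<bar> + 1"])
    show "\<forall>\<^sub>F x in at_top. norm (star_series a (complex_of_real x)) \<le> (\<bar>K\<bar> + 1) * norm (complex_of_real (x powr (- 1 / 2 + \<epsilon>)))"
      using eventually_ge_at_top[of 1]
    proof eventually_elim
      case (elim x)
      have "norm (star_series a (of_real x)) \<le> K * x powr (- 1 / 2 + e)" using K elim by simp
      also have "\<dots> \<le> (\<bar>K\<bar> + 1) * x powr (- 1 / 2 + \<epsilon>)"
        using elim e by (intro mult_mono powr_mono) auto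
      finally show ?case by simp
    qed
  qed simp
qed

end

theorem theorem3p6:
  fixes \<phi> :: "complex \<Rightarrow> complex" and a :: "nat \<Rightarrow> complex"
  assumes "\<phi> holomorphic_on UNIV"
    and "\<And>z. (\<lambda>n. a (Suc n) * z ^ Suc n) sums \<phi> z"
    and "mellin_proper (\<lambda>t. \<phi> (complex_of_real t))"
  shows "riemann_hypothesis \<longleftrightarrow>
    (\<forall>\<epsilon>>0. (\<lambda>x::real. star_series a (complex_of_real x))
        \<in> O[at_top](\<lambda>x. complex_of_real (x powr (- 1 / 2 + \<epsilon>))))"
proof -
  interpret entire_series \<phi> a
    by standard (rule assms(2))
  show ?thesis
    using riemann_hypothesis_if_decay decay_if_riemann_hypothesis assms(3) by blast
qed

end
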